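(* Let $0<\lambda\le 1$ and $0<\alpha\le 1$ be fixed. Then, as $T\to+\infty$, $$\sum_{0<\gamma\le T}\left(\beta-\frac12\right)=\frac{T}{4\pi}\log\frac{\alpha}{\lambda}+O(\log T),$$ where the sum runs over all nontrivial zeros $\rho=\beta+i\gamma$ of the Lerch zeta-function $L(\lambda,\alpha,s)$ with $0<\gamma\le T$.
   Context: For $0<\lambda,\alpha\le 1$ the Lerch zeta-function is defined by $L(\lambda,\alpha,s)=\sum_{m=0}^\infty \frac{e^{2\pi i\lambda m}}{(m+\alpha)^s}$ for $\operatorname{Re}s>1$, and by analytic continuation to the whole complex plane except for a possible simple pole at $s=1$. Write $s=\sigma+it$. A zero of $L(\lambda,\alpha,s)$ is called nontrivial if it lies in the strip $-1\le\sigma<1+\alpha$; a nontrivial zero is denoted $\rho=\beta+i\gamma$ with $\beta,\gamma$ real. Zeros are counted with multiplicity. The parameters $\lambda,\alpha$ are fixed constants, so the implied constant may depend on them. *)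

theory Defs
  imports
    "HOL-Complex_Analysis.Complex_Analysis"
    "HOL-Library.Landau_Symbols"
begin

definition is_lerch_continuation :: "real \<Rightarrow> real \<Rightarrow> (complex \<Rightarrow> complex) \<Rightarrow> bool" where
  "is_lerch_continuation lam \<alpha> f \<longleftrightarrow>
     f nicely_meromorphic_on UNIV \<and>
     f holomorphic_on (- {1}) \<and>
     (\<forall>s. Re s > 1 \<longrightarrow>
        (\<lambda>m::nat. exp (2 * of_real pi * \<i> * of_real lam * of_nat m)
                    / of_real (real m + \<alpha>) powr s) sums f s)"

(* nicely_meromorphic_on also fixes the value at 1: it is 0 if 1 is a pole, and the
   limit there otherwise. Hence the continuation is unique as a total function. *)
lemma is_lerch_continuation_unique:
  assumes f: "is_lerch_continuation lam \<alpha> f" and g: "is_lerch_continuation lam \<alpha> g"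
  shows "f = g"
proof -
  have eq: "f z = g z" if "z \<noteq> 1" for z
  proof (rule analytic_continuation_open[of "{s. Re s > 1}" "- {1}" f g])
    show "open {s. Re s > 1}" by (simp add: open_halfspace_Re_gt)
    have "2 \<in> {s. Re s > 1}" by simp
    then show "{s. Re s > 1} \<noteq> {}" by blast
    show "connected (- {1::complex})" by (simp add: connected_punctured_universe)
    show "f w = g w" if "w \<in> {s. Re s > 1}" for w
      using f g that unfolding is_lerch_continuation_def by (auto intro: sums_unique2)
  qed (use f g that in \<open>auto simp: is_lerch_continuation_def\<close>)
  have "eventually (\<lambda>z. f z = g z) (at 1)"
    using eq by (auto simp: eventually_at_filter)
  then have lim: "filterlim f F (at 1) \<longleftrightarrow> filterlim g F (at 1)" for F
    by (intro filterlim_cong refl)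
  then have pole: "is_pole f 1 \<longleftrightarrow> is_pole g 1"
    by (simp add: is_pole_def)
  have "f 1 = g 1"
  proof (cases "is_pole f 1")
    case True
    with f g pole show ?thesis
      unfolding is_lerch_continuation_def nicely_meromorphic_on_def
      by (metis UNIV_I is_pole_def not_tendsto_and_filterlim_at_infinity trivial_limit_at)
  next
    case False
    with f g pole have "(f \<longlongrightarrow> f 1) (at 1)" "(g \<longlongrightarrow> g 1) (at 1)"
      unfolding is_lerch_continuation_def nicely_meromorphic_on_def by blast+
    with lim show ?thesis using LIM_unique by blast
  qed
  with eq show ?thesis by (metis ext)
qed

definition lerch_zeta :: "real \<Rightarrow> real \<Rightarrow> complex \<Rightarrow> complex" where
  "lerch_zeta lam \<alpha> = (THE f. is_lerch_continuation lam \<alpha> f)"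

(* The pole clause is needed because a pole of lerch_zeta carries the dummy value 0. *)
definition lerch_nontrivial_zeros :: "real \<Rightarrow> real \<Rightarrow> complex set" where
  "lerch_nontrivial_zeros lam \<alpha> =
     {\<rho>. \<not> is_pole (lerch_zeta lam \<alpha>) \<rho> \<and> lerch_zeta lam \<alpha> \<rho> = 0 \<and> -1 \<le> Re \<rho> \<and> Re \<rho> < 1 + \<alpha>}"

end

theory Submission
  imports Defs "HOL-Complex_Analysis.Complex_Analysis" "HOL-Real_Asymp.Real_Asymp"
begin

text \<open>
  The series is a sum of residues of \<open>w powr (- s) * kern lam (w - \<alpha>)\<close>, hence minus the integral of
  this function over the line \<open>Re w = \<alpha>/2\<close>, which yields the continuation. For \<open>Re s < -1\<close> the line is
  moved to \<open>Re w = 0\<close>, where expanding the kernel in a geometric series gives the functional equation.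
  Phragmen--Lindelof then bounds \<open>L\<close> polynomially in vertical strips.

  Integrate \<open>(s - 1/2) * L' s / L s\<close> around the rectangle with \<open>-2 \<le> Re s \<le> 3\<close> and \<open>t1 \<le> Im s \<le> T\<close>,
  \<open>t1\<close> fixed; the imaginary part is \<open>2 * pi\<close> times the sum of \<open>\<beta> - 1/2\<close>. On a vertical side write
  \<open>L = exp l\<close> and integrate by parts. On the right \<open>l s\<close> is \<open>- s * ln \<alpha>\<close> up to the logarithm of a
  Dirichlet series close to \<open>1\<close>, which contributes \<open>T/2 * ln \<alpha>\<close>. On the left the functional equation
  brings in \<open>ln lam\<close> in the same way, while the terms of order \<open>T\<^sup>2\<close> and those with \<open>ln (2 * pi)\<close> coming
  from the Gamma function cancel against the exponential factors. On the top side split the weight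
  into \<open>\<i> * T\<close> and the real number \<open>Re s - 1/2\<close>. The former produces differences of \<open>ln (norm (L s))\<close>
  which cancel against the boundary terms of the vertical sides. The latter contributes \<open>O(ln T)\<close>, after
  dividing out the \<open>O(ln T)\<close> zeros of \<open>L\<close> in a disc around \<open>3 + \<i> * T\<close> and applying Borel--Caratheodory
  to the rest.
\<close>

section \<open>Horizontal segments and half strips\<close>

text \<open>The abscissae \<open>-2\<close> and \<open>3\<close> are symmetric about
  \<open>1/2\<close>, so the weight is \<open>\<plusminus>5/2 + \<i> * t\<close> on the vertical
  sides, and \<open>s\<close> to \<open>1 - s\<close> takes the left side to
  \<open>Re u = 3\<close>, where the dual series are dominated by their first terms. There
  \<open>norm (Gamma (3 - \<i> * t))\<close> grows like \<open>t powr (5/2)\<close> times an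
  exponential; this \<open>5/2\<close> equals the weight, and so no term \<open>T * ln T\<close>
  survives. The obstacle on the top side is a zero of \<open>L\<close> arbitrarily close to it,
  which makes \<open>L' / L\<close> large. It is harmless because only an imaginary part is wanted:
  the remaining weight is real on the segment, so a zero acts only through the angle under which it
  sees the segment, at most \<open>pi\<close>. The radii are nested as 5 < 6 < 18 < 19: the segment
  has length 5, zeros are divided out up to radius 6, the linear factors are compared on the circle
  of radius 18, and \<open>L\<close> is bounded up to radius 19. Radius 19 about
  \<open>3 + \<i> * T\<close> requires the strip from \<open>-16\<close> to \<open>22\<close>; on
  \<open>Re s = -16\<close> the factor \<open>Gamma (17 - \<i> * t)\<close> yields the growth
  exponent 17.\<close>

lemma borel_caratheodory_deriv:
  fixes h :: "complex \<Rightarrow> complex"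
  assumes hol: "h holomorphic_on ball c 6" and h0: "h c = 0" and K: "K > 0"
    and Re: "\<And>z. z \<in> ball c 6 \<Longrightarrow> Re (h z) < K" and z: "dist c z \<le> 5"
  shows "norm (deriv h z) \<le> 44 * K"
proof -
  \<comment> \<open>This Moebius map takes the half-plane \<open>Re < K\<close> into the unit disc
    and fixes \<open>0\<close>, so the Schwarz lemma applies to \<open>g\<close>.\<close>
  define g where "g w = h (c + 6 * w) / (2 * of_real K - h (c + 6 * w))" for w
  have inb: "c + 6 * w \<in> ball c 6" if "norm w < 1" for w
    using that by (simp add: dist_norm norm_mult)
  have ne: "2 * of_real K - h (c + 6 * w) \<noteq> 0" if "norm w < 1" for w
  proof
    assume "2 * of_real K - h (c + 6 * w) = 0"
    then have "h (c + 6 * w) = 2 * of_real K" by simp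
    then have "Re (h (c + 6 * w)) = 2 * K" by simp
    then show False using Re[OF inb[OF that]] K by simp
  qed
  have lt: "norm (h y) < norm (2 * of_real K - h y)" if "Re (h y) < K" for y
  proof -
    have "(norm (2 * of_real K - h y))\<^sup>2 - (norm (h y))\<^sup>2 = 4 * K * (K - Re (h y))"
      unfolding cmod_power2 by (simp add: power2_eq_square algebra_simps)
    also have "\<dots> > 0" using that K by simp
    finally show ?thesis by (simp add: power2_less_imp_less)
  qed
  have holg: "g holomorphic_on ball 0 1"
    unfolding g_def
    by (intro holomorphic_intros holomorphic_on_compose_gen[OF _ hol, unfolded o_def])
       (use ne inb in auto)
  have g1: "norm (g w) < 1" if "norm w < 1" for w
  proof -
    have "Re (h (c + 6 * w)) < K" using Re[OF inb[OF that]] .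
    from lt[OF this] show ?thesis by (auto simp: g_def norm_divide divide_simps)
  qed
  have gle: "norm (g w) \<le> norm w" if "norm w < 1" for w
    by (rule Schwarz_Lemma(1)[OF holg]) (use g1 that h0 in \<open>auto simp: g_def\<close>)
  \<comment> \<open>Radius \<open>11/2\<close> leaves room for Cauchy circles of radius
    \<open>1/2\<close> about the disc of radius \<open>5\<close>. There
    \<open>norm w \<le> 11/12\<close>, and solving \<open>x \<le> 11/12 * (2 * K + x)\<close> for
    \<open>x\<close> gives \<open>22 * K\<close>.\<close>
  have hle: "norm (h y) \<le> 22 * K" if y: "dist c y \<le> 11/2" for y
  proof -
    define w where "w = (y - c) / 6"
    have yw: "y = c + 6 * w" by (simp add: w_def field_simps)
    have nw: "norm w \<le> 11/12" using y by (simp add: w_def norm_divide dist_norm norm_minus_commute)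
    then have w1: "norm w < 1" by simp
    have gw: "norm (g w) \<le> 11/12" using gle[OF w1] nw by simp
    have "h y = g w * (2 * of_real K - h y)" using ne[OF w1] by (simp add: g_def yw)
    then have "norm (h y) = norm (g w) * norm (2 * of_real K - h y)" by (metis norm_mult)
    also have "\<dots> \<le> 11/12 * (2 * K + norm (h y))"
      using gw K norm_triangle_ineq4[of "2 * of_real K" "h y"] by (intro mult_mono) auto
    finally show ?thesis by simp
  qed
  have "norm ((deriv ^^ 1) h z) \<le> fact 1 * (22 * K) / (1/2) ^ 1"
  proof (rule Cauchy_inequality)
    have sub: "cball z (1/2) \<subseteq> ball c 6"
    proof
      fix y assume "y \<in> cball z (1/2)"
      then show "y \<in> ball c 6" using z dist_triangle[of c y z] by simp
    qed
    show "h holomorphic_on ball z (1/2)"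
      using hol holomorphic_on_subset sub ball_subset_cball by blast
    show "continuous_on (cball z (1/2)) h"
      using hol holomorphic_on_subset sub holomorphic_on_imp_continuous_on by blast
    show "norm (h x) \<le> 22 * K" if "norm (z - x) = 1/2" for x
      using that z dist_triangle[of c x z] by (intro hle) (simp add: dist_norm)
  qed simp
  then show ?thesis by simp
qed

section \<open>Dividing out the zeros of a bounded function in a disc\<close>

text \<open>A count in the manner of Jensen: on the circle of radius 18 every factor has modulus at
  least 12, at the centre at most 6, so every zero costs a factor 2 between
  \<open>norm (f c)\<close> and \<open>M\<close>. The same comparison bounds the cofactor in terms
  of its value at the centre.\<close>

lemma linear_factors_bound:
  fixes f g :: "complex \<Rightarrow> complex"
  assumes holg: "g holomorphic_on ball c 19"
    and fg: "\<And>z. z \<in> ball c 19 \<Longrightarrow> f z = g z * (\<Prod>a\<leftarrow>zs. z - a)"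
    and M: "\<And>z. z \<in> ball c 19 \<Longrightarrow> norm (f z) \<le> M" and fc: "f c \<noteq> 0"
    and zs: "set zs \<subseteq> cball c 6"
  shows "2 ^ length zs \<le> M / norm (f c)"
    and "\<And>z. z \<in> cball c 18 \<Longrightarrow> norm (g z) \<le> M / norm (f c) * norm (g c)"
proof -
  let ?n = "length zs"
  have lower: "12 ^ ?n \<le> norm (\<Prod>a\<leftarrow>zs. z - a)" if "dist c z = 18" for z
    using zs
  proof (induction zs)
    case (Cons a zs)
    have "12 \<le> norm (z - a)"
      using Cons.prems that dist_triangle[of c z a] by (simp add: dist_norm norm_minus_commute)
    then show ?case using Cons by (auto simp: norm_mult intro!: mult_mono)
  qed auto
  have upper: "norm (\<Prod>a\<leftarrow>zs. c - a) \<le> 6 ^ ?n"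
    using zs
  proof (induction zs)
    case (Cons a zs)
    then show ?case by (auto simp: norm_mult dist_norm intro!: mult_mono)
  qed auto
  have M0: "M \<ge> 0" using M[of c] order_trans[OF norm_ge_zero[of "f c"]] by simp
  have gb: "norm (g z) \<le> M / 12 ^ ?n" if "z \<in> cball c 18" for z
  proof (rule maximum_modulus_frontier[of g "cball c 18"])
    show "g holomorphic_on interior (cball c 18)"
      using holg by (rule holomorphic_on_subset) auto
    show "continuous_on (closure (cball c 18)) g"
      by (rule holomorphic_on_imp_continuous_on, rule holomorphic_on_subset[OF holg]) auto
    show "norm (g w) \<le> M / 12 ^ ?n" if "w \<in> frontier (cball c 18)" for w
    proof -
      have dw: "dist c w = 18" using that by simp
      have "norm (g w) * 12 ^ ?n \<le> norm (g w) * norm (\<Prod>a\<leftarrow>zs. w - a)"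
        using lower[OF dw] by (intro mult_left_mono) auto
      also have "\<dots> = norm (f w)" using fg[of w] dw by (simp add: norm_mult)
      also have "\<dots> \<le> M" using M dw by simp
      finally show ?thesis by (simp add: field_simps)
    qed
  qed (use that in auto)
  have fcle: "norm (f c) \<le> norm (g c) * 6 ^ ?n"
    using fg[of c] upper by (auto simp: norm_mult intro!: mult_left_mono)
  have "norm (f c) \<le> M / 12 ^ ?n * 6 ^ ?n"
    using fcle gb[of c] by (smt (verit, best) centre_in_cball mult_right_mono zero_le_power)
  also have "M / 12 ^ ?n * 6 ^ ?n = M / 2 ^ ?n"
  proof -
    have "(12::real) ^ ?n = 2 ^ ?n * 6 ^ ?n" by (simp flip: power_mult_distrib)
    then show ?thesis by simp
  qed
  finally show "2 ^ ?n \<le> M / norm (f c)" using fc by (simp add: field_simps)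
  fix z assume z: "z \<in> cball c 18"
  have "norm (g z) * norm (f c) \<le> M / 12 ^ ?n * (norm (g c) * 6 ^ ?n)"
    using gb[OF z] fcle M0 by (intro mult_mono) auto
  also have "\<dots> = M * norm (g c) * (6 ^ ?n / 12 ^ ?n)" by simp
  also have "\<dots> \<le> M * norm (g c) * 1"
    using M0 by (intro mult_left_mono) (auto simp: power_mono)
  finally show "norm (g z) \<le> M / norm (f c) * norm (g c)" using fc by (simp add: field_simps)
qed

text \<open>Take a factorisation with as many linear factors as possible. A maximum exists by the
  count in \<open>linear_factors_bound\<close>, and a zero of \<open>g\<close> in the smaller disc
  would allow one more factor. Multiple zeros are thus repeated in the list without any mention of
  their order.\<close>

lemma factor_zeros_disc:
  fixes f :: "complex \<Rightarrow> complex"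
  assumes hol: "f holomorphic_on ball c 19"
    and M: "\<And>z. z \<in> ball c 19 \<Longrightarrow> norm (f z) \<le> M" and fc: "f c \<noteq> 0"
  obtains g zs where "g holomorphic_on ball c 19" "set zs \<subseteq> cball c 6"
    "\<And>z. z \<in> ball c 19 \<Longrightarrow> f z = g z * (\<Prod>a\<leftarrow>zs. z - a)"
    "\<And>z. z \<in> cball c 6 \<Longrightarrow> g z \<noteq> 0"
proof -
  define P where "P n \<longleftrightarrow> (\<exists>g zs. g holomorphic_on ball c 19 \<and> set zs \<subseteq> cball c 6 \<and> length zs = n \<and>
     (\<forall>z \<in> ball c 19. f z = g z * (\<Prod>a\<leftarrow>zs. z - a)))" for n
  obtain B :: nat where B: "M / norm (f c) < 2 ^ B" using real_arch_pow[of 2 "M / norm (f c)"] by auto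
  have "P 0" unfolding P_def using hol by (intro exI[of _ f] exI[of _ "[]"]) auto
  moreover have "n \<le> B" if Pn: "P n" for n
  proof -
    obtain g zs where *: "g holomorphic_on ball c 19" "set zs \<subseteq> cball c 6" "length zs = n"
      "\<forall>z \<in> ball c 19. f z = g z * (\<Prod>a\<leftarrow>zs. z - a)" using Pn unfolding P_def by blast
    have "2 ^ n \<le> M / norm (f c)"
      using linear_factors_bound(1)[of g c f zs M] * M fc by auto
    then have "(2::real) ^ n < 2 ^ B" using B by linarith
    then show ?thesis by simp
  qed
  ultimately have "\<exists>n. P n \<and> (\<forall>m. P m \<longrightarrow> m \<le> n)"
    using ex_has_greatest_nat[of P 0 id "Suc B"] less_Suc_eq_le by auto
  then obtain n where n: "P n" "\<And>m. P m \<Longrightarrow> m \<le> n" by blast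
  then obtain g zs where *: "g holomorphic_on ball c 19" "set zs \<subseteq> cball c 6" "length zs = n"
      "\<And>z. z \<in> ball c 19 \<Longrightarrow> f z = g z * (\<Prod>a\<leftarrow>zs. z - a)" unfolding P_def by blast
  have "g z \<noteq> 0" if z: "z \<in> cball c 6" for z
  proof
    assume g0: "g z = 0"
    \<comment> \<open>The difference quotient with its removable singularity filled in; it is the
      cofactor of the longer list \<open>z # zs\<close>.\<close>
    define k where "k w = (if w = z then deriv g z else (g w - g z) / (w - z))" for w
    have "k holomorphic_on ball c 19"
      unfolding k_def using pole_lemma_open[OF *(1), of z] by simp
    moreover have "g w = k w * (w - z)" for w by (simp add: k_def g0)
    ultimately have "P (Suc n)"
      unfolding P_def using * z by (intro exI[of _ k] exI[of _ "z # zs"]) (auto simp: mult_ac)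
    with n(2) show False by force
  qed
  with * show ?thesis using that by blast
qed

section \<open>Logarithmic derivatives along a horizontal segment\<close>

text \<open>On the segment the numerator is real and at most \<open>5/2\<close> in modulus, while
  \<open>Im (1 / (z - a))\<close> has constant sign and integrates, up to sign, to the angle that
  the segment subtends at \<open>a\<close>. Hence the bound does not depend on how close
  \<open>a\<close> is.\<close>

lemma Im_contour_integral_linear_bound:
  fixes a c :: complex
  assumes a: "a \<notin> closed_segment (c - 5) c"
  shows "\<bar>Im (contour_integral (linepath (c - 5) c) (\<lambda>z. (z - (c - 5/2)) / (z - a)))\<bar> \<le> 5/2 * pi"
proof -
  define d where "d = \<bar>Im c - Im a\<bar>"
  define u where "u x = Re c - 5 + 5 * x - Re a" for x :: real
  let ?F = "\<lambda>z. (z - (c - 5/2)) / (z - a)"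
  let ?lp = "linepath (c - 5) c"
  have "continuous_on (closed_segment (c - 5) c) ?F"
    using a by (intro continuous_intros) auto
  then have "?F contour_integrable_on ?lp" by (rule contour_integrable_continuous_linepath)
  then have hi: "((\<lambda>x. ?F (?lp x) * 5) has_integral contour_integral ?lp ?F) {0..1}"
    using has_contour_integral_linepath[of ?F _ "c - 5" c] has_contour_integral_integral by force
  have him: "((\<lambda>x. Im (?F (?lp x) * 5)) has_integral Im (contour_integral ?lp ?F)) {0..1}"
    using has_integral_linear[OF hi bounded_linear_Im] by (simp add: o_def)
  have lp: "Re (?lp x) = Re c - 5 + 5 * x" "Im (?lp x) = Im c" for x
    by (simp_all add: linepath_def algebra_simps)
  show ?thesis
  \<comment> \<open>If \<open>a\<close> lies on the line through the segment, the integrand is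
    real.\<close>
  proof (cases "d = 0")
    case True
    then have "Im (?F (?lp x)) = 0" for x
      by (simp add: d_def lp Im_divide)
    then have "Im (?F (?lp x) * 5) = 0" for x by (simp only: Im_complex_of_real mult.commute times_complex.simps) simp
    then have "Im (contour_integral ?lp ?F) = 0"
      using him by (metis (no_types, lifting) has_integral_is_0 has_integral_unique)
    then show ?thesis by simp
  next
    case False
    then have d: "d > 0" by (auto simp: d_def)
    have gi: "((\<lambda>x. 25/2 * (d / ((u x)\<^sup>2 + d\<^sup>2))) has_integral
        (5/2 * arctan (u 1 / d) - 5/2 * arctan (u 0 / d))) {0..1}"
    proof (rule fundamental_theorem_of_calculus)
      show "((\<lambda>x. 5/2 * arctan (u x / d)) has_vector_derivative 25/2 * (d / ((u x)\<^sup>2 + d\<^sup>2)))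
        (at x within {0..1})" for x
      proof -
        have e: "1 + (u x / d)\<^sup>2 = ((u x)\<^sup>2 + d\<^sup>2) / d\<^sup>2" using d by (simp add: field_simps)
        have pos: "(u x)\<^sup>2 + d\<^sup>2 > 0" using d by (simp add: add_nonneg_pos)
        have "((\<lambda>x. 5/2 * arctan (u x / d)) has_real_derivative 5/2 * (inverse (1 + (u x / d)\<^sup>2) * (5 / d))) (at x within {0..1})"
          unfolding u_def using d by (auto intro!: derivative_eq_intros)
        also have "5/2 * (inverse (1 + (u x / d)\<^sup>2) * (5 / d)) = 25/2 * (d / ((u x)\<^sup>2 + d\<^sup>2))"
          unfolding e using d pos by (simp add: field_simps power2_eq_square)
        finally show ?thesis by (simp add: has_real_derivative_iff_has_vector_derivative)
      qed
    qed simp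
    have bnd: "norm (Im (?F (?lp x) * 5)) \<le> 25/2 * (d / ((u x)\<^sup>2 + d\<^sup>2))" if x: "x \<in> {0..1}" for x
    proof -
      let ?z = "?lp x"
      have zr: "?z - (c - 5/2) = of_real (5 * x - 5/2)"
        by (simp add: complex_eq_iff lp)
      have za: "?z - a = Complex (u x) (Im c - Im a)" by (simp add: complex_eq_iff lp u_def)
      have "Im (?F ?z) = - ((5 * x - 5/2) * (Im c - Im a) / ((u x)\<^sup>2 + (Im c - Im a)\<^sup>2))"
        unfolding zr za by (simp add: Im_divide)
      then have "\<bar>Im (?F ?z)\<bar> = \<bar>5 * x - 5/2\<bar> * (d / ((u x)\<^sup>2 + d\<^sup>2))"
        by (simp add: abs_mult d_def)
      also have "\<dots> \<le> 5/2 * (d / ((u x)\<^sup>2 + d\<^sup>2))"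
        using x d by (intro mult_right_mono abs_leI) auto
      finally have "\<bar>Im (?F ?z)\<bar> * 5 \<le> 25/2 * (d / ((u x)\<^sup>2 + d\<^sup>2))" by simp
      moreover have "Im (?F ?z * 5) = Im (?F ?z) * 5" by (simp only: times_complex.simps) simp
      ultimately show ?thesis by (simp add: abs_mult del: times_complex.simps mult.commute)
    qed
    have "norm (integral {0..1} (\<lambda>x. Im (?F (?lp x) * 5))) \<le> integral {0..1} (\<lambda>x. 25/2 * (d / ((u x)\<^sup>2 + d\<^sup>2)))"
      by (rule integral_norm_bound_integral) (use him gi bnd in \<open>auto intro: has_integral_integrable\<close>)
    then have "\<bar>Im (contour_integral ?lp ?F)\<bar> \<le> 5/2 * arctan (u 1 / d) - 5/2 * arctan (u 0 / d)"
      using integral_unique[OF him] integral_unique[OF gi] by simp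
    also have "\<dots> \<le> 5/2 * pi"
      using arctan_ubound[of "u 1 / d"] arctan_lbound[of "u 0 / d"] by (simp add: field_simps)
    finally show ?thesis .
  qed
qed

text \<open>The winding number of the open path plays the role of a continuous logarithm of
  \<open>z - a\<close>, so that no branch of \<open>Ln\<close> has to be followed.\<close>

lemma Re_contour_integral_inverse:
  fixes a :: complex
  assumes "a \<notin> closed_segment p q"
  shows "Re (contour_integral (linepath p q) (\<lambda>z. 1 / (z - a))) = ln (norm (q - a)) - ln (norm (p - a))"
proof -
  let ?I = "contour_integral (linepath p q) (\<lambda>z. 1 / (z - a))"
  have w: "winding_number (linepath p q) a = 1 / (2 * pi * \<i>) * ?I"
    by (rule winding_number_valid_path) (use assms in auto)
  have "q - a = exp (2 * pi * \<i> * winding_number (linepath p q) a) * (p - a)"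
    using winding_number_exp_2pi[of "linepath p q" a] assms by auto
  also have "2 * pi * \<i> * winding_number (linepath p q) a = ?I" unfolding w by simp
  finally have "norm (q - a) = exp (Re ?I) * norm (p - a)" by (metis norm_exp_eq_Re norm_mult)
  moreover have "p \<noteq> a" "q \<noteq> a" using assms by auto
  ultimately show ?thesis by (simp add: ln_mult)
qed

lemma has_field_derivative_prod_linear:
  fixes z :: complex
  assumes "z \<notin> set zs"
  shows "((\<lambda>z. \<Prod>a\<leftarrow>zs. z - a) has_field_derivative (\<Prod>a\<leftarrow>zs. z - a) * (\<Sum>a\<leftarrow>zs. 1 / (z - a))) (at z)"
  using assms
proof (induction zs)
  case (Cons a zs)
  then have *: "((\<lambda>z. \<Prod>a\<leftarrow>zs. z - a) has_field_derivative (\<Prod>a\<leftarrow>zs. z - a) * (\<Sum>a\<leftarrow>zs. 1 / (z - a))) (at z)"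
    and ne: "z \<noteq> a" by auto
  have "((\<lambda>z. (z - a) * (\<Prod>a\<leftarrow>zs. z - a)) has_field_derivative
     ((z - a) * ((\<Prod>a\<leftarrow>zs. z - a) * (\<Sum>a\<leftarrow>zs. 1 / (z - a))) + 1 * (\<Prod>a\<leftarrow>zs. z - a))) (at z)"
    by (rule DERIV_mult'[OF _ *]) (auto intro!: derivative_eq_intros)
  also have "(z - a) * ((\<Prod>a\<leftarrow>zs. z - a) * (\<Sum>a\<leftarrow>zs. 1 / (z - a))) + 1 * (\<Prod>a\<leftarrow>zs. z - a) =
     (z - a) * (\<Prod>a\<leftarrow>zs. z - a) * (1 / (z - a) + (\<Sum>a\<leftarrow>zs. 1 / (z - a)))"
    using ne by (simp add: field_simps)
  finally show ?case by simp
qed auto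

lemma contour_integral_sum_list:
  assumes "\<And>a. a \<in> set zs \<Longrightarrow> F a contour_integrable_on p"
  shows "(\<lambda>z. \<Sum>a\<leftarrow>zs. F a z) contour_integrable_on p \<and>
     contour_integral p (\<lambda>z. \<Sum>a\<leftarrow>zs. F a z) = (\<Sum>a\<leftarrow>zs. contour_integral p (F a))"
  using assms
proof (induction zs)
  case Nil
  then show ?case by (auto simp: contour_integrable_on_def intro: has_contour_integral_0)
qed (auto simp: contour_integral_add contour_integrable_add)

text \<open>The unweighted integral will be multiplied by \<open>\<i> * T\<close> before an
  imaginary part is taken; this is why its real part is wanted, which is exact and involves no
  argument of \<open>f\<close>. The second integral carries the real weight that is left
  over.\<close>

theorem horizontal_log_derivative:
  fixes f :: "complex \<Rightarrow> complex"
  assumes hol: "f holomorphic_on ball c 19"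
    and M: "\<And>z. z \<in> ball c 19 \<Longrightarrow> norm (f z) \<le> M"
    and nz: "\<And>z. z \<in> closed_segment (c - 5) c \<Longrightarrow> f z \<noteq> 0"
  shows "Re (contour_integral (linepath (c - 5) c) (\<lambda>z. deriv f z / f z)) = ln (norm (f c)) - ln (norm (f (c - 5)))"
    and "\<bar>Im (contour_integral (linepath (c - 5) c) (\<lambda>z. (z - (c - 5/2)) * (deriv f z / f z)))\<bar>
           \<le> 600 * (ln (M / norm (f c)) + 1)"
proof -
  let ?S = "closed_segment (c - 5) c" and ?lp = "linepath (c - 5) c"
  have fc: "f c \<noteq> 0" using nz by auto
  obtain g zs where g: "g holomorphic_on ball c 19" "set zs \<subseteq> cball c 6"
    and fg: "\<And>z. z \<in> ball c 19 \<Longrightarrow> f z = g z * (\<Prod>a\<leftarrow>zs. z - a)"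
    and gnz: "\<And>z. z \<in> cball c 6 \<Longrightarrow> g z \<noteq> 0"
    using factor_zeros_disc[OF hol M fc] by blast
  let ?n = "length zs"
  note bound = linear_factors_bound[OF g(1) fg M fc g(2)]
  define \<Lambda> where "\<Lambda> = ln (M / norm (f c))"
  have Mf: "M / norm (f c) \<ge> 1" using bound(1) one_le_power[of "2::real" ?n] by linarith
  have \<Lambda>0: "\<Lambda> \<ge> 0" using Mf by (simp add: \<Lambda>_def)
  have "real ?n * ln 2 \<le> \<Lambda>"
    using bound(1) Mf unfolding \<Lambda>_def by (metis ln_mono ln_realpow zero_less_numeral zero_less_power)
  moreover have "ln 2 \<ge> (1/2::real)" using ln2_ge_two_thirds by simp
  ultimately have n: "real ?n \<le> 2 * \<Lambda>"
    using mult_left_mono[of "1/2" "ln 2" "real ?n"] by simp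
  have "\<exists>h. h holomorphic_on ball c 6 \<and> (\<forall>z\<in>ball c 6. g z = exp (h z))"
  proof -
    have "g holomorphic_on ball c 6" by (rule holomorphic_on_subset[OF g(1)]) auto
    from contractible_imp_holomorphic_log[OF this convex_imp_contractible[OF convex_ball]] gnz show ?thesis by (metis ball_subset_cball subsetD)
  qed
  then obtain h0 where h0: "h0 holomorphic_on ball c 6" "\<And>z. z \<in> ball c 6 \<Longrightarrow> g z = exp (h0 z)" by blast
  \<comment> \<open>Normalised to vanish at \<open>c\<close>, as
    \<open>borel_caratheodory_deriv\<close> demands.\<close>
  define h where "h z = h0 z - h0 c" for z
  have hol_h: "h holomorphic_on ball c 6" unfolding h_def using h0 by (intro holomorphic_intros)
  have gh: "g z = g c * exp (h z)" if "z \<in> ball c 6" for z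
    using h0(2)[of c] h0(2)[OF that] by (simp add: h_def exp_diff)
  \<comment> \<open>The summand \<open>1\<close> makes the bound strict and positive even if
    \<open>\<Lambda> = 0\<close>.\<close>
  have Reh: "Re (h z) < \<Lambda> + 1" if "z \<in> ball c 6" for z
  proof -
    have "norm (g z) \<le> M / norm (f c) * norm (g c)" using bound(2)[of z] that by simp
    then have "exp (Re (h z)) \<le> M / norm (f c)"
      using gh[OF that] gnz[of c] by (simp add: norm_mult mult.commute[of "norm (g c)"] flip: times_divide_eq_left)
    also have "\<dots> = exp \<Lambda>" using Mf by (simp add: \<Lambda>_def)
    finally show ?thesis by simp
  qed
  have dh: "norm (deriv h z) \<le> 44 * (\<Lambda> + 1)" if "dist c z \<le> 5" for z
    by (rule borel_caratheodory_deriv[OF hol_h]) (use \<Lambda>0 Reh that in \<open>auto simp: h_def\<close>)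
  have S_ball: "dist c z \<le> 5" if "z \<in> ?S" for z
    using segment_bound(2)[OF that] by (simp add: dist_norm norm_minus_commute)
  have zsS: "a \<notin> ?S" if "a \<in> set zs" for a
  proof
    assume aS: "a \<in> ?S"
    have "(\<Prod>a\<leftarrow>zs. a' - a) = 0" if "a' = a" for a'
      using \<open>a \<in> set zs\<close> that by (auto simp: prod_list_zero_iff)
    then have "(\<Prod>b\<leftarrow>zs. a - b) = 0" using \<open>a \<in> set zs\<close> by (auto simp: prod_list_zero_iff image_iff)
    then have "f a = 0" using fg[of a] S_ball[OF aS] by simp
    with nz[OF aS] show False by simp
  qed
  have logd: "deriv f z / f z = deriv h z + (\<Sum>a\<leftarrow>zs. 1 / (z - a))" if z: "z \<in> ?S" for z
  proof -
    have zb: "z \<in> ball c 6" using S_ball[OF z] by simp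
    have znot: "z \<notin> set zs" using zsS z by blast
    have dhz: "(h has_field_derivative deriv h z) (at z)"
      using hol_h zb by (meson holomorphic_derivI open_ball)
    let ?p = "\<Prod>a\<leftarrow>zs. z - a" and ?s = "\<Sum>a\<leftarrow>zs. 1 / (z - a)"
    have "((\<lambda>z. g c * exp (h z)) has_field_derivative g c * (exp (h z) * deriv h z)) (at z)"
      by (intro DERIV_cmult DERIV_chain2[OF DERIV_exp dhz])
    from DERIV_mult'[OF this has_field_derivative_prod_linear[OF znot]]
    have "((\<lambda>z. g c * exp (h z) * (\<Prod>a\<leftarrow>zs. z - a)) has_field_derivative
       g c * exp (h z) * (?p * ?s) + g c * (exp (h z) * deriv h z) * ?p) (at z)" .
    moreover have "f z = g c * exp (h z) * ?p"
      using fg[of z] gh[OF zb] zb by simp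
    then have "g c * exp (h z) * (?p * ?s) + g c * (exp (h z) * deriv h z) * ?p = f z * (deriv h z + ?s)"
      by (simp add: distrib_left)
    ultimately have "((\<lambda>z. g c * exp (h z) * (\<Prod>a\<leftarrow>zs. z - a)) has_field_derivative
       f z * (deriv h z + ?s)) (at z)" by simp
    then have "(f has_field_derivative f z * (deriv h z + ?s)) (at z)"
    proof (rule has_field_derivative_transform_within_open[OF _ open_ball zb])
      show "g c * exp (h w) * (\<Prod>a\<leftarrow>zs. w - a) = f w" if "w \<in> ball c 6" for w
        using fg[of w] gh[OF that] that by simp
    qed
    then show ?thesis using nz[OF z] by (simp add: DERIV_imp_deriv)
  qed
  have dh_cont: "continuous_on ?S (deriv h)"
  proof (rule continuous_on_subset)
    show "continuous_on (ball c 6) (deriv h)"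
      using hol_h by (intro holomorphic_on_imp_continuous_on holomorphic_deriv) auto
    show "?S \<subseteq> ball c 6" using S_ball by force
  qed
  have int1: "(\<lambda>z. 1 / (z - a)) contour_integrable_on ?lp"
    and int2: "(\<lambda>z. (z - (c - 5/2)) / (z - a)) contour_integrable_on ?lp" if "a \<in> set zs" for a
    by (rule contour_integrable_continuous_linepath; use zsS[OF that] in \<open>auto intro!: continuous_intros\<close>)+
  have int3: "deriv h contour_integrable_on ?lp" "(\<lambda>z. (z - (c - 5/2)) * deriv h z) contour_integrable_on ?lp"
    by (intro contour_integrable_continuous_linepath continuous_intros dh_cont)+
  note s1 = contour_integral_sum_list[of zs "\<lambda>a z. 1 / (z - a)", OF int1]
  note s2 = contour_integral_sum_list[of zs "\<lambda>a z. (z - (c - 5/2)) / (z - a)", OF int2]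
  have cS: "c \<in> ?S" "c - 5 \<in> ?S" by auto
  have primh: "contour_integral ?lp (deriv h) = h c - h (c - 5)"
  proof -
    have "(deriv h has_contour_integral h (pathfinish ?lp) - h (pathstart ?lp)) ?lp"
    proof (rule contour_integral_primitive)
      show "(h has_field_derivative deriv h x) (at x within ball c 6)" if "x \<in> ball c 6" for x
        using hol_h that by (meson holomorphic_derivI open_ball)
    qed (use S_ball in force)+
    then show ?thesis by (simp add: contour_integral_unique)
  qed
  have "contour_integral ?lp (\<lambda>z. deriv f z / f z) = contour_integral ?lp (\<lambda>z. deriv h z + (\<Sum>a\<leftarrow>zs. 1 / (z - a)))"
    by (rule contour_integral_eq) (use logd in auto)
  also have "\<dots> = h c - h (c - 5) + (\<Sum>a\<leftarrow>zs. contour_integral ?lp (\<lambda>z. 1 / (z - a)))"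
    using s1 int3 primh by (simp add: contour_integral_add)
  finally have I1: "contour_integral ?lp (\<lambda>z. deriv f z / f z) = \<dots>" .
  have lnf: "ln (norm (f z)) = ln (norm (g c)) + Re (h z) + (\<Sum>a\<leftarrow>zs. ln (norm (z - a)))" if z: "z \<in> ?S" for z
  proof -
    have znot: "z \<notin> set zs" using zsS z by blast
    then have *: "ln (norm (\<Prod>a\<leftarrow>zs. z - a)) = (\<Sum>a\<leftarrow>zs. ln (norm (z - a))) \<and> (\<Prod>a\<leftarrow>zs. z - a) \<noteq> 0"
      by (induction zs) (auto simp: norm_mult ln_mult)
    have "f z = g c * exp (h z) * (\<Prod>a\<leftarrow>zs. z - a)" using fg[of z] gh[of z] S_ball[OF z] by simp
    moreover have "g c \<noteq> 0" using gnz[of c] by simp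
    ultimately show ?thesis using * by (simp add: norm_mult ln_mult)
  qed
  have "Re (\<Sum>a\<leftarrow>zs. contour_integral ?lp (\<lambda>z. 1 / (z - a))) =
     (\<Sum>a\<leftarrow>zs. ln (norm (c - a))) - (\<Sum>a\<leftarrow>zs. ln (norm (c - 5 - a)))"
    using zsS
  proof (induction zs)
    case (Cons a zs)
    have "Re (contour_integral ?lp (\<lambda>z. 1 / (z - a))) = ln (norm (c - a)) - ln (norm (c - 5 - a))"
      using Cons.prems by (intro Re_contour_integral_inverse) auto
    moreover have "Re (\<Sum>a\<leftarrow>zs. contour_integral ?lp (\<lambda>z. 1 / (z - a))) =
     (\<Sum>a\<leftarrow>zs. ln (norm (c - a))) - (\<Sum>a\<leftarrow>zs. ln (norm (c - 5 - a)))"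
      using Cons by auto
    ultimately show ?case by simp
  qed auto
  then show "Re (contour_integral ?lp (\<lambda>z. deriv f z / f z)) = ln (norm (f c)) - ln (norm (f (c - 5)))"
    unfolding I1 lnf[OF cS(1)] lnf[OF cS(2)] by simp
  have "contour_integral ?lp (\<lambda>z. (z - (c - 5/2)) * (deriv f z / f z))
      = contour_integral ?lp (\<lambda>z. (z - (c - 5/2)) * deriv h z + (\<Sum>a\<leftarrow>zs. (z - (c - 5/2)) / (z - a)))"
    by (rule contour_integral_eq) (use logd in \<open>auto simp: distrib_left sum_list_const_mult[symmetric]\<close>)
  also have "\<dots> = contour_integral ?lp (\<lambda>z. (z - (c - 5/2)) * deriv h z)
       + (\<Sum>a\<leftarrow>zs. contour_integral ?lp (\<lambda>z. (z - (c - 5/2)) / (z - a)))"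
    using s2 int3 by (simp add: contour_integral_add)
  finally have I2: "contour_integral ?lp (\<lambda>z. (z - (c - 5/2)) * (deriv f z / f z)) = \<dots>" .
  have A: "norm (contour_integral ?lp (\<lambda>z. (z - (c - 5/2)) * deriv h z)) \<le> (5/2 * (44 * (\<Lambda> + 1))) * norm (c - (c - 5))"
  proof (rule contour_integral_bound_linepath[OF int3(2)])
    fix z assume z: "z \<in> ?S"
    obtain x where x: "0 \<le> x" "x \<le> 1" "z = c - 5 + of_real (5 * x)"
    proof -
      obtain u where "0 \<le> u" "u \<le> 1" "z = (1 - u) *\<^sub>R (c - 5) + u *\<^sub>R c" using z by (auto simp: closed_segment_def)
      then show ?thesis using that[of u] by (simp add: scaleR_conv_of_real algebra_simps)
    qed
    have e: "z - (c - 5/2) = of_real (5 * x - 5/2)" by (simp add: x(3))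
    have "norm (z - (c - 5/2)) = \<bar>5 * x - 5/2\<bar>" unfolding e by (rule norm_of_real)
    also have "\<dots> \<le> 5/2" using x by linarith
    finally have "norm (z - (c - 5/2)) \<le> 5/2" .
    then show "norm ((z - (c - 5/2)) * deriv h z) \<le> 5/2 * (44 * (\<Lambda> + 1))"
      unfolding norm_mult using dh[OF S_ball[OF z]] by (intro mult_mono) auto
  qed (use \<Lambda>0 in auto)
  have B: "\<bar>Im (\<Sum>a\<leftarrow>zs. contour_integral ?lp (\<lambda>z. (z - (c - 5/2)) / (z - a)))\<bar> \<le> real ?n * (5/2 * pi)"
    using zsS
  proof (induction zs)
    case (Cons a zs)
    have "\<bar>Im (contour_integral ?lp (\<lambda>z. (z - (c - 5/2)) / (z - a)))\<bar> \<le> 5/2 * pi"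
      using Cons.prems by (intro Im_contour_integral_linear_bound) auto
    moreover have "\<bar>Im (\<Sum>a\<leftarrow>zs. contour_integral ?lp (\<lambda>z. (z - (c - 5/2)) / (z - a)))\<bar> \<le> real (length zs) * (5/2 * pi)"
      using Cons by auto
    ultimately show ?case
      by (simp only: list.map sum_list.Cons plus_complex.simps length_Cons of_nat_Suc distrib_right mult_1)
  qed auto
  \<comment> \<open>\<open>550\<close> is length 5 times weight \<open>5/2\<close> times 44. The
    zeros add at most \<open>2 * \<Lambda>\<close> times 10, and 550 + 20 is rounded up to
    600.\<close>
  have "\<bar>Im (contour_integral ?lp (\<lambda>z. (z - (c - 5/2)) * (deriv f z / f z)))\<bar> \<le> 550 * (\<Lambda> + 1) + real ?n * (5/2 * pi)"
    unfolding I2 using A B abs_Im_le_cmod[of "contour_integral ?lp (\<lambda>z. (z - (c - 5/2)) * deriv h z)"] by simp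
  also have "real ?n * (5/2 * pi) \<le> 2 * \<Lambda> * (5/2 * 4)"
    using n pi_less_4 \<Lambda>0 by (intro mult_mono) auto
  finally show "\<bar>Im (contour_integral ?lp (\<lambda>z. (z - (c - 5/2)) * (deriv f z / f z)))\<bar> \<le> 600 * (ln (M / norm (f c)) + 1)"
    using \<Lambda>0 unfolding \<Lambda>_def by simp
qed

section \<open>Polynomial growth in a half strip\<close>

text \<open>The modulus of \<open>exp (\<epsilon> * z\<^sup>2)\<close> is
  \<open>exp (\<epsilon> * (x\<^sup>2 - y\<^sup>2))\<close> at \<open>z = x + \<i> * y\<close>,
  which beats any \<open>exp (k * y)\<close>. After division by \<open>z ^ N\<close> the maximum
  principle applies on a tall box, uniformly in \<open>\<epsilon>\<close> up to a factor that tends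
  to 1.\<close>

theorem phragmen_lindelof_half_strip:
  fixes f :: "complex \<Rightarrow> complex"
  assumes hol: "f holomorphic_on U" and U: "{z. a \<le> Re z \<and> Re z \<le> b \<and> 1 \<le> Im z} \<subseteq> U"
    and C1: "\<And>z. a \<le> Re z \<Longrightarrow> Re z \<le> b \<Longrightarrow> 1 \<le> Im z \<Longrightarrow> norm (f z) \<le> C1 * exp (k * Im z)"
    and C2: "\<And>z. Re z = a \<or> Re z = b \<Longrightarrow> 1 \<le> Im z \<Longrightarrow> norm (f z) \<le> C2 * Im z ^ N"
  obtains C where "C > 0" "\<And>z. a \<le> Re z \<Longrightarrow> Re z \<le> b \<Longrightarrow> 1 \<le> Im z \<Longrightarrow> norm (f z) \<le> C * norm z ^ N"
proof -
  define m where "m = max \<bar>a\<bar> \<bar>b\<bar>"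
  \<comment> \<open>\<open>C1 * exp k\<close> takes care of the bottom edge \<open>Im z = 1\<close>,
    where the exponential bound is the only one at hand.\<close>
  define C where "C = max 1 (max C2 (C1 * exp k))"
  have Cge: "C \<ge> 1" "C \<ge> C2" "C \<ge> C1 * exp k" by (simp_all add: C_def)
  have main: "norm (f z) \<le> C * norm z ^ N" if z: "a \<le> Re z" "Re z \<le> b" "1 \<le> Im z" for z
  proof -
    have zne: "w \<noteq> 0" if "1 \<le> Im w" for w using that by auto
    define F where "F \<epsilon> w = f w / w ^ N * exp (of_real \<epsilon> * w\<^sup>2)" for \<epsilon> w
    have nF: "norm (F \<epsilon> w) = norm (f w) / norm w ^ N * exp (\<epsilon> * ((Re w)\<^sup>2 - (Im w)\<^sup>2))" for \<epsilon> w
      by (simp add: F_def norm_mult norm_divide norm_power power2_eq_square)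
    have key: "norm (F \<epsilon> z) \<le> C * exp (\<epsilon> * m\<^sup>2)" if \<epsilon>: "\<epsilon> > 0" for \<epsilon>
    proof -
      define D where "D = ln (max 1 C1)"
      \<comment> \<open>So high that \<open>\<epsilon> * Y\<^sup>2 - k * Y\<close> exceeds
        \<open>ln (max 1 C1)\<close>: on the top edge the Gaussian factor then absorbs the
        exponential growth.\<close>
      define Y where "Y = max (Im z + 1) ((\<bar>k\<bar> + D) / \<epsilon>)"
      have D: "D \<ge> 0" by (simp add: D_def)
      have Yz: "Y \<ge> Im z + 1" "Y \<ge> 1" using z by (auto simp: Y_def)
      have "(\<bar>k\<bar> + D) / \<epsilon> \<le> Y" by (simp add: Y_def)
      then have "\<bar>k\<bar> + D \<le> \<epsilon> * Y" using \<epsilon> by (simp add: field_simps)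
      then have "(\<bar>k\<bar> + D) * Y \<le> \<epsilon> * Y * Y" using Yz by (intro mult_right_mono) auto
      moreover have "k * Y \<le> \<bar>k\<bar> * Y" using Yz by (intro mult_right_mono) auto
      moreover have "D \<le> D * Y" using Yz D mult_left_mono[of 1 Y D] by simp
      ultimately have "\<epsilon> * (Y * Y) - k * Y \<ge> D" by (simp only: distrib_right mult.assoc)
      then have Y: "\<epsilon> * (Y * Y) - k * Y \<ge> ln (max 1 C1)" "Y > Im z"
        using Yz by (auto simp: D_def)
      let ?S = "cbox (Complex a 1) (Complex b Y)"
      have S: "w \<in> ?S \<longleftrightarrow> a \<le> Re w \<and> Re w \<le> b \<and> 1 \<le> Im w \<and> Im w \<le> Y" for w
        by (auto simp: in_cbox_complex_iff)
      have SU: "?S \<subseteq> U" using U S by blast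
      have holF: "F \<epsilon> holomorphic_on ?S"
        unfolding F_def using zne S by (intro holomorphic_intros holomorphic_on_subset[OF hol SU]) auto
      show ?thesis
      proof (rule maximum_modulus_frontier[of "F \<epsilon>" ?S])
        show "F \<epsilon> holomorphic_on interior ?S" using holF interior_subset by (rule holomorphic_on_subset)
        show "continuous_on (closure ?S) (F \<epsilon>)" using holF by (simp add: holomorphic_on_imp_continuous_on)
        show "z \<in> ?S" using z Y by (simp add: S)
        show "norm (F \<epsilon> w) \<le> C * exp (\<epsilon> * m\<^sup>2)" if "w \<in> frontier ?S" for w
        proof -
          have wS: "a \<le> Re w" "Re w \<le> b" "1 \<le> Im w" "Im w \<le> Y"
            using that S frontier_subset_closed[OF closed_cbox] by blast+
          have "w \<notin> box (Complex a 1) (Complex b Y)"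
            using that by (simp add: frontier_def)
          then have edge: "Re w = a \<or> Re w = b \<or> Im w = 1 \<or> Im w = Y"
            using wS by (auto simp: in_box_complex_iff)
          have "\<bar>Re w\<bar> \<le> m" using wS by (auto simp: m_def)
          then have rm: "(Re w)\<^sup>2 \<le> m\<^sup>2" by (metis abs_ge_zero power2_abs power_mono)
          have nw: "norm w \<ge> Im w" using abs_Im_le_cmod[of w] by simp
          have nwN: "norm w ^ N \<ge> Im w ^ N" using nw wS by (intro power_mono) auto
          have ImN: "Im w ^ N \<ge> 1" using wS by (simp add: one_le_power)
          have e1: "exp (\<epsilon> * ((Re w)\<^sup>2 - (Im w)\<^sup>2)) \<le> exp (\<epsilon> * m\<^sup>2)"
            using rm \<epsilon> zero_le_power2[of "Im w"] by (intro iffD2[OF exp_le_cancel_iff] mult_left_mono) (linarith | simp)+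
          consider "Re w = a \<or> Re w = b" | "Im w = 1" | "Im w = Y" using edge by blast
          then show ?thesis
          proof cases
            case 1
            have "norm (f w) \<le> C2 * Im w ^ N" using C2 1 wS by blast
            also have "\<dots> \<le> C * norm w ^ N"
              using Cge nwN ImN by (intro mult_mono) auto
            finally have "norm (f w) / norm w ^ N \<le> C" using nwN ImN by (simp add: divide_le_eq)
            then show ?thesis unfolding nF using e1 Cge by (intro mult_mono) auto
          next
            case 2
            have "norm (f w) \<le> C1 * exp (k * Im w)" using C1 wS by blast
            also have "\<dots> \<le> C * 1" using 2 Cge by simp
            also have "\<dots> \<le> C * norm w ^ N" using Cge nwN ImN by (intro mult_left_mono) auto
            finally have "norm (f w) / norm w ^ N \<le> C" using nwN ImN by (simp add: divide_le_eq)
            then show ?thesis unfolding nF using e1 Cge by (intro mult_mono) auto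
          next
            case 3
            have "norm (f w) / norm w ^ N \<le> norm (f w) / 1"
              using nwN ImN by (intro divide_left_mono) auto
            also have "\<dots> \<le> C1 * exp (k * Im w)" using C1 wS by simp
            also have "\<dots> \<le> max 1 C1 * exp (k * Y)" using 3 by (intro mult_mono) auto
            also have "\<dots> = exp (ln (max 1 C1) + k * Y)" by (simp add: exp_add)
            also have "\<dots> \<le> exp (\<epsilon> * Y\<^sup>2)" using Y by (simp add: power2_eq_square)
            finally have *: "norm (f w) / norm w ^ N \<le> exp (\<epsilon> * Y\<^sup>2)" .
            have "norm (F \<epsilon> w) \<le> exp (\<epsilon> * Y\<^sup>2) * exp (\<epsilon> * ((Re w)\<^sup>2 - (Im w)\<^sup>2))"
              unfolding nF by (rule mult_right_mono[OF *]) auto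
            also have "\<dots> = exp (\<epsilon> * (Re w)\<^sup>2)" using 3 by (simp add: algebra_simps flip: exp_add)
            also have "\<dots> \<le> exp (\<epsilon> * m\<^sup>2)" using rm \<epsilon> by simp
            also have "\<dots> \<le> C * exp (\<epsilon> * m\<^sup>2)" using Cge by simp
            finally show ?thesis .
          qed
        qed
      qed auto
    qed
    have L1: "((\<lambda>\<epsilon>. norm (F \<epsilon> z)) \<longlongrightarrow> norm (F 0 z)) (at_right 0)"
      unfolding F_def by (intro tendsto_intros)
    have L2: "((\<lambda>\<epsilon>. C * exp (\<epsilon> * m\<^sup>2)) \<longlongrightarrow> C * exp (0 * m\<^sup>2)) (at_right 0)"
      by (intro tendsto_intros)
    have L3: "eventually (\<lambda>\<epsilon>. norm (F \<epsilon> z) \<le> C * exp (\<epsilon> * m\<^sup>2)) (at_right 0)"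
      using eventually_at_right_less[of "0::real"] by eventually_elim (rule key)
    have "norm (F 0 z) \<le> C * exp (0 * m\<^sup>2)"
      by (rule tendsto_le[OF trivial_limit_at_right_real L2 L1 L3])
    then have "norm (f z) / norm z ^ N \<le> C" by (simp add: nF)
    moreover have "norm z ^ N > 0" using zne[OF z(3)] by simp
    ultimately show ?thesis by (simp add: divide_le_eq)
  qed
  show ?thesis using that[of C] main Cge by auto
qed

section \<open>The kernel and its integrals along vertical lines\<close>

definition ee :: "complex \<Rightarrow> complex" where
  "ee z = exp (2 * of_real pi * \<i> * z)"

lemma ee_0 [simp]: "ee 0 = 1"
  by (simp add: ee_def)

lemma ee_1 [simp]: "ee 1 = 1"
  by (simp add: ee_def)

lemma ee_nonzero [simp]: "ee z \<noteq> 0"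
  by (simp add: ee_def)

lemma ee_add: "ee (a + b) = ee a * ee b"
  by (simp add: ee_def exp_add algebra_simps)

lemma ee_diff: "ee (a - b) = ee a / ee b"
  by (simp add: ee_def exp_diff algebra_simps)

lemma ee_minus: "ee (- a) = 1 / ee a"
  using ee_diff[of 0 a] by simp

lemma norm_ee: "norm (ee z) = exp (- (2 * pi * Im z))"
  by (simp add: ee_def)

lemma norm_ee_of_real [simp]: "norm (ee (of_real x)) = 1"
  by (simp add: norm_ee)

lemma cnj_ee: "cnj (ee z) = ee (- cnj z)"
  by (simp add: ee_def exp_cnj)

lemma ee_holomorphic [holomorphic_intros]:
  "f holomorphic_on A \<Longrightarrow> (\<lambda>z. ee (f z)) holomorphic_on A"
  unfolding ee_def by (intro holomorphic_intros)

lemma continuous_on_ee [continuous_intros]: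
  "continuous_on A f \<Longrightarrow> continuous_on A (\<lambda>z. ee (f z))"
  unfolding ee_def by (intro continuous_intros)

lemma ee_eq_1_iff: "ee z = 1 \<longleftrightarrow> z \<in> \<int>"
proof
  assume "ee z = 1"
  then obtain n :: int where n: "- (2 * pi * Im z) = 0" "2 * pi * Re z = of_int (2 * n) * pi"
    unfolding ee_def exp_eq_1 by auto
  then have "z = of_int n" by (simp add: complex_eq_iff)
  then show "z \<in> \<int>" by simp
next
  assume "z \<in> \<int>"
  then obtain n :: int where "z = of_int n" by (elim Ints_cases)
  then show "ee z = 1" unfolding ee_def exp_eq_1 by auto
qed

text \<open>With \<open>r = norm (ee z)\<close> and \<open>t = sin (pi * Re z)\<close> the square of
  the left side is \<open>(1 - r)\<^sup>2 + 4 * r * t\<^sup>2\<close>. Since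
  \<open>t\<^sup>2 \<le> 1\<close>, replacing the first summand by
  \<open>t\<^sup>2 * (1 - r)\<^sup>2\<close> only decreases it and completes the square
  \<open>(t * (1 + r))\<^sup>2\<close>.\<close>

lemma norm_ee_minus_1_ge: "norm (ee z - 1) \<ge> \<bar>sin (pi * Re z)\<bar> * (1 + exp (- (2 * pi * Im z)))"
proof -
  define r where "r = exp (- (2 * pi * Im z))"
  define t where "t = sin (pi * Re z)"
  have c: "cos (2 * pi * Re z) = 1 - 2 * t\<^sup>2"
    using cos_double_sin[of "pi * Re z"] by (simp add: t_def mult.assoc)
  have z: "Re (ee z) = r * cos (2 * pi * Re z)" "Im (ee z) = r * sin (2 * pi * Re z)"
    by (simp_all add: ee_def Re_exp Im_exp r_def)
  have "(norm (ee z - 1))\<^sup>2 = (r * cos (2 * pi * Re z) - 1)\<^sup>2 + (r * sin (2 * pi * Re z))\<^sup>2"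
    by (simp add: cmod_power2 z)
  also have "\<dots> = r\<^sup>2 * ((sin (2 * pi * Re z))\<^sup>2 + (cos (2 * pi * Re z))\<^sup>2) - 2 * r * cos (2 * pi * Re z) + 1"
    by (simp only: power2_diff power_mult_distrib distrib_left) simp
  also have "\<dots> = r\<^sup>2 - 2 * r * (1 - 2 * t\<^sup>2) + 1"
    by (simp only: sin_cos_squared_add) (simp only: c mult_1_right)
  also have "\<dots> = (1 - r)\<^sup>2 + 4 * r * t\<^sup>2"
    by (simp add: power2_eq_square algebra_simps)
  also have "\<dots> \<ge> t\<^sup>2 * (1 - r)\<^sup>2 + 4 * r * t\<^sup>2"
    using mult_right_mono[of "t\<^sup>2" 1 "(1 - r)\<^sup>2"] by (simp add: t_def abs_square_le_1)
  also (xtrans) have "t\<^sup>2 * (1 - r)\<^sup>2 + 4 * r * t\<^sup>2 = (\<bar>t\<bar> * (1 + r))\<^sup>2"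
    by (simp add: power2_eq_square algebra_simps)
  finally show ?thesis unfolding r_def[symmetric] t_def[symmetric]
    by (rule power2_le_imp_le) simp
qed

lemma norm_ee_minus_1_ge': "norm (ee z - 1) \<ge> \<bar>1 - exp (- (2 * pi * Im z))\<bar>"
  using norm_triangle_ineq3[of "ee z" 1] by (simp add: norm_ee)

text \<open>A summation kernel: it has a simple pole at each integer \<open>n\<close>, with residue
  \<open>ee (\<mu> * n) / (2 * pi * \<i>)\<close>. So it produces the coefficients of the Lerch
  series.\<close>

definition kern :: "real \<Rightarrow> complex \<Rightarrow> complex" where
  "kern \<mu> z = ee (of_real \<mu> * z) / (ee z - 1)"

lemma kern_shift: "kern \<mu> (z + 1) = ee (of_real \<mu>) * kern \<mu> z"
  by (simp add: kern_def ee_add algebra_simps)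

text \<open>This symmetry is the origin of the dual parameter \<open>1 - lam\<close>: it folds the
  lower half of a vertical line onto the upper half.\<close>

lemma kern_cnj: "kern \<mu> (cnj z) = - cnj (kern (1 - \<mu>) z)"
proof -
  have "cnj (kern (1 - \<mu>) z) = ee (- (of_real (1 - \<mu>) * cnj z)) / (ee (- cnj z) - 1)"
    by (simp add: kern_def cnj_ee)
  also have "ee (- (of_real (1 - \<mu>) * cnj z)) = ee (of_real \<mu> * cnj z) * ee (- cnj z)"
    by (simp add: algebra_simps flip: ee_add)
  also have "ee (of_real \<mu> * cnj z) * ee (- cnj z) / (ee (- cnj z) - 1) = - kern \<mu> (cnj z)"
    by (cases "ee (cnj z) = 1") (simp_all add: kern_def ee_minus divide_simps, simp add: algebra_simps)
  finally show ?thesis by simp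
qed

lemma kern_1: "ee z \<noteq> 1 \<Longrightarrow> kern 1 z = kern 0 z + 1"
  by (simp add: kern_def divide_simps)

text \<open>The remainder of the finite geometric sum is again a kernel, with parameter
  \<open>\<mu> + N\<close>. Its integral can therefore be estimated directly, in place of an
  interchange of an infinite sum with an integral.\<close>

lemma kern_expand:
  assumes "ee z \<noteq> 1"
  shows "kern \<mu> z = kern (\<mu> + real N) z - (\<Sum>n<N. ee (of_real (\<mu> + real n) * z))"
proof (induction N)
  case (Suc N)
  have "kern (\<mu> + real N) z = kern (\<mu> + real (Suc N)) z - ee (of_real (\<mu> + real N) * z)"
  proof -
    have "ee (of_real (\<mu> + real (Suc N)) * z) = ee (of_real (\<mu> + real N) * z) * ee z"
      by (simp add: algebra_simps flip: ee_add)
    then show ?thesis using assms by (simp add: kern_def divide_simps) (simp add: algebra_simps)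
  qed
  with Suc show ?case by simp
qed simp

lemma norm_kern_le_sin:
  assumes "sin (pi * Re z) \<noteq> 0"
  shows "norm (kern \<mu> z) \<le> exp (- (2 * pi * \<mu> * Im z)) / \<bar>sin (pi * Re z)\<bar>"
proof -
  have "\<bar>sin (pi * Re z)\<bar> * 1 \<le> \<bar>sin (pi * Re z)\<bar> * (1 + exp (- (2 * pi * Im z)))"
    by (intro mult_left_mono) auto
  also have "\<dots> \<le> norm (ee z - 1)" by (rule norm_ee_minus_1_ge)
  finally show ?thesis unfolding kern_def norm_divide norm_ee
    using assms by (intro frac_le) auto
qed

text \<open>At distance at least 1 from the real axis the poles are out of reach, so the bounds are
  uniform in \<open>Re z\<close>; they serve for horizontal edges far from the axis.\<close>

lemma norm_kern_le_1:
  assumes "0 \<le> \<mu>" "\<mu> \<le> 1" "\<bar>Im z\<bar> \<ge> 1"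
  shows "norm (kern \<mu> z) \<le> 2" and "Im z \<ge> 1 \<Longrightarrow> norm (kern \<mu> z) \<le> 2 * exp (- (2 * pi * \<mu> * Im z))"
proof -
  have e2: "exp (-1) \<le> (1/2::real)"
    using exp_ge_add_one_self[of 1] by (simp add: exp_minus field_simps)
  have small: "exp (- (2 * pi * y)) \<le> 1/2" if "y \<ge> 1" for y
  proof -
    have "1 * 1 \<le> (2 * pi) * y" using that pi_ge_two by (intro mult_mono) auto
    then have "exp (- (2 * pi * y)) \<le> exp (-1)" by simp
    with e2 show ?thesis by linarith
  qed
  show *: "norm (kern \<mu> z) \<le> 2 * exp (- (2 * pi * \<mu> * Im z))" if "Im z \<ge> 1"
  proof -
    have "1/2 \<le> norm (ee z - 1)" using norm_ee_minus_1_ge'[of z] small[OF that] by simp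
    then have "exp (- (2 * pi * \<mu> * Im z)) / norm (ee z - 1) \<le> exp (- (2 * pi * \<mu> * Im z)) / (1/2)"
      by (intro divide_left_mono) auto
    then show ?thesis by (simp add: kern_def norm_divide norm_ee mult.assoc)
  qed
  show "norm (kern \<mu> z) \<le> 2"
  proof (cases "Im z \<ge> 1")
    case True
    have "norm (kern \<mu> z) \<le> 2 * exp (- (2 * pi * \<mu> * Im z))" using *[OF True] .
    also have "\<dots> \<le> 2 * 1" using assms True by (intro mult_left_mono) auto
    finally show ?thesis by simp
  next
    case False
    then have y: "- Im z \<ge> 1" using assms by linarith
    define E where "E = exp (2 * pi * Im z)"
    have E: "E \<le> 1/2" "E > 0" using small[OF y] by (simp_all add: E_def)
    have r: "exp (- (2 * pi * Im z)) = 1 / E" by (simp add: E_def exp_minus field_simps)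
    have "1 / E \<ge> 2" using E by (simp add: field_simps)
    then have "norm (ee z - 1) \<ge> 1 / E - 1" using norm_ee_minus_1_ge'[of z] unfolding r by linarith
    also have "1 / E - 1 \<ge> 1 / (2 * E)" using E by (simp add: field_simps)
    finally have n: "norm (ee z - 1) \<ge> 1 / (2 * E)" by simp
    have "\<mu> * (- Im z) \<le> 1 * (- Im z)" using assms y by (intro mult_right_mono) auto
    then have "- (2 * pi * \<mu> * Im z) \<le> - (2 * pi * Im z)" by (simp add: mult.assoc)
    then have "exp (- (2 * pi * \<mu> * Im z)) \<le> 1 / E" unfolding r[symmetric] by simp
    then have "exp (- (2 * pi * \<mu> * Im z)) / norm (ee z - 1) \<le> (1 / E) / (1 / (2 * E))"
      using n E by (intro frac_le) auto
    then show ?thesis using E by (simp add: kern_def norm_divide norm_ee mult.assoc)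
  qed
qed

lemma norm_powr_le:
  assumes "Re w \<ge> 0"
  shows "norm (w powr s) \<le> norm w powr Re s * exp (pi/2 * \<bar>Im s\<bar>)"
proof (cases "w = 0")
  case False
  have "\<bar>Arg w\<bar> \<le> pi / 2" using Re_Ln_pos_le[OF False] assms False by (simp add: Arg_eq_Im_Ln)
  then have "\<bar>Im s * Arg w\<bar> \<le> \<bar>Im s\<bar> * (pi / 2)" unfolding abs_mult by (intro mult_left_mono) auto
  then have "- Im s * Arg w \<le> pi/2 * \<bar>Im s\<bar>" by (simp add: abs_le_iff mult.commute)
  then show ?thesis by (auto simp: norm_powr_complex intro!: mult_left_mono)
qed simp

text \<open>From \<open>ln x \<le> x\<close> at \<open>x = k * q / A\<close>. It pays for a power
  with a part of the exponential decay.\<close>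

lemma powr_le_exp_mult:
  fixes A k q :: real
  assumes "A > 0" "k > 0" "q > 0"
  shows "q powr A \<le> (A / k) powr A * exp (k * q)"
proof -
  have "(k * q / A) powr A = exp (A * ln (k * q / A))" using assms by (simp add: powr_def)
  also have "\<dots> \<le> exp (A * (k * q / A))"
    using assms ln_le_minus_one[of "k * q / A"] by (intro iffD2[OF exp_le_cancel_iff] mult_left_mono) auto
  also have "A * (k * q / A) = k * q" using assms by simp
  finally have "(A / k) powr A * (k * q / A) powr A \<le> (A / k) powr A * exp (k * q)"
    by (intro mult_left_mono) auto
  moreover have "(A / k) powr A * (k * q / A) powr A = q powr A"
    using assms by (simp flip: powr_mult)
  ultimately show ?thesis by simp
qed

text \<open>The third claim gives an explicit rate for the truncated integrals, from which locally
  uniform convergence in a parameter follows; the fourth turns identities on \<open>{0..Y}\<close>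
  into identities on the half-line.\<close>

lemma exp_decay_integral:
  fixes F :: "real \<Rightarrow> complex"
  assumes cont: "continuous_on {0..} F" and bnd: "\<And>y. y \<ge> 0 \<Longrightarrow> norm (F y) \<le> C * exp (- k * y)" and k: "k > 0"
  shows "F integrable_on {0..}" and "norm (integral {0..} F) \<le> C / k"
    and "\<And>Y. Y \<ge> 0 \<Longrightarrow> norm (integral {0..} F - integral {0..Y} F) \<le> C / k * exp (- k * Y)"
    and "((\<lambda>Y. integral {0..Y} F) \<longlongrightarrow> integral {0..} F) at_top"
proof -
  have int: "F integrable_on {c..}" and bi: "norm (integral {c..} F) \<le> C / k * exp (- k * c)" if c: "c \<ge> 0" for c
  proof -
    have g: "((\<lambda>y. C * exp (- k * y)) has_integral C * (exp (- k * c) / k)) {c..}"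
      by (intro has_integral_mult_right has_integral_exp_minus_to_infinity k)
    have meas: "F \<in> borel_measurable (lebesgue_on {c..})"
      by (rule continuous_imp_measurable_on_sets_lebesgue[OF continuous_on_subset[OF cont]]) (use c in auto)
    have "F absolutely_integrable_on {c..}"
      by (rule measurable_bounded_by_integrable_imp_absolutely_integrable[OF meas _ has_integral_integrable[OF g]])
         (use bnd c in auto)
    then show i: "F integrable_on {c..}" by (rule set_lebesgue_integral_eq_integral(1))
    have "norm (integral {c..} F) \<le> integral {c..} (\<lambda>y. C * exp (- k * y))"
      by (rule integral_norm_bound_integral[OF i has_integral_integrable[OF g]]) (use bnd c in auto)
    then show "norm (integral {c..} F) \<le> C / k * exp (- k * c)" using integral_unique[OF g] by simp
  qed
  show "F integrable_on {0..}" using int[of 0] by simp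
  show "norm (integral {0..} F) \<le> C / k" using bi[of 0] by simp
  show tail: "norm (integral {0..} F - integral {0..Y} F) \<le> C / k * exp (- k * Y)" if Y: "Y \<ge> 0" for Y
  proof -
    have "{0..} = {0..Y} \<union> {Y..}" and "{0..Y} \<inter> {Y..} = {Y}" using Y by auto
    moreover have "F integrable_on {0..Y}"
      by (rule integrable_continuous_interval[OF continuous_on_subset[OF cont]]) auto
    ultimately have "integral {0..} F = integral {0..Y} F + integral {Y..} F"
      using int[OF Y] by (simp del: ivl_disj_un_one)
    then show ?thesis using bi[OF Y] by simp
  qed
  have "((\<lambda>Y. C / k * exp (- k * Y)) \<longlongrightarrow> 0) at_top"
    using k by real_asymp
  then have "((\<lambda>Y. integral {0..Y} F - integral {0..} F) \<longlongrightarrow> 0) at_top"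
  proof (rule Lim_null_comparison[rotated])
    show "eventually (\<lambda>Y. norm (integral {0..Y} F - integral {0..} F) \<le> C / k * exp (- k * Y)) at_top"
      using eventually_ge_at_top[of 0] by eventually_elim (use tail in \<open>simp add: norm_minus_commute\<close>)
  qed
  then show "((\<lambda>Y. integral {0..Y} F) \<longlongrightarrow> integral {0..} F) at_top" by (simp add: LIM_zero_iff)
qed

section \<open>The upper half of a vertical line as an entire function\<close>

text \<open>On \<open>w = b + \<i> * y\<close> this is
  \<open>w powr (- s) * kern \<mu> (w - (b + c))\<close>. The abscissa \<open>b\<close> and the
  distance \<open>c\<close> to the next pole are separate parameters because a shift of
  \<open>b\<close> by 1 with fixed \<open>c\<close> moves the line to the next gap between
  poles.\<close>

definition Uint :: "real \<Rightarrow> real \<Rightarrow> real \<Rightarrow> complex \<Rightarrow> real \<Rightarrow> complex" where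
  "Uint \<mu> c b s y = Complex b y powr (- s) * kern \<mu> (Complex (- c) y)"

definition U :: "real \<Rightarrow> real \<Rightarrow> real \<Rightarrow> complex \<Rightarrow> complex" where
  "U \<mu> c b s = integral {0..} (Uint \<mu> c b s)"

lemma ee_neq_1_Re:
  assumes "0 < c" "c < 1"
  shows "ee (Complex (- c) y) \<noteq> 1"
proof
  assume "ee (Complex (- c) y) = 1"
  then obtain n :: int where "Complex (- c) y = of_int n" unfolding ee_eq_1_iff by (elim Ints_cases)
  then have "- c = of_int n" by (simp add: complex_eq_iff)
  then show False using assms by (smt (verit) of_int_le_iff of_int_less_iff of_int_0 of_int_minus of_int_1)
qed

lemma continuous_on_Complex [continuous_intros]:
  "continuous_on A f \<Longrightarrow> continuous_on A g \<Longrightarrow> continuous_on A (\<lambda>x. Complex (f x) (g x))"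
  unfolding Complex_eq by (intro continuous_intros)

lemma Complex_notin_nonpos: "b > 0 \<Longrightarrow> Complex b y \<notin> \<real>\<^sub>\<le>\<^sub>0"
  by (auto simp: complex_nonpos_Reals_iff)

lemma Uint_continuous:
  assumes "0 < c" "c < 1" "b > 0"
  shows "continuous_on A (Uint \<mu> c b s)"
  unfolding Uint_def kern_def using ee_neq_1_Re[OF assms(1,2)] assms(3)
  by (intro continuous_intros) (auto simp: complex_eq_iff)

lemma sin_pi_pos: "0 < c \<Longrightarrow> c < 1 \<Longrightarrow> sin (pi * c) > 0"
  by (intro sin_gt_zero) auto

lemma Uint_bound:
  assumes c: "0 < c" "c < 1" and b: "b > 0" and y: "y \<ge> 0"
  shows "norm (Uint \<mu> c b s y) \<le> norm (Complex b y) powr (- Re s) * (exp (pi/2 * \<bar>Im s\<bar>) / sin (pi * c)) * exp (- (2 * pi * \<mu>) * y)"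
proof -
  have "norm (kern \<mu> (Complex (- c) y)) \<le> exp (- (2 * pi * \<mu> * y)) / sin (pi * c)"
    using norm_kern_le_sin[of "Complex (- c) y" \<mu>] sin_pi_pos[OF c] by simp
  moreover have "norm (Complex b y powr (- s)) \<le> norm (Complex b y) powr (- Re s) * exp (pi/2 * \<bar>Im s\<bar>)"
    using norm_powr_le[of "Complex b y" "- s"] b by simp
  ultimately have "norm (Uint \<mu> c b s y) \<le> (norm (Complex b y) powr (- Re s) * exp (pi/2 * \<bar>Im s\<bar>)) * (exp (- (2 * pi * \<mu> * y)) / sin (pi * c))"
    unfolding Uint_def norm_mult by (intro mult_mono) auto
  then show ?thesis by (simp add: mult_ac)
qed

lemma Uint_bound_strip:
  assumes c: "0 < c" "c < 1" and b: "b > 0" and \<mu>: "\<mu> > 0" and A: "A > 0"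
  obtains K where "K \<ge> 0"
    "\<And>s y. \<bar>Re s\<bar> \<le> A \<Longrightarrow> y \<ge> 0 \<Longrightarrow> norm (Uint \<mu> c b s y) \<le> (K * exp (pi/2 * \<bar>Im s\<bar>)) * exp (- (pi * \<mu>) * y)"
proof -
  \<comment> \<open>Chosen so that \<open>q0 + y\<close> dominates \<open>1\<close>,
    \<open>norm w\<close> and \<open>1 / norm w\<close> alike; one power of it then covers both
    signs of \<open>Re s\<close>. Half of the decay rate \<open>2 * pi * \<mu>\<close> is spent on
    that power.\<close>
  define q0 where "q0 = 1 + 1 / b + b"
  define K where "K = (A / (pi * \<mu>)) powr A * exp (pi * \<mu> * q0) / sin (pi * c)"
  have sp: "sin (pi * c) > 0" using sin_pi_pos[OF c] .
  have "norm (Uint \<mu> c b s y) \<le> (K * exp (pi/2 * \<bar>Im s\<bar>)) * exp (- (pi * \<mu>) * y)"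
    if s: "\<bar>Re s\<bar> \<le> A" and y: "y \<ge> 0" for s y
  proof -
    let ?w = "norm (Complex b y)" and ?q = "q0 + y"
    have w: "?w > 0" "?w \<ge> b" using b abs_Re_le_cmod[of "Complex b y"] by auto
    have w2: "?w \<le> b + y" using cmod_le[of "Complex b y"] b y by simp
    have q1: "?q \<ge> 1" "?w \<le> ?q" using w2 b y by (auto simp: q0_def intro: order_trans[OF w2])
    have "1 / ?w \<le> 1 / b" using w b by (intro divide_left_mono) auto
    then have q2: "1 / ?w \<le> ?q" using b y by (simp add: q0_def)
    have "?w powr (- Re s) \<le> ?q powr A"
    proof (cases "Re s \<le> 0")
      case True
      have "?w powr (- Re s) \<le> ?q powr (- Re s)" using True q1 w by (intro powr_mono2) auto
      also have "\<dots> \<le> ?q powr A" using s q1 by (intro powr_mono) auto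
      finally show ?thesis .
    next
      case False
      have "?w powr (- Re s) = (1 / ?w) powr Re s" using powr_minus_divide[of ?w "Re s"] powr_divide[of 1 ?w "Re s"] w by simp
      also have "\<dots> \<le> ?q powr Re s" using False q2 w by (intro powr_mono2) auto
      also have "\<dots> \<le> ?q powr A" using s q1 by (intro powr_mono) auto
      finally show ?thesis .
    qed
    also have "\<dots> \<le> (A / (pi * \<mu>)) powr A * exp ((pi * \<mu>) * ?q)"
      using A \<mu> q1 by (intro powr_le_exp_mult) auto
    also have "\<dots> = (A / (pi * \<mu>)) powr A * exp (pi * \<mu> * q0) * exp (pi * \<mu> * y)"
      by (simp add: exp_add distrib_left mult.assoc)
    finally have "?w powr (- Re s) \<le> (A / (pi * \<mu>)) powr A * exp (pi * \<mu> * q0) * exp (pi * \<mu> * y)" .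
    then have "?w powr (- Re s) * (exp (pi/2 * \<bar>Im s\<bar>) / sin (pi * c)) * exp (- (2 * pi * \<mu>) * y)
      \<le> (A / (pi * \<mu>)) powr A * exp (pi * \<mu> * q0) * exp (pi * \<mu> * y) * (exp (pi/2 * \<bar>Im s\<bar>) / sin (pi * c)) * exp (- (2 * pi * \<mu>) * y)"
      using sp by (intro mult_right_mono) auto
    also have "\<dots> = K * exp (pi/2 * \<bar>Im s\<bar>) * (exp (pi * \<mu> * y) * exp (- (2 * pi * \<mu>) * y))"
      by (simp add: K_def mult_ac)
    also have "exp (pi * \<mu> * y) * exp (- (2 * pi * \<mu>) * y) = exp (- (pi * \<mu>) * y)"
      by (simp flip: exp_add)
    finally show ?thesis using Uint_bound[OF c b y, of \<mu> s] by simp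
  qed
  moreover have "K \<ge> 0" using sp by (simp add: K_def)
  ultimately show ?thesis using that by blast
qed

lemma U_limit:
  assumes c: "0 < c" "c < 1" and b: "b > 0" and \<mu>: "\<mu> > 0"
  shows "((\<lambda>Y. integral {0..Y} (Uint \<mu> c b s)) \<longlongrightarrow> U \<mu> c b s) at_top"
proof -
  obtain K where K: "\<And>s' y. \<bar>Re s'\<bar> \<le> \<bar>Re s\<bar> + 1 \<Longrightarrow> y \<ge> 0 \<Longrightarrow> norm (Uint \<mu> c b s' y) \<le> (K * exp (pi/2 * \<bar>Im s'\<bar>)) * exp (- (pi * \<mu>) * y)"
    using Uint_bound_strip[OF c b \<mu>, of "\<bar>Re s\<bar> + 1"] by (metis abs_ge_zero add_nonneg_pos zero_less_one)
  show ?thesis unfolding U_def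
    by (rule exp_decay_integral(4)[OF Uint_continuous[OF c b] K]) (use \<mu> in auto)
qed

lemma norm_U_strip:
  assumes c: "0 < c" "c < 1" and b: "b > 0" and \<mu>: "\<mu> > 0" and A: "A > 0"
  obtains K where "K \<ge> 0" "\<And>s. \<bar>Re s\<bar> \<le> A \<Longrightarrow> norm (U \<mu> c b s) \<le> K * exp (pi/2 * \<bar>Im s\<bar>)"
proof -
  obtain K where K: "K \<ge> 0" "\<And>s y. \<bar>Re s\<bar> \<le> A \<Longrightarrow> y \<ge> 0 \<Longrightarrow> norm (Uint \<mu> c b s y) \<le> (K * exp (pi/2 * \<bar>Im s\<bar>)) * exp (- (pi * \<mu>) * y)"
    using Uint_bound_strip[OF c b \<mu> A] by blast
  have "norm (U \<mu> c b s) \<le> (K / (pi * \<mu>)) * exp (pi/2 * \<bar>Im s\<bar>)" if "\<bar>Re s\<bar> \<le> A" for s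
    using exp_decay_integral(2)[OF Uint_continuous[OF c b] K(2)[OF that]] \<mu> by (simp add: U_def)
  then show ?thesis using that[of "K / (pi * \<mu>)"] K(1) \<mu> by auto
qed

lemma norm_U_large:
  assumes c: "0 < c" "c < 1" and b: "b > 0" and \<mu>: "\<mu> > 0" and s: "Re s \<ge> 0"
  shows "norm (U \<mu> c b s) \<le> b powr (- Re s) * (exp (pi/2 * \<bar>Im s\<bar>) / sin (pi * c)) / (2 * pi * \<mu>)"
  unfolding U_def
proof (rule exp_decay_integral(2)[OF Uint_continuous[OF c b]])
  fix y :: real assume y: "y \<ge> 0"
  have "norm (Complex b y) \<ge> b" using abs_Re_le_cmod[of "Complex b y"] b by simp
  then have "norm (Complex b y) powr (- Re s) \<le> b powr (- Re s)"
    using b s by (intro powr_mono2') auto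
  then show "norm (Uint \<mu> c b s y) \<le> b powr (- Re s) * (exp (pi/2 * \<bar>Im s\<bar>) / sin (pi * c)) * exp (- (2 * pi * \<mu>) * y)"
    using sin_pi_pos[OF c] by (intro order_trans[OF Uint_bound[OF c b y]] mult_right_mono) auto
qed (use \<mu> in auto)

lemma U_holomorphic:
  assumes c: "0 < c" "c < 1" and b: "b > 0" and \<mu>: "\<mu> > 0"
  shows "U \<mu> c b holomorphic_on UNIV"
proof (rule holomorphic_uniform_sequence[of UNIV "\<lambda>n s. integral (cbox 0 (real n)) (Uint \<mu> c b s)"])
  note ne = ee_neq_1_Re[OF c] and np = Complex_notin_nonpos[OF b]
  show "(\<lambda>s. integral (cbox 0 (real n)) (Uint \<mu> c b s)) holomorphic_on UNIV" for n
  proof (rule leibniz_rule_holomorphic)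
    show "((\<lambda>s. Uint \<mu> c b s y) has_field_derivative
        - Ln (Complex b y) * Uint \<mu> c b s y) (at s within UNIV)" for s y
    proof -
      have "Complex b y \<noteq> 0" using b by (simp add: complex_eq_iff)
      then have "(\<lambda>s. Uint \<mu> c b s y) = (\<lambda>s. exp (- s * Ln (Complex b y)) * kern \<mu> (Complex (- c) y))"
        by (simp add: Uint_def powr_def fun_eq_iff)
      moreover have "((\<lambda>s. exp (- s * Ln (Complex b y)) * kern \<mu> (Complex (- c) y)) has_field_derivative
          - Ln (Complex b y) * (exp (- s * Ln (Complex b y)) * kern \<mu> (Complex (- c) y))) (at s)"
        by (auto intro!: derivative_eq_intros)
      ultimately show ?thesis by (metis (no_types, lifting))
    qed
    show "Uint \<mu> c b s integrable_on cbox 0 (real n)" for s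
      by (intro integrable_continuous Uint_continuous c b)
    show "continuous_on (UNIV \<times> cbox 0 (real n)) (\<lambda>(s, y). - Ln (Complex b y) * Uint \<mu> c b s y)"
      unfolding split_def Uint_def kern_def using ne np
      using b by (intro continuous_intros) (auto simp: complex_eq_iff)
  qed auto
  fix x :: complex
  define A where "A = \<bar>Re x\<bar> + 1"
  define B where "B = \<bar>Im x\<bar> + 1"
  obtain K where K: "K \<ge> 0" "\<And>s y. \<bar>Re s\<bar> \<le> A \<Longrightarrow> y \<ge> 0 \<Longrightarrow> norm (Uint \<mu> c b s y) \<le> (K * exp (pi/2 * \<bar>Im s\<bar>)) * exp (- (pi * \<mu>) * y)"
  proof -
    have "A > 0" by (simp add: A_def)
    then show ?thesis using Uint_bound_strip[OF c b \<mu>, of A] that by blast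
  qed
  have "uniform_limit (cball x 1) (\<lambda>n s. integral (cbox 0 (real n)) (Uint \<mu> c b s)) (U \<mu> c b) sequentially"
  proof (rule uniform_limitI)
    fix e :: real assume e: "e > 0"
    have "(\<lambda>n. K * exp (pi/2 * B) / (pi * \<mu>) * exp (- (pi * \<mu>) * real n)) \<longlonglongrightarrow> 0"
      using \<mu> by real_asymp
    then have "eventually (\<lambda>n. K * exp (pi/2 * B) / (pi * \<mu>) * exp (- (pi * \<mu>) * real n) < e) sequentially"
      using e by (rule order_tendstoD)
    then show "eventually (\<lambda>n. \<forall>s\<in>cball x 1. dist (integral (cbox 0 (real n)) (Uint \<mu> c b s)) (U \<mu> c b s) < e) sequentially"
    proof eventually_elim
      case (elim n)
      show ?case
      proof
        fix s assume "s \<in> cball x 1"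
        then have "norm (s - x) \<le> 1" by (simp add: dist_norm norm_minus_commute)
        then have sA: "\<bar>Re s\<bar> \<le> A" and sB: "\<bar>Im s\<bar> \<le> B"
          using abs_Re_le_cmod[of "s - x"] abs_Im_le_cmod[of "s - x"] by (auto simp: A_def B_def)
        have "norm (U \<mu> c b s - integral {0..real n} (Uint \<mu> c b s)) \<le> K * exp (pi/2 * \<bar>Im s\<bar>) / (pi * \<mu>) * exp (- (pi * \<mu>) * real n)"
          unfolding U_def by (rule exp_decay_integral(3)[OF Uint_continuous[OF c b] K(2)[OF sA]]) (use \<mu> in auto)
        also have "\<dots> \<le> K * exp (pi/2 * B) / (pi * \<mu>) * exp (- (pi * \<mu>) * real n)"
          using sB K \<mu> by (intro mult_right_mono divide_right_mono mult_left_mono) auto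
        also have "\<dots> < e" by (rule elim)
        finally show "dist (integral (cbox 0 (real n)) (Uint \<mu> c b s)) (U \<mu> c b s) < e"
          by (simp add: dist_norm norm_minus_commute)
      qed
    qed
  qed
  then show "\<exists>d. 0 < d \<and> cball x d \<subseteq> UNIV \<and>
        uniform_limit (cball x d) (\<lambda>n s. integral (cbox 0 (real n)) (Uint \<mu> c b s)) (U \<mu> c b) sequentially"
    by (intro exI[of _ 1]) auto
qed auto

section \<open>Analytic continuation\<close>

lemma contour_integral_rectpath:
  fixes f :: "complex \<Rightarrow> complex"
  assumes cont: "continuous_on (path_image (rectpath (Complex x1 y1) (Complex x2 y2))) f"
  shows "contour_integral (rectpath (Complex x1 y1) (Complex x2 y2)) f =
    contour_integral (linepath (Complex x1 y1) (Complex x2 y1)) f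
    + contour_integral (linepath (Complex x2 y1) (Complex x2 y2)) f
    - contour_integral (linepath (Complex x1 y2) (Complex x2 y2)) f
    - contour_integral (linepath (Complex x1 y1) (Complex x1 y2)) f"
proof -
  have img: "path_image (rectpath (Complex x1 y1) (Complex x2 y2)) = closed_segment (Complex x1 y1) (Complex x2 y1) \<union>
      (closed_segment (Complex x2 y1) (Complex x2 y2) \<union>
      (closed_segment (Complex x2 y2) (Complex x1 y2) \<union> closed_segment (Complex x1 y2) (Complex x1 y1)))"
    by (simp add: rectpath_def Let_def path_image_join)
  have conts: "continuous_on (closed_segment (Complex x1 y1) (Complex x2 y1)) f"
    "continuous_on (closed_segment (Complex x2 y1) (Complex x2 y2)) f"
    "continuous_on (closed_segment (Complex x2 y2) (Complex x1 y2)) f"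
    "continuous_on (closed_segment (Complex x1 y2) (Complex x1 y1)) f"
    using cont unfolding img by (auto elim: continuous_on_subset)
  note ints = conts[THEN contour_integrable_continuous_linepath]
  have "contour_integral (rectpath (Complex x1 y1) (Complex x2 y2)) f =
    contour_integral (linepath (Complex x1 y1) (Complex x2 y1)) f
    + (contour_integral (linepath (Complex x2 y1) (Complex x2 y2)) f
    + (contour_integral (linepath (Complex x2 y2) (Complex x1 y2)) f
    + contour_integral (linepath (Complex x1 y2) (Complex x1 y1)) f))"
    using ints by (simp add: rectpath_def Let_def contour_integral_join contour_integrable_joinI valid_path_join)
  moreover have "contour_integral (linepath (Complex x2 y2) (Complex x1 y2)) f = - contour_integral (linepath (Complex x1 y2) (Complex x2 y2)) f"
    "contour_integral (linepath (Complex x1 y2) (Complex x1 y1)) f = - contour_integral (linepath (Complex x1 y1) (Complex x1 y2)) f"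
    by (rule contour_integral_reverse_linepath; use conts in \<open>simp add: closed_segment_commute\<close>)+
  ultimately show ?thesis by simp
qed

text \<open>The pole of \<open>kern\<close> at the origin is split off as a factor \<open>1 / z\<close>.\<close>

definition kern_reg :: "real \<Rightarrow> complex \<Rightarrow> complex" where
  "kern_reg \<mu> z = ee (of_real \<mu> * z) / (if z = 0 then 2 * of_real pi * \<i> else (ee z - 1) / z)"

lemma kern_reg_holomorphic: "kern_reg \<mu> holomorphic_on {z. \<bar>Re z\<bar> < 1}"
proof -
  have "(ee has_field_derivative 2 * of_real pi * \<i>) (at 0)"
    unfolding ee_def by (auto intro!: derivative_eq_intros)
  then have d: "deriv ee 0 = 2 * of_real pi * \<i>" by (rule DERIV_imp_deriv)
  have "ee holomorphic_on UNIV" using ee_holomorphic[of "\<lambda>z. z" UNIV] by simp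
  from pole_lemma_open[OF this, of 0]
  have hol: "(\<lambda>z. if z = 0 then 2 * of_real pi * \<i> else (ee z - 1) / z) holomorphic_on UNIV"
    by (simp add: d cong: if_cong)
  have nz: "(if z = 0 then 2 * of_real pi * \<i> else (ee z - 1) / z) \<noteq> 0" if "\<bar>Re z\<bar> < 1" for z
  proof (cases "z = 0")
    case False
    have "ee z \<noteq> 1"
    proof
      assume "ee z = 1"
      then obtain n :: int where n: "z = of_int n" unfolding ee_eq_1_iff by (elim Ints_cases)
      then have "\<bar>n\<bar> < 1" using that by simp
      then show False using n False by simp
    qed
    then show ?thesis using False by simp
  qed simp
  show ?thesis unfolding kern_reg_def
    using nz by (intro holomorphic_on_divide holomorphic_on_subset[OF hol] holomorphic_intros) auto
qed

lemma kern_reg_0: "kern_reg \<mu> 0 = 1 / (2 * of_real pi * \<i>)"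
  by (simp add: kern_reg_def)

lemma kern_reg: "z \<noteq> 0 \<Longrightarrow> kern_reg \<mu> z / z = kern \<mu> z"
  by (simp add: kern_reg_def kern_def)

section \<open>Moving the line past one pole\<close>

definition Jfin :: "real \<Rightarrow> real \<Rightarrow> real \<Rightarrow> complex \<Rightarrow> real \<Rightarrow> complex" where
  "Jfin \<mu> c b s Y = \<i> * integral {-Y..Y} (\<lambda>y. Uint \<mu> c b s y)"

text \<open>In the variable \<open>z = w - (b + c)\<close> the rectangle between the two lines
  encloses only the pole \<open>0\<close>, whose residue gives the right-hand side. By periodicity
  of the kernel the right edge is \<open>ee lam\<close> times an integral of the same shape, and the
  horizontal edges are \<open>O(Y powr (- Re s))\<close>.\<close>

lemma Jfin_difference:
  assumes lam: "0 < lam" "lam \<le> 1" and c: "0 < c" "c < 1" and b: "b > 0" and s: "Re s > 0"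
  shows "((\<lambda>Y. ee (of_real lam) * Jfin lam c (b + 1) s Y - Jfin lam c b s Y) \<longlongrightarrow> of_real (b + c) powr (- s)) at_top"
proof -
  define \<beta> where "\<beta> = b + c"
  define F where "F z = (z + of_real \<beta>) powr (- s) * kern lam z" for z
  define H where "H Y y = contour_integral (linepath (Complex (- c) y) (Complex (1 - c) y)) F" for Y y :: real
  have sub: "z + of_real \<beta> \<notin> \<real>\<^sub>\<le>\<^sub>0" if "Re z > - \<beta>" for z
    using that by (auto simp: complex_nonpos_Reals_iff)
  have eq: "of_real \<beta> powr (- s) = H Y (- Y) + ee (of_real lam) * Jfin lam c (b + 1) s Y - H Y Y - Jfin lam c b s Y"
    if Y: "Y > 0" for Y
  proof -
    let ?R = "rectpath (Complex (- c) (- Y)) (Complex (1 - c) Y)"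
    \<comment> \<open>Right of the branch cut of the power and strictly between the neighbouring
      poles \<open>-1\<close> and \<open>1\<close> of the kernel.\<close>
    let ?S = "{z. Re z > - min \<beta> 1} \<inter> {z. Re z < 1}"
    define f where "f z = (z + of_real \<beta>) powr (- s) * kern_reg lam z" for z
    have img: "path_image ?R = cbox (Complex (- c) (- Y)) (Complex (1 - c) Y) - box (Complex (- c) (- Y)) (Complex (1 - c) Y)"
      using c Y by (intro path_image_rectpath_cbox_minus_box) auto
    have in0: "0 \<in> box (Complex (- c) (- Y)) (Complex (1 - c) Y)" using c Y by (simp add: in_box_complex_iff)
    have "((\<lambda>z. f z / (z - 0)) has_contour_integral (2 * pi * \<i> * winding_number ?R 0 * f 0)) ?R"
    proof (rule Cauchy_integral_formula_convex_simple)
      show "convex ?S" by (intro convex_Int convex_halfspace_Re_gt convex_halfspace_Re_lt)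
      show "f holomorphic_on ?S"
        unfolding f_def using sub
        by (intro holomorphic_intros holomorphic_on_subset[OF kern_reg_holomorphic]) auto
      have "open ?S" by (intro open_Int open_halfspace_Re_gt open_halfspace_Re_lt)
      then show "0 \<in> interior ?S" using b c using interior_open[of ?S] by (simp add: \<beta>_def del: interior_Int)
      show "path_image ?R \<subseteq> ?S - {0}"
        unfolding img using in0 c b by (auto simp: in_cbox_complex_iff \<beta>_def)
    qed auto
    also have "winding_number ?R 0 = 1" by (rule winding_number_rectpath[OF in0])
    also have "2 * pi * \<i> * 1 * f 0 = of_real \<beta> powr (- s)" by (simp add: f_def kern_reg_0)
    finally have "((\<lambda>z. f z / (z - 0)) has_contour_integral of_real \<beta> powr (- s)) ?R" .
    then have I: "(F has_contour_integral of_real \<beta> powr (- s)) ?R"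
    proof (rule has_contour_integral_eq)
      fix z assume "z \<in> path_image ?R"
      then have "z \<noteq> 0" using in0 unfolding img by auto
      then show "f z / (z - 0) = F z" using kern_reg[of z lam] by (simp add: f_def F_def flip: times_divide_eq_right)
    qed
    have ne: "ee z \<noteq> 1" if "z \<in> path_image ?R" for z
    proof
      assume "ee z = 1"
      then obtain n :: int where n: "z = of_int n" unfolding ee_eq_1_iff by (elim Ints_cases)
      have "- c \<le> of_int n" "of_int n \<le> 1 - c" using that n unfolding img by (auto simp: in_cbox_complex_iff)
      then have "n = 0" using c by linarith
      then show False using that n in0 unfolding img by auto
    qed
    have contF: "continuous_on (path_image ?R) F"
      unfolding F_def kern_def
    proof (intro continuous_intros)
      have pos: "Re z + \<beta> > 0" if "z \<in> path_image ?R" for z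
        using that b unfolding img by (auto simp: in_cbox_complex_iff \<beta>_def)
      show "path_image ?R \<subseteq> {z. 0 \<le> Re (z + of_real \<beta>) \<or> Im (z + of_real \<beta>) \<noteq> 0}"
        using pos less_imp_le by auto
      \<comment> \<open>A side condition of the continuity of \<open>powr\<close> at base
        \<open>0\<close>. The base never vanishes on the path, so the assumptions are
        contradictory.\<close>
      show "0 < Re (- s)" if "z \<in> path_image ?R" "z + of_real \<beta> = 0" for z
        using pos[OF that(1)] arg_cong[OF that(2), of Re] by simp
      show "\<forall>z\<in>path_image ?R. ee z - 1 \<noteq> 0" using ne by simp
    qed
    have "of_real \<beta> powr (- s) = H Y (- Y)
        + contour_integral (linepath (Complex (1-c) (-Y)) (Complex (1-c) Y)) F - H Y Y
        - contour_integral (linepath (Complex (-c) (-Y)) (Complex (-c) Y)) F"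
      unfolding contour_integral_unique[OF I, symmetric] H_def
      by (rule contour_integral_rectpath[OF contF])
    also have "contour_integral (linepath (Complex (1-c) (-Y)) (Complex (1-c) Y)) F = ee (of_real lam) * Jfin lam c (b + 1) s Y"
    proof -
      have "F (Complex (1 - c) y) = ee (of_real lam) * Uint lam c (b + 1) s y" for y
      proof -
        have "Complex (1 - c) y = Complex (- c) y + 1" by (simp add: complex_eq_iff)
        moreover have "Complex (1 - c) y + of_real \<beta> = Complex (b + 1) y" by (simp add: complex_eq_iff \<beta>_def)
        ultimately show ?thesis by (simp add: F_def Uint_def kern_shift)
      qed
      then show ?thesis
        using Y by (subst contour_integral_linepath_same_Re[where c = "1 - c" and a = "- Y" and b = Y]) (auto simp: Jfin_def)
    qed
    also have "contour_integral (linepath (Complex (-c) (-Y)) (Complex (-c) Y)) F = Jfin lam c b s Y"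
    proof -
      have "F (Complex (- c) y) = Uint lam c b s y" for y
      proof -
        have "Complex (- c) y + of_real \<beta> = Complex b y" by (simp add: complex_eq_iff \<beta>_def)
        then show ?thesis by (simp add: F_def Uint_def)
      qed
      then show ?thesis
        using Y by (subst contour_integral_linepath_same_Re[where c = "- c" and a = "- Y" and b = Y]) (auto simp: Jfin_def)
    qed
    finally show ?thesis by simp
  qed
  have Hb: "norm (H Y y) \<le> 2 * exp (pi/2 * \<bar>Im s\<bar>) * Y powr (- Re s)" if Y: "Y \<ge> 1" and y: "\<bar>y\<bar> = Y" for Y y
  proof -
    have seg: "Re z \<ge> - c \<and> Re z \<le> 1 - c \<and> Im z = y" if "z \<in> closed_segment (Complex (- c) y) (Complex (1 - c) y)" for z
      using that by (auto simp: closed_segment_same_Im closed_segment_eq_real_ivl)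
    have "norm (H Y y) \<le> 2 * exp (pi/2 * \<bar>Im s\<bar>) * Y powr (- Re s) * norm (Complex (1 - c) y - Complex (- c) y)"
      unfolding H_def
    proof (rule contour_integral_bound_linepath)
      show "F contour_integrable_on linepath (Complex (- c) y) (Complex (1 - c) y)"
      proof (rule contour_integrable_continuous_linepath, unfold F_def kern_def, intro continuous_intros)
        show "closed_segment (Complex (- c) y) (Complex (1 - c) y) \<subseteq> {z. 0 \<le> Re (z + of_real \<beta>) \<or> Im (z + of_real \<beta>) \<noteq> 0}"
          using seg b by (fastforce simp: \<beta>_def)
        show "0 < Re (- s)" if "z \<in> closed_segment (Complex (- c) y) (Complex (1 - c) y)" "z + of_real \<beta> = 0" for z
          using seg[OF that(1)] b arg_cong[OF that(2), of Re] by (simp add: \<beta>_def)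
        show "\<forall>z\<in>closed_segment (Complex (- c) y) (Complex (1 - c) y). ee z - 1 \<noteq> 0"
        proof
          fix z assume z: "z \<in> closed_segment (Complex (- c) y) (Complex (1 - c) y)"
          have "z \<notin> \<int>" using seg[OF z] Y y by (auto elim!: Ints_cases)
          then show "ee z - 1 \<noteq> 0" by (simp add: ee_eq_1_iff)
        qed
      qed
      fix z assume z: "z \<in> closed_segment (Complex (- c) y) (Complex (1 - c) y)"
      note sz = seg[OF z]
      have "norm (kern lam z) \<le> 2" by (rule norm_kern_le_1(1)) (use lam sz Y y in auto)
      moreover have "norm ((z + of_real \<beta>) powr (- s)) \<le> norm (z + of_real \<beta>) powr (- Re s) * exp (pi/2 * \<bar>Im s\<bar>)"
        using norm_powr_le[of "z + of_real \<beta>" "- s"] sz b by (simp add: \<beta>_def del: of_real_add)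
      moreover have le: "norm (z + of_real \<beta>) powr (- Re s) \<le> Y powr (- Re s)"
      proof (rule powr_mono2')
        show "Y \<le> norm (z + of_real \<beta>)" using abs_Im_le_cmod[of "z + of_real \<beta>"] sz y by simp
      qed (use s Y in auto)
      moreover have "norm (z + of_real \<beta>) powr (- Re s) * exp (pi/2 * \<bar>Im s\<bar>) \<le> Y powr (- Re s) * exp (pi/2 * \<bar>Im s\<bar>)"
        using le by (rule mult_right_mono) simp
      ultimately have "norm (kern lam z) \<le> 2"
        "norm ((z + of_real \<beta>) powr (- s)) \<le> Y powr (- Re s) * exp (pi/2 * \<bar>Im s\<bar>)" by linarith+
      then have "norm (F z) \<le> (Y powr (- Re s) * exp (pi/2 * \<bar>Im s\<bar>)) * 2"
        unfolding F_def norm_mult by (intro mult_mono) auto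
      then show "norm (F z) \<le> 2 * exp (pi/2 * \<bar>Im s\<bar>) * Y powr (- Re s)" by (simp add: mult_ac)
    qed auto
    moreover have "Complex (1 - c) y - Complex (- c) y = 1" by (simp add: complex_eq_iff)
    ultimately show ?thesis by simp
  qed
  have H0: "((\<lambda>Y. H Y Y - H Y (- Y)) \<longlongrightarrow> 0) at_top"
  proof (rule Lim_null_comparison)
    show "((\<lambda>Y. 4 * exp (pi/2 * \<bar>Im s\<bar>) * Y powr (- Re s)) \<longlongrightarrow> 0) at_top"
      using s by real_asymp
    show "eventually (\<lambda>Y. norm (H Y Y - H Y (- Y)) \<le> 4 * exp (pi/2 * \<bar>Im s\<bar>) * Y powr (- Re s)) at_top"
      using eventually_ge_at_top[of 1]
    proof eventually_elim
      case (elim Y)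
      then show ?case using Hb[of Y Y] Hb[of Y "- Y"] norm_triangle_ineq4[of "H Y Y" "H Y (- Y)"] by simp
    qed
  qed
  have "((\<lambda>Y. of_real \<beta> powr (- s) + (H Y Y - H Y (- Y))) \<longlongrightarrow> of_real \<beta> powr (- s) + 0) at_top"
    by (intro tendsto_intros H0)
  then have "((\<lambda>Y. ee (of_real lam) * Jfin lam c (b + 1) s Y - Jfin lam c b s Y) \<longlongrightarrow> of_real \<beta> powr (- s) + 0) at_top"
  proof (rule Lim_transform_eventually)
    show "eventually (\<lambda>Y. of_real \<beta> powr (- s) + (H Y Y - H Y (- Y)) =
       ee (of_real lam) * Jfin lam c (b + 1) s Y - Jfin lam c b s Y) at_top"
      using eventually_gt_at_top[of 0]
    proof eventually_elim
      case (elim Y)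
      show ?case unfolding eq[OF elim] by simp
    qed
  qed
  then show ?thesis by (simp add: \<beta>_def)
qed

text \<open>For \<open>lam = 1\<close> reflection leads to the parameter \<open>0\<close>, whose
  kernel does not decay upwards. By \<open>kern_1\<close> it is traded for the parameter
  \<open>1\<close>, and \<open>lam_ind\<close> records the constant that this costs.\<close>

definition lam_dual :: "real \<Rightarrow> real" where
  "lam_dual lam = (if lam = 1 then 1 else 1 - lam)"

definition lam_ind :: "real \<Rightarrow> complex" where
  "lam_ind lam = (if lam = 1 then 1 else 0)"

text \<open>
  \<open>J\<close> is the integral over the whole line \<open>Re w = b\<close>, with its lower half reflected to the upper one. For
  \<open>lam = 1\<close> the kernel tends to \<open>1\<close>, not \<open>0\<close>, below, and the last term is the integral of that constant part.
\<close>

definition J :: "real \<Rightarrow> real \<Rightarrow> real \<Rightarrow> complex \<Rightarrow> complex" where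
  "J lam c b s = \<i> * (U lam c b s - cnj (U (lam_dual lam) c b (cnj s))) + lam_ind lam * of_real b powr (1 - s) / (1 - s)"

lemma kern_cnj_dual:
  assumes "ee (cnj z) \<noteq> 1"
  shows "kern lam (cnj z) = - cnj (kern (lam_dual lam) z) + lam_ind lam"
proof (cases "lam = 1")
  case True
  then show ?thesis using kern_cnj[of 0 z] kern_1[OF assms] by (simp add: lam_dual_def lam_ind_def)
next
  case False
  then show ?thesis using kern_cnj[of lam z] by (simp add: lam_dual_def lam_ind_def)
qed

lemma lam_dual_pos: "0 < lam \<Longrightarrow> lam \<le> 1 \<Longrightarrow> 0 < lam_dual lam \<and> lam_dual lam \<le> 1"
  by (auto simp: lam_dual_def)

text \<open>Reflection turns the lower half into a second integral of type \<open>U\<close>, plus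
  the integral of a pure power if \<open>lam = 1\<close>. The power has an elementary primitive, and
  \<open>Re s > 1\<close> makes its boundary term at infinity vanish.\<close>

lemma Jfin_tendsto:
  assumes lam: "0 < lam" "lam \<le> 1" and c: "0 < c" "c < 1" and b: "b > 0" and s: "Re s > 1"
  shows "((\<lambda>Y. Jfin lam c b s Y) \<longlongrightarrow> J lam c b s) at_top"
proof -
  let ?ls = "lam_dual lam" and ?d = "lam_ind lam"
  note np = Complex_notin_nonpos[OF b]
  define P where "P y = Complex b (- y) powr (- s)" for y
  have cont_P: "continuous_on A P" for A
    unfolding P_def using b by (intro continuous_intros) (auto simp: complex_eq_iff)
  have eq: "Jfin lam c b s Y = \<i> * (integral {0..Y} (Uint lam c b s) - cnj (integral {0..Y} (Uint ?ls c b (cnj s))))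
       + ?d * ((of_real b powr (1 - s) - Complex b (- Y) powr (1 - s)) / (1 - s))" if Y: "Y > 0" for Y
  proof -
    have i: "Uint \<mu> c b s' integrable_on {x..y}" for \<mu> s' x y
      by (intro integrable_continuous_interval Uint_continuous c b)
    have "integral {-Y..Y} (Uint lam c b s) = integral {-Y..0} (Uint lam c b s) + integral {0..Y} (Uint lam c b s)"
      using Y by (intro Henstock_Kurzweil_Integration.integral_combine[symmetric] i) auto
    also have "integral {-Y..0} (Uint lam c b s) = integral {0..Y} (\<lambda>y. Uint lam c b s (- y))"
      using Henstock_Kurzweil_Integration.integral_reflect_real[of Y 0 "\<lambda>y. Uint lam c b s (- y)"] by simp
    also have "(\<lambda>y. Uint lam c b s (- y)) = (\<lambda>y. - cnj (Uint ?ls c b (cnj s) y) + ?d * P y)"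
    proof
      fix y
      have w: "Complex b (- y) = cnj (Complex b y)" "Complex (- c) (- y) = cnj (Complex (- c) y)" by (simp_all add: complex_eq_iff)
      have pw: "cnj (Complex b y) powr (- s) = cnj (Complex b y powr (- cnj s))"
        using b by (subst cnj_powr) auto
      have "ee (cnj (Complex (- c) y)) \<noteq> 1" using ee_neq_1_Re[OF c, of "- y"] unfolding w .
      then show "Uint lam c b s (- y) = - cnj (Uint ?ls c b (cnj s) y) + ?d * P y"
        unfolding Uint_def P_def w by (simp add: kern_cnj_dual pw algebra_simps)
    qed
    also have "integral {0..Y} (\<lambda>y. - cnj (Uint ?ls c b (cnj s) y) + ?d * P y)
       = - cnj (integral {0..Y} (Uint ?ls c b (cnj s))) + ?d * integral {0..Y} P"
    proof (rule integral_unique, intro has_integral_add has_integral_neg has_integral_mult_right)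
      show "((\<lambda>y. cnj (Uint ?ls c b (cnj s) y)) has_integral cnj (integral {0..Y} (Uint ?ls c b (cnj s)))) {0..Y}"
        using i[of ?ls "cnj s" 0 Y] by (simp add: has_integral_cnj[unfolded o_def] integrable_integral)
      show "(P has_integral integral {0..Y} P) {0..Y}"
        by (intro integrable_integral integrable_continuous_interval cont_P)
    qed
    finally have E: "integral {-Y..Y} (Uint lam c b s) =
      - cnj (integral {0..Y} (Uint ?ls c b (cnj s))) + ?d * integral {0..Y} P + integral {0..Y} (Uint lam c b s)" .
    have HI: "((\<lambda>y. \<i> * P y) has_integral (- (Complex b (- Y) powr (1 - s)) / (1 - s) - (- (Complex b (- 0) powr (1 - s)) / (1 - s)))) {0..Y}"
    proof (rule fundamental_theorem_of_calculus)
      fix y :: real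
      have n1: "1 - s \<noteq> 0" using s by auto
      have npy: "of_real b - \<i> * of_real y \<notin> \<real>\<^sub>\<le>\<^sub>0" using b by (auto simp: complex_nonpos_Reals_iff)
      have w: "Complex b (- y) = of_real b - \<i> * of_real y" for y by (simp add: complex_eq_iff)
      have D: "((\<lambda>z. (of_real b - \<i> * z) powr (1 - s)) has_field_derivative
          ((1 - s) * (of_real b - \<i> * of_real y) powr (1 - s - 1)) * (- \<i>)) (at (of_real y))"
        by (rule DERIV_chain2[where f = "\<lambda>z. z powr (1 - s)" and g = "\<lambda>z. of_real b - \<i> * z", OF has_field_derivative_powr[OF npy]])
           (auto intro!: derivative_eq_intros)
      have "((\<lambda>z. - ((of_real b - \<i> * z) powr (1 - s)) / (1 - s)) has_field_derivative \<i> * (of_real b - \<i> * of_real y) powr (- s)) (at (of_real y))"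
        using DERIV_cdivide[OF DERIV_minus[OF D], of "1 - s"] n1 by (simp add: mult.commute)
      then have "((\<lambda>y. - ((of_real b - \<i> * of_real y) powr (1 - s)) / (1 - s)) has_vector_derivative \<i> * (of_real b - \<i> * of_real y) powr (- s)) (at y within {0..Y})"
        by (rule has_vector_derivative_real_field)
      then show "((\<lambda>y. - (Complex b (- y) powr (1 - s)) / (1 - s)) has_vector_derivative \<i> * P y) (at y within {0..Y})"
        unfolding P_def w by simp
    qed (use Y in auto)
    then have "integral {0..Y} (\<lambda>y. \<i> * P y) = (of_real b powr (1 - s) - Complex b (- Y) powr (1 - s)) / (1 - s)"
      using integral_unique[OF HI] by (simp add: diff_divide_distrib complex_of_real_def)
    then have "\<i> * integral {0..Y} P = (of_real b powr (1 - s) - Complex b (- Y) powr (1 - s)) / (1 - s)"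
      by simp
    then have "?d * (\<i> * integral {0..Y} P) = ?d * ((of_real b powr (1 - s) - Complex b (- Y) powr (1 - s)) / (1 - s))"
      by simp
    then show ?thesis unfolding Jfin_def E by (simp add: algebra_simps)
  qed
  have lim0: "((\<lambda>Y. Complex b (- Y) powr (1 - s)) \<longlongrightarrow> 0) at_top"
  proof (rule Lim_null_comparison)
    show "((\<lambda>Y. Y powr (1 - Re s) * exp (pi/2 * \<bar>Im s\<bar>)) \<longlongrightarrow> 0) at_top" using s by real_asymp
    show "eventually (\<lambda>Y. norm (Complex b (- Y) powr (1 - s)) \<le> Y powr (1 - Re s) * exp (pi/2 * \<bar>Im s\<bar>)) at_top"
      using eventually_gt_at_top[of 0]
    proof eventually_elim
      case (elim Y)
      have "norm (Complex b (- Y)) powr (1 - Re s) \<le> Y powr (1 - Re s)"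
        using abs_Im_le_cmod[of "Complex b (- Y)"] elim s by (intro powr_mono2') auto
      then have "norm (Complex b (- Y)) powr Re (1 - s) * exp (pi/2 * \<bar>Im (1 - s)\<bar>) \<le> Y powr (1 - Re s) * exp (pi/2 * \<bar>Im s\<bar>)"
        by (simp add: mult_right_mono)
      with norm_powr_le[of "Complex b (- Y)" "1 - s"] b show ?case
        by (intro order_trans[OF norm_powr_le]) auto
    qed
  qed
  have "((\<lambda>Y. \<i> * (integral {0..Y} (Uint lam c b s) - cnj (integral {0..Y} (Uint ?ls c b (cnj s))))
       + ?d * ((of_real b powr (1 - s) - Complex b (- Y) powr (1 - s)) / (1 - s))) \<longlongrightarrow>
       \<i> * (U lam c b s - cnj (U ?ls c b (cnj s))) + ?d * ((of_real b powr (1 - s) - 0) / (1 - s))) at_top"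
    using s lam lam_dual_pos[OF lam] by (intro tendsto_intros U_limit c b lim0) auto
  then have "((\<lambda>Y. Jfin lam c b s Y) \<longlongrightarrow> \<i> * (U lam c b s - cnj (U ?ls c b (cnj s))) + ?d * ((of_real b powr (1 - s) - 0) / (1 - s))) at_top"
  proof (rule Lim_transform_eventually)
    show "eventually (\<lambda>Y. \<i> * (integral {0..Y} (Uint lam c b s) - cnj (integral {0..Y} (Uint ?ls c b (cnj s))))
       + ?d * ((of_real b powr (1 - s) - Complex b (- Y) powr (1 - s)) / (1 - s)) = Jfin lam c b s Y) at_top"
      using eventually_gt_at_top[of 0] by eventually_elim (use eq in simp)
  qed
  then show ?thesis by (simp add: J_def)
qed

lemma J_difference:
  assumes lam: "0 < lam" "lam \<le> 1" and c: "0 < c" "c < 1" and b: "b > 0" and s: "Re s > 1"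
  shows "ee (of_real lam) * J lam c (b + 1) s - J lam c b s = of_real (b + c) powr (- s)"
proof (rule tendsto_unique[OF _ _ Jfin_difference[OF lam c b]])
  show "((\<lambda>Y. ee (of_real lam) * Jfin lam c (b + 1) s Y - Jfin lam c b s Y) \<longlongrightarrow>
      ee (of_real lam) * J lam c (b + 1) s - J lam c b s) at_top"
    using b by (intro tendsto_intros Jfin_tendsto lam c s) auto
qed (use s in auto)

lemma J_large:
  assumes lam: "0 < lam" "lam \<le> 1" and c: "0 < c" "c < 1" and b: "b > 0" and s: "Re s > 1"
  shows "(\<lambda>M. J lam c (b + real M) s) \<longlonglongrightarrow> 0"
proof -
  have U0: "(\<lambda>M. U \<mu> c (b + real M) s') \<longlonglongrightarrow> 0" if \<mu>: "\<mu> > 0" and s': "Re s' > 1" for \<mu> s'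
  proof (rule Lim_null_comparison)
    show "(\<lambda>M. (b + real M) powr (- Re s') * (exp (pi/2 * \<bar>Im s'\<bar>) / sin (pi * c)) / (2 * pi * \<mu>)) \<longlonglongrightarrow> 0"
    proof -
      have "(\<lambda>M. (b + real M) powr (- Re s')) \<longlonglongrightarrow> 0" using s' by real_asymp
      from tendsto_mult_right[OF this, of "(exp (pi/2 * \<bar>Im s'\<bar>) / sin (pi * c)) / (2 * pi * \<mu>)"]
      show ?thesis by simp
    qed
    show "eventually (\<lambda>M. norm (U \<mu> c (b + real M) s') \<le> (b + real M) powr (- Re s') * (exp (pi/2 * \<bar>Im s'\<bar>) / sin (pi * c)) / (2 * pi * \<mu>)) sequentially"
      using b s' \<mu> by (intro always_eventually allI norm_U_large c) auto
  qed
  have P0: "(\<lambda>M. of_real (b + real M) powr (1 - s)) \<longlonglongrightarrow> 0"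
  proof (rule Lim_null_comparison)
    show "(\<lambda>M. (b + real M) powr (1 - Re s)) \<longlonglongrightarrow> 0" using s by real_asymp
    show "eventually (\<lambda>M. norm (complex_of_real (b + real M) powr (1 - s)) \<le> (b + real M) powr (1 - Re s)) sequentially"
      using b by (intro always_eventually allI) (simp add: norm_powr_real_powr)
  qed
  have "(\<lambda>M. \<i> * (U lam c (b + real M) s - cnj (U (lam_dual lam) c (b + real M) (cnj s)))
      + lam_ind lam * of_real (b + real M) powr (1 - s) / (1 - s)) \<longlonglongrightarrow> \<i> * (0 - cnj 0) + lam_ind lam * 0 / (1 - s)"
    using s lam lam_dual_pos[OF lam] by (intro tendsto_intros U0 P0) auto
  then show ?thesis by (simp add: J_def)
qed

text \<open>The differences of \<open>J_difference\<close> telescope along the abscissae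
  \<open>\<alpha>/2 + m\<close>, where \<open>b + c\<close> is exactly \<open>m + \<alpha>\<close>.
  The line that remains recedes to infinity and contributes nothing, which leaves the first one with
  a minus sign.\<close>

theorem lerch_series_eq_J:
  assumes lam: "0 < lam" "lam \<le> 1" and \<alpha>: "0 < \<alpha>" "\<alpha> \<le> 1" and s: "Re s > 1"
  shows "(\<lambda>m. ee (of_real (lam * real m)) * of_real (real m + \<alpha>) powr (- s)) sums (- J lam (\<alpha>/2) (\<alpha>/2) s)"
proof -
  let ?c = "\<alpha> / 2"
  have c: "0 < ?c" "?c < 1" using \<alpha> by auto
  have part: "(\<Sum>m<M. ee (of_real (lam * real m)) * of_real (real m + \<alpha>) powr (- s)) =
     ee (of_real (lam * real M)) * J lam ?c (?c + real M) s - J lam ?c ?c s" for M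
  proof (induction M)
    case (Suc M)
    let ?E = "ee (of_real (lam * real M))" and ?X = "of_real (real M + \<alpha>) powr (- s)"
    have "ee (of_real lam) * J lam ?c (?c + real M + 1) s - J lam ?c (?c + real M) s = of_real (?c + real M + ?c) powr (- s)"
      using \<alpha> by (intro J_difference lam c s) auto
    also have "of_real (?c + real M + ?c) = (of_real (real M + \<alpha>) :: complex)" by simp
    finally have X: "?X = ee (of_real lam) * J lam ?c (?c + real M + 1) s - J lam ?c (?c + real M) s" by simp
    have E: "ee (of_real (lam * real (Suc M))) = ?E * ee (of_real lam)"
      by (simp add: algebra_simps flip: ee_add)
    have i: "?c + real (Suc M) = ?c + real M + 1" by simp
    show ?case unfolding sum.lessThan_Suc Suc X E i by (simp only: right_diff_distrib mult.assoc) simp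
  qed simp
  have "(\<lambda>M. ee (of_real (lam * real M)) * J lam ?c (?c + real M) s) \<longlonglongrightarrow> 0"
  proof (rule Lim_null_comparison)
    show "(\<lambda>M. norm (J lam ?c (?c + real M) s)) \<longlonglongrightarrow> 0"
      using J_large[OF lam c _ s, of ?c] \<alpha> by (intro tendsto_norm_zero) auto
    show "eventually (\<lambda>M. norm (ee (of_real (lam * real M)) * J lam ?c (?c + real M) s) \<le> norm (J lam ?c (?c + real M) s)) sequentially"
      by (simp add: norm_mult norm_ee)
  qed
  then have "(\<lambda>M. ee (of_real (lam * real M)) * J lam ?c (?c + real M) s - J lam ?c ?c s) \<longlonglongrightarrow> 0 - J lam ?c ?c s"
    by (intro tendsto_intros)
  then show ?thesis unfolding sums_def part by simp
qed

section \<open>Functional equation\<close>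

lemma sin_pi_ge:
  assumes "0 \<le> x" "x \<le> 1/2"
  shows "sin (pi * x) \<ge> x"
proof -
  define t where "t = pi * x"
  have t: "0 \<le> t" "t \<le> 8/5" using assms pi_less_4 pi_approx mult_mono[of pi "16/5" x "1/2"] by (auto simp: t_def)
  have "\<bar>sin t - (\<Sum>m<3. sin_coeff m * t ^ m)\<bar> \<le> inverse (fact 3) * \<bar>t\<bar> ^ 3"
    by (rule Maclaurin_sin_bound)
  also have "(\<Sum>m<3. sin_coeff m * t ^ m) = t" by (simp add: sin_coeff_def eval_nat_numeral)
  also have "inverse (fact 3) * \<bar>t\<bar> ^ 3 = t * (t * t) / 6" using t by (simp add: fact_numeral eval_nat_numeral)
  finally have "sin t \<ge> t - t * (t * t) / 6" by linarith
  moreover have "t * (t * t) \<le> t * 3"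
    using t mult_mono[of t "8/5" t "8/5"] by (intro mult_left_mono) auto
  ultimately have "sin t \<ge> t / 2" by linarith
  moreover have "2 * x \<le> t" using assms pi_ge_two mult_right_mono[of 2 pi x] by (simp add: t_def)
  ultimately show ?thesis by (simp add: t_def)
qed

lemma one_minus_exp_ge:
  fixes t :: real assumes "t > 0"
  shows "1 / (1 - exp (- t)) \<le> 1 + 1 / t" and "1 - exp (- t) > 0"
proof -
  show p: "1 - exp (- t) > 0" using assms by simp
  have "exp (- t) \<le> 1 / (1 + t)"
    using exp_ge_add_one_self[of t] assms by (simp add: exp_minus field_simps)
  then have "1 - exp (- t) \<ge> t / (1 + t)" using assms by (simp add: field_simps)
  then have "1 / (1 - exp (- t)) \<le> 1 / (t / (1 + t))"
    using assms p by (intro divide_left_mono) auto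
  then show "1 / (1 - exp (- t)) \<le> 1 + 1 / t" using assms by (simp add: field_simps)
qed

text \<open>For \<open>\<alpha> = 1\<close> the corner \<open>w = 0\<close> is itself a pole of the
  shifted kernel, so a lower bound linear in \<open>norm w\<close> is what can hold uniformly. The
  left side is at least \<open>Re w\<close> and at least \<open>Im w / 2\<close>, hence at least a
  third of \<open>Re w + Im w\<close>.\<close>

lemma norm_ee_minus_1_corner:
  assumes \<alpha>: "0 < \<alpha>" "\<alpha> \<le> 1" and w: "0 \<le> Re w" "Re w \<le> \<alpha>/2" "0 \<le> Im w" "Im w \<le> 1"
  shows "norm (ee (w - of_real \<alpha>) - 1) \<ge> norm w / 3"
proof -
  define u where "u = \<alpha> - Re w"
  have u: "Re w \<le> u" "u \<le> 1 - Re w" "0 \<le> u" using \<alpha> w by (auto simp: u_def)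
  have "sin (pi * u) \<ge> Re w"
  proof (cases "u \<le> 1/2")
    case True
    then show ?thesis using sin_pi_ge[of u] u by linarith
  next
    case False
    have "sin (pi * u) = sin (pi * (1 - u))" by (simp add: right_diff_distrib)
    then show ?thesis using sin_pi_ge[of "1 - u"] u False w by linarith
  qed
  moreover have "\<bar>sin (pi * Re (w - of_real \<alpha>))\<bar> = \<bar>sin (pi * u)\<bar>"
  proof -
    have "pi * Re (w - of_real \<alpha>) = - (pi * u)" by (simp add: u_def algebra_simps)
    then show ?thesis by simp
  qed
  ultimately have s: "\<bar>sin (pi * Re (w - of_real \<alpha>))\<bar> \<ge> Re w" by linarith
  have "\<bar>sin (pi * Re (w - of_real \<alpha>))\<bar> * 1 \<le> \<bar>sin (pi * Re (w - of_real \<alpha>))\<bar> * (1 + exp (- (2 * pi * Im (w - of_real \<alpha>))))"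
    by (intro mult_left_mono) auto
  then have A1: "norm (ee (w - of_real \<alpha>) - 1) \<ge> Re w"
    using norm_ee_minus_1_ge[of "w - of_real \<alpha>"] s by linarith
  have A2: "norm (ee (w - of_real \<alpha>) - 1) \<ge> Im w / 2"
  proof (cases "Im w = 0")
    case False
    then have y: "Im w > 0" using w by simp
    define t where "t = 2 * pi * Im w"
    have t: "t > 0" using y by (simp add: t_def)
    have "exp (- t) \<le> 1 / (1 + t)" using exp_ge_add_one_self[of t] t by (simp add: exp_minus field_simps)
    moreover have "1 - 1 / (1 + t) \<ge> Im w / 2"
    proof -
      have "Im w * (1 + t) \<le> 2 * t"
      proof -
        have "Im w * (1 + t) \<le> Im w + t" using w t mult_right_mono[of "Im w" 1 t] by (simp add: distrib_left)
        moreover have "Im w * 1 \<le> Im w * (2 * pi)" using pi_ge_two w by (intro mult_left_mono) auto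
        then have "Im w \<le> t" by (simp add: t_def mult.commute)
        ultimately show ?thesis by linarith
      qed
      then show ?thesis using t by (simp add: field_simps)
    qed
    ultimately have "1 - exp (- t) \<ge> Im w / 2" by linarith
    then show ?thesis using norm_ee_minus_1_ge'[of "w - of_real \<alpha>"] by (simp add: t_def)
  qed simp
  show ?thesis using A1 A2 cmod_le[of w] w by simp
qed

section \<open>Moving the line to the imaginary axis\<close>

definition Gint :: "real \<Rightarrow> real \<Rightarrow> complex \<Rightarrow> complex \<Rightarrow> complex" where
  "Gint \<mu> \<alpha> s w = w powr (- s) * kern \<mu> (w - of_real \<alpha>)"

definition quarter :: "real \<Rightarrow> complex set" where
  "quarter \<alpha> = {w. 0 \<le> Re w \<and> Re w \<le> \<alpha>/2 \<and> 0 \<le> Im w}"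

lemma ee_neq_1_Im: "Im z \<noteq> 0 \<Longrightarrow> ee z \<noteq> 1"
  by (auto simp: ee_eq_1_iff elim!: Ints_cases)

lemma ee_neq_1_quarter:
  assumes \<alpha>: "0 < \<alpha>" "\<alpha> \<le> 1" and w: "w \<in> quarter \<alpha>" "w \<noteq> 0"
  shows "ee (w - of_real \<alpha>) \<noteq> 1"
proof (cases "Im w = 0")
  case True
  then have "norm (ee (w - of_real \<alpha>) - 1) \<ge> norm w / 3"
    using w by (intro norm_ee_minus_1_corner \<alpha>) (auto simp: quarter_def)
  moreover have "norm w / 3 > 0" using w by simp
  ultimately show ?thesis by auto
qed (simp add: ee_neq_1_Im)

text \<open>The critical point is the corner \<open>0\<close>, where the kernel may have a simple
  pole. The assumption \<open>Re s < -1\<close> lets \<open>w powr (- s)\<close> outweigh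
  it.\<close>

lemma Gint_continuous:
  assumes \<alpha>: "0 < \<alpha>" "\<alpha> \<le> 1" and s: "Re s < -1" and \<mu>: "\<mu> \<ge> 0"
  shows "continuous_on (quarter \<alpha>) (Gint \<mu> \<alpha> s)"
  unfolding continuous_on_eq_continuous_within
proof
  fix w assume w: "w \<in> quarter \<alpha>"
  show "continuous (at w within quarter \<alpha>) (Gint \<mu> \<alpha> s)"
  proof (cases "w = 0")
    case False
    have "continuous_on (quarter \<alpha> - {0}) (Gint \<mu> \<alpha> s)"
      unfolding Gint_def kern_def
      using ee_neq_1_quarter[OF \<alpha>] by (intro continuous_intros) (auto simp: quarter_def)
    then have "continuous (at w within quarter \<alpha> - {0}) (Gint \<mu> \<alpha> s)"
      using w False by (simp add: continuous_on_eq_continuous_within)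
    moreover have "at w within quarter \<alpha> - {0} = at w within quarter \<alpha>"
      using False by (intro at_within_nhd[of _ "- {0}"]) auto
    ultimately show ?thesis by (simp add: continuous_within)
  next
    case True
    have "(Gint \<mu> \<alpha> s \<longlongrightarrow> 0) (at 0 within quarter \<alpha>)"
    proof (rule Lim_null_comparison)
      have "((\<lambda>w::complex. norm w powr (- Re s - 1)) \<longlongrightarrow> 0) (at 0 within quarter \<alpha>)"
        by (rule tendsto_zero_powrI[where b = "- Re s - 1"])
           (use s in \<open>auto intro!: tendsto_eq_intros\<close>)
      from tendsto_mult_right_zero[OF this]
      show "((\<lambda>w. (3 * exp (pi/2 * \<bar>Im s\<bar>)) * norm w powr (- Re s - 1)) \<longlongrightarrow> 0) (at 0 within quarter \<alpha>)" .
      have "eventually (\<lambda>w. w \<in> quarter \<alpha> \<and> w \<noteq> 0 \<and> norm w < 1) (at 0 within quarter \<alpha>)"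
        by (auto simp: eventually_at dist_norm intro!: exI[of _ 1])
      then show "eventually (\<lambda>w. norm (Gint \<mu> \<alpha> s w) \<le> (3 * exp (pi/2 * \<bar>Im s\<bar>)) * norm w powr (- Re s - 1)) (at 0 within quarter \<alpha>)"
      proof eventually_elim
        case (elim w)
        then have w0: "norm w > 0" by simp
        have wq: "0 \<le> Re w" "Re w \<le> \<alpha>/2" "0 \<le> Im w" "Im w \<le> 1"
          using elim abs_Im_le_cmod[of w] by (auto simp: quarter_def)
        have l: "norm (ee (w - of_real \<alpha>) - 1) \<ge> norm w / 3" by (rule norm_ee_minus_1_corner[OF \<alpha> wq])
        have "norm (kern \<mu> (w - of_real \<alpha>)) \<le> 1 / (norm w / 3)"
          unfolding kern_def norm_divide using l w0 \<mu> wq by (intro frac_le) (auto simp: norm_ee)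
        moreover have "norm (w powr (- s)) \<le> norm w powr (- Re s) * exp (pi/2 * \<bar>Im s\<bar>)"
          using norm_powr_le[of w "- s"] wq by simp
        ultimately have "norm (Gint \<mu> \<alpha> s w) \<le> (norm w powr (- Re s) * exp (pi/2 * \<bar>Im s\<bar>)) * (1 / (norm w / 3))"
          unfolding Gint_def norm_mult by (intro mult_mono) auto
        also have "\<dots> = (3 * exp (pi/2 * \<bar>Im s\<bar>)) * norm w powr (- Re s - 1)"
          using w0 by (simp add: powr_diff)
        finally show ?case .
      qed
    qed
    \<comment> \<open>The limit agrees with the value because \<open>0 powr (- s)\<close> is
      \<open>0\<close> by convention.\<close>
    then show ?thesis unfolding True continuous_within by (simp add: Gint_def)
  qed
qed

definition Vint :: "real \<Rightarrow> real \<Rightarrow> complex \<Rightarrow> real \<Rightarrow> complex" where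
  "Vint \<mu> \<alpha> s y = Gint \<mu> \<alpha> s (Complex 0 y)"

definition V :: "real \<Rightarrow> real \<Rightarrow> complex \<Rightarrow> complex" where
  "V \<mu> \<alpha> s = integral {0..} (Vint \<mu> \<alpha> s)"

lemma Vint_continuous:
  assumes \<alpha>: "0 < \<alpha>" "\<alpha> \<le> 1" and s: "Re s < -1" and \<mu>: "\<mu> \<ge> 0"
  shows "continuous_on {0..} (Vint \<mu> \<alpha> s)"
  unfolding Vint_def
  by (rule continuous_on_compose2[OF Gint_continuous[OF assms]])
     (use \<alpha> in \<open>auto simp: quarter_def intro!: continuous_intros\<close>)

text \<open>One constant \<open>K\<close> serves for all \<open>N\<close>, while the rate grows with
  \<open>N\<close>; this makes the remainders of the expansion tend to 0. The estimate
  \<open>1 / (1 - exp (- t)) \<le> 1 + 1 / t\<close> costs one power of \<open>y\<close>, which the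
  factor \<open>y powr (- Re s)\<close> affords.\<close>

lemma Vint_bound:
  assumes \<alpha>: "0 < \<alpha>" "\<alpha> \<le> 1" and s: "Re s < -1" and \<mu>: "\<mu> > 0"
  obtains K where "K \<ge> 0"
    "\<And>N y. y \<ge> 0 \<Longrightarrow> norm (Vint (\<mu> + real N) \<alpha> s y) \<le> K * exp (- (pi * \<mu> + 2 * pi * real N) * y)"
proof -
  define p where "p = - Re s"
  define k where "k = pi * \<mu>"
  have p: "p > 1" and k: "k > 0" using s \<mu> by (auto simp: p_def k_def)
  define K where "K = exp (pi/2 * \<bar>Im s\<bar>) * ((p / k) powr p + ((p - 1) / k) powr (p - 1))"
  have "norm (Vint (\<mu> + real N) \<alpha> s y) \<le> K * exp (- (pi * \<mu> + 2 * pi * real N) * y)" if y: "y \<ge> 0" for N y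
  proof (cases "y = 0")
    case True
    have z: "Complex 0 0 = 0" by (simp add: complex_eq_iff)
    show ?thesis using True by (simp add: Vint_def Gint_def z K_def)
  next
    case False
    then have y: "y > 0" using that by simp
    let ?E = "exp (- (2 * pi * (\<mu> + real N) * y))"
    have t: "2 * pi * y > 0" using y by simp
    have n: "norm (Complex 0 y) = y" using y by (simp add: cmod_def)
    have "norm (ee (Complex 0 y - of_real \<alpha>) - 1) \<ge> 1 - exp (- (2 * pi * y))"
      using norm_ee_minus_1_ge'[of "Complex 0 y - of_real \<alpha>"] by simp
    then have "norm (kern (\<mu> + real N) (Complex 0 y - of_real \<alpha>)) \<le> ?E / (1 - exp (- (2 * pi * y)))"
      unfolding kern_def norm_divide using one_minus_exp_ge(2)[OF t]
      by (intro frac_le) (auto simp: norm_ee algebra_simps)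
    also have "\<dots> = ?E * (1 / (1 - exp (- (2 * pi * y))))" by simp
    also have "\<dots> \<le> ?E * (1 + 1 / (2 * pi * y))"
      by (intro mult_left_mono one_minus_exp_ge(1)[OF t]) auto
    also have "\<dots> \<le> ?E * (1 + 1 / y)"
    proof -
      have "1 * y \<le> (2 * pi) * y" using pi_ge_two y by (intro mult_right_mono) auto
      then have "1 / (2 * pi * y) \<le> 1 / y" using y by (intro divide_left_mono) auto
      then show ?thesis by (intro mult_left_mono) auto
    qed
    finally have kb: "norm (kern (\<mu> + real N) (Complex 0 y - of_real \<alpha>)) \<le> ?E * (1 + 1 / y)" .
    have "norm (Complex 0 y powr (- s)) \<le> y powr p * exp (pi/2 * \<bar>Im s\<bar>)"
      using norm_powr_le[of "Complex 0 y" "- s"] by (simp add: n p_def)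
    with kb have "norm (Vint (\<mu> + real N) \<alpha> s y) \<le> (y powr p * exp (pi/2 * \<bar>Im s\<bar>)) * (?E * (1 + 1 / y))"
      unfolding Vint_def Gint_def norm_mult by (intro mult_mono) auto
    also have "\<dots> = exp (pi/2 * \<bar>Im s\<bar>) * (y powr p + y powr (p - 1)) * ?E"
      using y by (simp add: powr_diff algebra_simps)
    also have "\<dots> \<le> exp (pi/2 * \<bar>Im s\<bar>) * ((p / k) powr p * exp (k * y) + ((p - 1) / k) powr (p - 1) * exp (k * y)) * ?E"
      using p k y by (intro mult_right_mono mult_left_mono add_mono powr_le_exp_mult) auto
    also have "\<dots> = K * (exp (k * y) * ?E)" by (simp add: K_def algebra_simps)
    also have "exp (k * y) * ?E = exp (- (pi * \<mu> + 2 * pi * real N) * y)"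
      by (simp add: k_def algebra_simps flip: exp_add)
    finally show ?thesis .
  qed
  moreover have "K \<ge> 0" by (simp add: K_def)
  ultimately show ?thesis using that by blast
qed

text \<open>Cauchy's theorem on the half strip. The bottom edge survives; it is disposed of only in
  \<open>J_eq_V\<close>, together with that of the reflected half.\<close>

lemma U_eq_V:
  assumes \<alpha>: "0 < \<alpha>" "\<alpha> \<le> 1" and s: "Re s < -1" and \<mu>: "0 < \<mu>" "\<mu> \<le> 1"
  shows "\<i> * U \<mu> (\<alpha>/2) (\<alpha>/2) s = \<i> * V \<mu> \<alpha> s - integral {0..\<alpha>/2} (\<lambda>x. Gint \<mu> \<alpha> s (of_real x))"
proof -
  let ?b = "\<alpha>/2" and ?G = "Gint \<mu> \<alpha> s"
  have b: "?b > 0" "?b < 1" using \<alpha> by auto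
  have Gc: "continuous_on A ?G" if "A \<subseteq> quarter \<alpha>" for A
    using continuous_on_subset[OF Gint_continuous[OF \<alpha> s] that] \<mu> by simp
  define H where "H Y = contour_integral (linepath (Complex 0 Y) (Complex ?b Y)) ?G" for Y
  have E: "contour_integral (linepath (Complex 0 0) (Complex ?b 0)) ?G = integral {0..?b} (\<lambda>x. ?G (of_real x))"
  proof -
    have c: "Complex 0 0 = 0" "Complex ?b 0 = of_real ?b" by (simp_all add: complex_eq_iff)
    have "?G contour_integrable_on linepath (Complex 0 0) (Complex ?b 0)"
      by (intro contour_integrable_continuous_linepath Gc)
         (use b in \<open>auto simp: quarter_def closed_segment_same_Im closed_segment_eq_real_ivl\<close>)
    then have "(?G has_contour_integral contour_integral (linepath (Complex 0 0) (Complex ?b 0)) ?G) (linepath (Complex 0 0) (Complex ?b 0))"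
      by (rule has_contour_integral_integral)
    then have "((\<lambda>x. ?G (of_real x)) has_integral contour_integral (linepath (Complex 0 0) (Complex ?b 0)) ?G) {Re 0..Re (of_real ?b)}"
      unfolding c using b by (subst (asm) has_contour_integral_linepath_Reals_iff) auto
    then show ?thesis by (simp add: integral_unique)
  qed
  have eq: "integral {0..?b} (\<lambda>x. ?G (of_real x)) + \<i> * integral {0..Y} (Uint \<mu> ?b ?b s) - H Y - \<i> * integral {0..Y} (Vint \<mu> \<alpha> s) = 0"
    if Y: "Y > 0" for Y
  proof -
    let ?S = "cbox (Complex 0 0) (Complex ?b Y)"
    have Sq: "?S \<subseteq> quarter \<alpha>" by (auto simp: quarter_def in_cbox_complex_iff)
    have "(?G has_contour_integral 0) (rectpath (Complex 0 0) (Complex ?b Y))"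
    \<comment> \<open>The origin, a branch point, is a corner of the rectangle. The version used
      asks for continuity on the closed rectangle and differentiability only inside.\<close>
    proof (rule Cauchy_theorem_convex[where S = ?S and K = "{}"])
      show "continuous_on ?S ?G" by (rule Gc[OF Sq])
      show "?G field_differentiable at x" if "x \<in> interior ?S - {}" for x
      proof -
        have x: "Re x > 0" "Im x > 0" using that by (auto simp: in_box_complex_iff)
        have "open ({z. Re z > 0} \<inter> {z. Im z > 0})" by (intro open_Int open_halfspace_Re_gt open_halfspace_Im_gt)
        moreover have "?G holomorphic_on ({z. Re z > 0} \<inter> {z. Im z > 0})"
          unfolding Gint_def kern_def using ee_neq_1_Im
          by (intro holomorphic_intros) (auto simp: complex_nonpos_Reals_iff)
        ultimately show ?thesis using x by (auto intro: holomorphic_on_imp_differentiable_at)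
      qed
      show "path_image (rectpath (Complex 0 0) (Complex ?b Y)) \<subseteq> ?S"
        using b Y by (intro path_image_rectpath_subset_cbox) auto
    qed auto
    then have "contour_integral (rectpath (Complex 0 0) (Complex ?b Y)) ?G = 0" by (rule contour_integral_unique)
    moreover have "contour_integral (linepath (Complex ?b 0) (Complex ?b Y)) ?G = \<i> * integral {0..Y} (Uint \<mu> ?b ?b s)"
    proof -
      have "Complex ?b y - of_real \<alpha> = Complex (- ?b) y" for y by (simp add: complex_eq_iff)
      then show ?thesis using Y
        by (subst contour_integral_linepath_same_Re[where c = ?b and a = 0 and b = Y]) (auto simp: Uint_def[abs_def] Gint_def)
    qed
    moreover have "contour_integral (linepath (Complex 0 0) (Complex 0 Y)) ?G = \<i> * integral {0..Y} (Vint \<mu> \<alpha> s)"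
      using Y by (subst contour_integral_linepath_same_Re[where c = 0 and a = 0 and b = Y]) (auto simp: Vint_def[abs_def])
    ultimately show ?thesis
      using contour_integral_rectpath[of 0 0 ?b Y, OF Gc[OF order_trans[OF path_image_rectpath_subset_cbox Sq]]] b Y E
      by (simp add: H_def)
  qed
  have H0: "(H \<longlongrightarrow> 0) at_top"
  proof (rule Lim_null_comparison)
    show "((\<lambda>Y. (?b + Y) powr (- Re s) * exp (pi/2 * \<bar>Im s\<bar>) * (2 * exp (- (2 * pi * \<mu> * Y))) * ?b) \<longlongrightarrow> 0) at_top"
    proof -
      define p where "p = - Re s"
      define k where "k = 2 * pi * \<mu>"
      have "p > 0" "k > 0" using s \<mu> by (auto simp: p_def k_def)
      then have "((\<lambda>Y. (?b + Y) powr p * exp (- (k * Y))) \<longlongrightarrow> 0) at_top" using b by real_asymp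
      from tendsto_mult_right_zero[OF this, of "exp (pi/2 * \<bar>Im s\<bar>) * 2 * ?b"]
      show ?thesis by (simp add: p_def k_def mult_ac)
    qed
    show "eventually (\<lambda>Y. norm (H Y) \<le> (?b + Y) powr (- Re s) * exp (pi/2 * \<bar>Im s\<bar>) * (2 * exp (- (2 * pi * \<mu> * Y))) * ?b) at_top"
      using eventually_ge_at_top[of 1]
    proof eventually_elim
      case (elim Y)
      let ?B = "(?b + Y) powr (- Re s) * exp (pi/2 * \<bar>Im s\<bar>) * (2 * exp (- (2 * pi * \<mu> * Y)))"
      have seg: "0 \<le> Re z \<and> Re z \<le> ?b \<and> Im z = Y" if "z \<in> closed_segment (Complex 0 Y) (Complex ?b Y)" for z
        using that b by (auto simp: closed_segment_same_Im closed_segment_eq_real_ivl)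
      have "norm (H Y) \<le> ?B * norm (Complex ?b Y - Complex 0 Y)"
        unfolding H_def
      proof (rule contour_integral_bound_linepath)
        show "?G contour_integrable_on linepath (Complex 0 Y) (Complex ?b Y)"
          by (intro contour_integrable_continuous_linepath Gc) (use seg elim in \<open>auto simp: quarter_def\<close>)
        fix z assume "z \<in> closed_segment (Complex 0 Y) (Complex ?b Y)"
        note z = seg[OF this]
        have "norm (kern \<mu> (z - of_real \<alpha>)) \<le> 2 * exp (- (2 * pi * \<mu> * Y))"
          using norm_kern_le_1(2)[of \<mu> "z - of_real \<alpha>"] z elim \<mu> by simp
        moreover have "norm (z powr (- s)) \<le> (?b + Y) powr (- Re s) * exp (pi/2 * \<bar>Im s\<bar>)"
        proof -
          have "norm z \<le> ?b + Y" using cmod_le[of z] z elim by simp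
          then have "norm z powr (- Re s) \<le> (?b + Y) powr (- Re s)" using s by (intro powr_mono2) auto
          then have "norm z powr (- Re s) * exp (pi/2 * \<bar>Im s\<bar>) \<le> (?b + Y) powr (- Re s) * exp (pi/2 * \<bar>Im s\<bar>)"
            by (rule mult_right_mono) simp
          moreover have "norm (z powr (- s)) \<le> norm z powr (- Re s) * exp (pi/2 * \<bar>Im s\<bar>)"
            using norm_powr_le[of z "- s"] z by simp
          ultimately show ?thesis by linarith
        qed
        ultimately show "norm (?G z) \<le> ?B" unfolding Gint_def norm_mult by (intro mult_mono) auto
      qed auto
      also have "Complex ?b Y - Complex 0 Y = of_real ?b" by (simp add: complex_eq_iff)
      finally show ?case using b by simp
    qed
  qed
  obtain K where "K \<ge> 0" and K: "\<And>N y. y \<ge> 0 \<Longrightarrow> norm (Vint (\<mu> + real N) \<alpha> s y) \<le> K * exp (- (pi * \<mu> + 2 * pi * real N) * y)"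
    by (rule Vint_bound[OF \<alpha> s \<mu>(1)]) (rule that)
  have Vlim: "((\<lambda>Y. integral {0..Y} (Vint \<mu> \<alpha> s)) \<longlongrightarrow> V \<mu> \<alpha> s) at_top"
  proof -
    have c: "continuous_on {0..} (Vint \<mu> \<alpha> s)" by (rule Vint_continuous[OF \<alpha> s]) (use \<mu> in simp)
    have d: "norm (Vint \<mu> \<alpha> s y) \<le> K * exp (- (pi * \<mu>) * y)" if "y \<ge> 0" for y
      using K[OF that, of 0] by simp
    have k: "pi * \<mu> > 0" using \<mu> by simp
    show ?thesis unfolding V_def by (rule exp_decay_integral(4)[OF c d k])
  qed
  have "((\<lambda>Y. integral {0..?b} (\<lambda>x. ?G (of_real x)) + \<i> * integral {0..Y} (Uint \<mu> ?b ?b s) - H Y - \<i> * integral {0..Y} (Vint \<mu> \<alpha> s))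
     \<longlongrightarrow> integral {0..?b} (\<lambda>x. ?G (of_real x)) + \<i> * U \<mu> ?b ?b s - 0 - \<i> * V \<mu> \<alpha> s) at_top"
    using b \<mu> by (intro tendsto_intros U_limit Vlim H0) auto
  moreover have "eventually (\<lambda>Y. integral {0..?b} (\<lambda>x. ?G (of_real x)) + \<i> * integral {0..Y} (Uint \<mu> ?b ?b s) - H Y - \<i> * integral {0..Y} (Vint \<mu> \<alpha> s) = 0) at_top"
    using eventually_gt_at_top[of 0] by eventually_elim (rule eq)
  ultimately have "((\<lambda>Y::real. 0::complex) \<longlongrightarrow> integral {0..?b} (\<lambda>x. ?G (of_real x)) + \<i> * U \<mu> ?b ?b s - 0 - \<i> * V \<mu> \<alpha> s) at_top"
    by (rule Lim_transform_eventually)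
  then have "integral {0..?b} (\<lambda>x. ?G (of_real x)) + \<i> * U \<mu> ?b ?b s - 0 - \<i> * V \<mu> \<alpha> s = 0"
    by (simp add: tendsto_const_iff)
  then show ?thesis by (simp add: algebra_simps)
qed

text \<open>On the real segment the kernel and its reflected conjugate add up to the constant
  \<open>lam_ind lam\<close>. The two bottom edges therefore combine to the integral of
  \<open>x powr (- s)\<close>, which cancels the elementary term in \<open>J\<close>.\<close>

lemma J_eq_V:
  assumes lam: "0 < lam" "lam \<le> 1" and \<alpha>: "0 < \<alpha>" "\<alpha> \<le> 1" and s: "Re s < -1"
  shows "J lam (\<alpha>/2) (\<alpha>/2) s = \<i> * V lam \<alpha> s - \<i> * cnj (V (lam_dual lam) \<alpha> (cnj s))"
proof -
  let ?b = "\<alpha>/2" and ?ls = "lam_dual lam" and ?d = "lam_ind lam"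
  have ls: "0 < ?ls" "?ls \<le> 1" using lam_dual_pos[OF lam] by auto
  have b: "?b > 0" using \<alpha> by simp
  define E1 where "E1 = integral {0..?b} (\<lambda>x. Gint lam \<alpha> s (of_real x))"
  define E2 where "E2 = integral {0..?b} (\<lambda>x. Gint ?ls \<alpha> (cnj s) (of_real x))"
  have U1: "\<i> * U lam ?b ?b s = \<i> * V lam \<alpha> s - E1"
    unfolding E1_def by (rule U_eq_V[OF \<alpha> s lam])
  have "\<i> * U ?ls ?b ?b (cnj s) = \<i> * V ?ls \<alpha> (cnj s) - E2"
    unfolding E2_def by (rule U_eq_V[OF \<alpha> _ ls]) (use s in simp)
  then have "cnj (\<i> * U ?ls ?b ?b (cnj s)) = cnj (\<i> * V ?ls \<alpha> (cnj s) - E2)" by simp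
  then have U2: "\<i> * cnj (U ?ls ?b ?b (cnj s)) = \<i> * cnj (V ?ls \<alpha> (cnj s)) + cnj E2"
    by (simp add: algebra_simps)
  have int: "(\<lambda>x. Gint \<mu> \<alpha> s' (of_real x)) integrable_on {0..?b}" if "Re s' < -1" "\<mu> \<ge> 0" for \<mu> s'
    by (intro integrable_continuous_interval continuous_on_compose2[OF Gint_continuous[OF \<alpha> that]] continuous_intros)
       (auto simp: quarter_def)
  have "E1 + cnj E2 = integral {0..?b} (\<lambda>x. Gint lam \<alpha> s (of_real x) + cnj (Gint ?ls \<alpha> (cnj s) (of_real x)))"
    unfolding E1_def E2_def Henstock_Kurzweil_Integration.integral_cnj
    using int[of s lam] int[of "cnj s" ?ls] s lam ls
    by (subst Henstock_Kurzweil_Integration.integral_add) (auto simp: integrable_on_cnj_iff)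
  also have "\<dots> = integral {0..?b} (\<lambda>x. ?d * of_real x powr (- s))"
  proof (rule Henstock_Kurzweil_Integration.integral_cong)
    fix x assume x: "x \<in> {0..?b}"
    show "Gint lam \<alpha> s (of_real x) + cnj (Gint ?ls \<alpha> (cnj s) (of_real x)) = ?d * of_real x powr (- s)"
    proof (cases "x = 0")
      case False
      let ?z = "of_real x - of_real \<alpha> :: complex"
      have "ee (of_real x - of_real \<alpha>) \<noteq> 1"
        by (rule ee_neq_1_quarter[OF \<alpha>]) (use x False in \<open>auto simp: quarter_def\<close>)
      then have "kern lam ?z = - cnj (kern ?ls ?z) + ?d" using kern_cnj_dual[of ?z lam] by simp
      moreover have "cnj (of_real x powr (- cnj s)) = of_real x powr (- s)"
        using x by (subst cnj_powr) auto
      ultimately have "Gint lam \<alpha> s (of_real x) + cnj (Gint ?ls \<alpha> (cnj s) (of_real x))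
          = of_real x powr (- s) * (- cnj (kern ?ls ?z) + ?d) + of_real x powr (- s) * cnj (kern ?ls ?z)"
        by (simp only: Gint_def complex_cnj_mult)
      then show ?thesis by (simp only: distrib_left[symmetric]) (simp add: mult.commute)
    qed (simp add: Gint_def)
  qed
  also have "\<dots> = ?d * (of_real ?b powr (1 - s) / (1 - s))"
  proof -
    have n1: "1 - s \<noteq> 0" using s by auto
    have "((\<lambda>x. of_real x powr (- s)) has_integral (of_real ?b powr (1 - s) / (1 - s) - of_real 0 powr (1 - s) / (1 - s))) {0..?b}"
    proof (rule fundamental_theorem_of_calculus_interior)
      show "continuous_on {0..?b} (\<lambda>x. complex_of_real x powr (1 - s) / (1 - s))"
        using n1 s by (intro continuous_intros) auto
      fix x assume x: "x \<in> {0<..<?b}"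
      then have "of_real x \<notin> (\<real>\<^sub>\<le>\<^sub>0 :: complex set)" by simp
      from DERIV_cdivide[OF has_field_derivative_powr[OF this, of "1 - s"], of "1 - s"]
      have "((\<lambda>z. z powr (1 - s) / (1 - s)) has_field_derivative of_real x powr (- s)) (at (of_real x))"
        using n1 by simp
      then show "((\<lambda>x. of_real x powr (1 - s) / (1 - s)) has_vector_derivative of_real x powr (- s)) (at x)"
        by (rule has_vector_derivative_real_field)
    qed (use b in auto)
    then show ?thesis by (simp add: integral_unique)
  qed
  finally have "E1 + cnj E2 = ?d * (of_real ?b powr (1 - s) / (1 - s))" .
  then show ?thesis unfolding J_def right_diff_distrib U1 U2 by (simp add: algebra_simps)
qed

section \<open>Termwise integration and the dual series\<close>

lemma Gamma_integral_scaled: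
  assumes z: "Re z > 1" and k: "k > 0"
  shows "((\<lambda>t. of_real t powr (z - 1) * of_real (exp (- (k * t)))) has_integral Gamma z * of_real k powr (- z)) {0..}"
proof -
  define F where "F k t = complex_of_real t powr (z - 1) * of_real (exp (- (k * t)))" for k t
  define p where "p = Re z - 1"
  have p: "p > 0" using z by (simp add: p_def)
  have cont: "continuous_on {0..} (F k)" for k
    unfolding F_def using z by (intro continuous_intros) auto
  have bnd: "norm (F k t) \<le> (2 * p / k) powr p * exp (- (k/2) * t)" if "t \<ge> 0" "k > 0" for t k
  proof (cases "t = 0")
    case False
    have "norm (F k t) = t powr p * exp (- (k * t))"
      using that by (simp add: F_def norm_mult norm_powr_real_powr p_def)
    also have "\<dots> \<le> ((p / (k/2)) powr p * exp ((k/2) * t)) * exp (- (k * t))"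
      using that False p by (intro mult_right_mono powr_le_exp_mult) auto
    also have "\<dots> = (2 * p / k) powr p * (exp ((k/2) * t) * exp (- (k * t)))" by (simp add: mult_ac)
    also have "exp ((k/2) * t) * exp (- (k * t)) = exp (- (k/2) * t)" by (simp flip: exp_add)
    finally show ?thesis .
  qed (simp add: F_def)
  have lim: "((\<lambda>Y. integral {0..Y} (F k)) \<longlongrightarrow> integral {0..} (F k)) at_top" and int: "F k integrable_on {0..}" if "k > 0" for k
    using exp_decay_integral(1,4)[OF cont bnd] that by auto
  have "((\<lambda>t. of_real t powr (z - 1) / of_real (exp t)) has_integral Gamma z) {0..}"
    using z by (intro Gamma_integral_complex) auto
  moreover have "(\<lambda>t. of_real t powr (z - 1) / of_real (exp t)) = F 1"
    by (auto simp: F_def exp_minus field_simps)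
  ultimately have G: "integral {0..} (F 1) = Gamma z" by (simp add: integral_unique)
  have st: "integral {0..Y} (F k) = integral {0..k * Y} (F 1) * of_real k powr (- z)" if Y: "Y > 0" for Y
  proof -
    have img: "(\<lambda>x. x / k) ` {0..k * Y} = {0..Y}" using k Y by (simp add: image_divide_atLeastAtMost)
    have Fk: "F 1 (k * x) = of_real k powr (z - 1) * F k x" if "x \<in> {0..Y}" for x
      using that k by (simp add: F_def powr_times_real)
    have "integral {0..Y} (\<lambda>x. F 1 (k * x)) = (1 / k) *\<^sub>R integral {0..k * Y} (F 1)"
      using integral_stretch_real[of k 0 "k * Y" "F 1"] k unfolding img by simp
    moreover have "integral {0..Y} (\<lambda>x. F 1 (k * x)) = of_real k powr (z - 1) * integral {0..Y} (F k)"
    proof -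
      have "integral {0..Y} (\<lambda>x. F 1 (k * x)) = integral {0..Y} (\<lambda>x. of_real k powr (z - 1) * F k x)"
        by (rule Henstock_Kurzweil_Integration.integral_cong) (rule Fk)
      then show ?thesis by simp
    qed
    ultimately have "of_real k powr (z - 1) * integral {0..Y} (F k) = integral {0..k * Y} (F 1) / of_real k"
      by (simp add: scaleR_conv_of_real)
    moreover have "of_real k powr (z - 1) = of_real k powr z / (of_real k :: complex)" "of_real k powr z \<noteq> (0::complex)"
      using k by (auto simp: powr_diff)
    ultimately show ?thesis using k by (simp add: powr_minus field_simps)
  qed
  have "filterlim (\<lambda>Y::real. k * Y) at_top at_top" using k by real_asymp
  from filterlim_compose[OF lim[of 1] this]
  have "((\<lambda>Y. integral {0..k * Y} (F 1)) \<longlongrightarrow> Gamma z) at_top" by (simp add: G)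
  then have "((\<lambda>Y. integral {0..k * Y} (F 1) * of_real k powr (- z)) \<longlongrightarrow> Gamma z * of_real k powr (- z)) at_top"
    by (intro tendsto_intros)
  then have "((\<lambda>Y. integral {0..Y} (F k)) \<longlongrightarrow> Gamma z * of_real k powr (- z)) at_top"
  proof (rule Lim_transform_eventually)
    show "eventually (\<lambda>Y. integral {0..k * Y} (F 1) * of_real k powr (- z) = integral {0..Y} (F k)) at_top"
      using eventually_gt_at_top[of 0] by eventually_elim (use st in simp)
  qed
  then have "integral {0..} (F k) = Gamma z * of_real k powr (- z)"
    using lim[OF k] tendsto_unique trivial_limit_at_top_linorder by blast
  then show ?thesis using int[OF k] by (simp add: F_def[abs_def] has_integral_iff)
qed

text \<open>The integral over \<open>y \<ge> 0\<close> of
  \<open>w powr (- s) * ee (a * (w - \<alpha>))\<close> at \<open>w = \<i> * y\<close>: the first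
  factor is \<open>\<i> powr (- s)\<close>, and the rest is a Gamma integral with rate
  \<open>2 * pi * a\<close>.\<close>

definition Vterm :: "real \<Rightarrow> complex \<Rightarrow> real \<Rightarrow> complex" where
  "Vterm \<alpha> s a = exp (- \<i> * of_real pi * s / 2) * Gamma (1 - s) * of_real (2 * pi) powr (s - 1)
      * (ee (of_real (- (\<alpha> * a))) * of_real a powr (s - 1))"

lemma Vterm_integral:
  assumes s: "Re s < -1" and a: "a > 0"
  shows "((\<lambda>y. Complex 0 y powr (- s) * ee (of_real a * Complex (- \<alpha>) y)) has_integral Vterm \<alpha> s a) {0..}"
proof -
  have "((\<lambda>t. of_real t powr (1 - s - 1) * of_real (exp (- (2 * pi * a * t)))) has_integral Gamma (1 - s) * of_real (2 * pi * a) powr (- (1 - s))) {0..}"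
    using s a by (intro Gamma_integral_scaled) auto
  from has_integral_mult_right[OF this, of "exp (- \<i> * of_real pi * s / 2) * ee (of_real (- (\<alpha> * a)))"]
  have "((\<lambda>t. exp (- \<i> * of_real pi * s / 2) * ee (of_real (- (\<alpha> * a))) * (of_real t powr (1 - s - 1) * of_real (exp (- (2 * pi * a * t)))))
     has_integral exp (- \<i> * of_real pi * s / 2) * ee (of_real (- (\<alpha> * a))) * (Gamma (1 - s) * of_real (2 * pi * a) powr (- (1 - s)))) {0..}" .
  also have "exp (- \<i> * of_real pi * s / 2) * ee (of_real (- (\<alpha> * a))) * (Gamma (1 - s) * of_real (2 * pi * a) powr (- (1 - s))) = Vterm \<alpha> s a"
    using a by (simp add: Vterm_def powr_times_real mult_ac)
  finally show ?thesis
  proof (rule has_integral_eq[rotated])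
    fix y :: real assume "y \<in> {0..}"
    then have y: "y \<ge> 0" by simp
    have e: "ee (of_real a * Complex (- \<alpha>) y) = ee (of_real (- (\<alpha> * a))) * of_real (exp (- (2 * pi * a * y)))"
    proof -
      have "2 * of_real pi * \<i> * (of_real a * Complex (- \<alpha>) y) = 2 * of_real pi * \<i> * of_real (- (\<alpha> * a)) + of_real (- (2 * pi * a * y))"
        by (simp add: Complex_eq algebra_simps)
      then show ?thesis unfolding ee_def exp_of_real[symmetric] by (simp only: exp_add)
    qed
    have c: "Complex 0 y = \<i> * of_real y" by (simp add: complex_eq_iff)
    have "Complex 0 y powr (- s) = exp (- \<i> * of_real pi * s / 2) * of_real y powr (- s)"
    proof (cases "y = 0")
      case False
      then have "Ln (\<i> * of_real y) = Ln (of_real y) + \<i> * of_real pi / 2"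
        using y by (subst Ln_times_ii) auto
      then show ?thesis unfolding c using False by (simp add: powr_def algebra_simps flip: exp_add)
    next
      case True
      then have "Complex 0 y = 0" by (simp add: complex_eq_iff)
      then show ?thesis using True by simp
    qed
    then show "exp (- \<i> * of_real pi * s / 2) * ee (of_real (- (\<alpha> * a))) * (of_real y powr (1 - s - 1) * of_real (exp (- (2 * pi * a * y))))
       = Complex 0 y powr (- s) * ee (of_real a * Complex (- \<alpha>) y)"
      unfolding e by (simp add: mult_ac)
  qed
qed

text \<open>By \<open>kern_expand\<close> the partial sums differ from the limit by exactly
  \<open>V (\<mu> + N) \<alpha> s\<close>, which is \<open>O(1 / N)\<close>.\<close>

lemma V_sums:
  assumes \<alpha>: "0 < \<alpha>" "\<alpha> \<le> 1" and s: "Re s < -1" and \<mu>: "0 < \<mu>"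
  shows "(\<lambda>n. Vterm \<alpha> s (\<mu> + real n)) sums (- V \<mu> \<alpha> s)"
proof -
  obtain K where K: "K \<ge> 0" "\<And>N y. y \<ge> 0 \<Longrightarrow> norm (Vint (\<mu> + real N) \<alpha> s y) \<le> K * exp (- (pi * \<mu> + 2 * pi * real N) * y)"
    by (rule Vint_bound[OF \<alpha> s \<mu>]) (rule that)
  have kpos: "pi * \<mu> + 2 * pi * real N > 0" for N using \<mu> by (simp add: add_pos_nonneg)
  have cont: "continuous_on {0..} (Vint (\<mu> + real N) \<alpha> s)" for N
    by (rule Vint_continuous[OF \<alpha> s]) (use \<mu> in simp)
  note dec = exp_decay_integral[OF cont K(2) kpos]
  have part: "(\<Sum>n<N. Vterm \<alpha> s (\<mu> + real n)) = V (\<mu> + real N) \<alpha> s - V \<mu> \<alpha> s" for N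
  proof -
    have "((\<lambda>y. Vint (\<mu> + real N) \<alpha> s y - (\<Sum>n<N. Complex 0 y powr (- s) * ee (of_real (\<mu> + real n) * Complex (- \<alpha>) y)))
       has_integral (V (\<mu> + real N) \<alpha> s - (\<Sum>n<N. Vterm \<alpha> s (\<mu> + real n)))) {0..}"
    proof (intro has_integral_diff has_integral_sum)
      show "(Vint (\<mu> + real N) \<alpha> s has_integral V (\<mu> + real N) \<alpha> s) {0..}"
        unfolding V_def by (intro integrable_integral dec(1))
      show "((\<lambda>y. Complex 0 y powr (- s) * ee (of_real (\<mu> + real n) * Complex (- \<alpha>) y)) has_integral Vterm \<alpha> s (\<mu> + real n)) {0..}" for n
        by (rule Vterm_integral[OF s]) (use \<mu> in simp)
    qed auto
    then have "(Vint \<mu> \<alpha> s has_integral (V (\<mu> + real N) \<alpha> s - (\<Sum>n<N. Vterm \<alpha> s (\<mu> + real n)))) {0..}"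
    proof (rule has_integral_eq[rotated])
      fix y :: real assume "y \<in> {0..}"
      have c: "Complex 0 y - of_real \<alpha> = Complex (- \<alpha>) y" by (simp add: complex_eq_iff)
      show "Vint (\<mu> + real N) \<alpha> s y - (\<Sum>n<N. Complex 0 y powr (- s) * ee (of_real (\<mu> + real n) * Complex (- \<alpha>) y)) = Vint \<mu> \<alpha> s y"
      proof (cases "y = 0")
        case True
        have "Complex 0 0 = 0" by (simp add: complex_eq_iff)
        then show ?thesis by (simp add: True Vint_def Gint_def)
      next
        case False
        then have "ee (Complex (- \<alpha>) y) \<noteq> 1" by (intro ee_neq_1_Im) auto
        from kern_expand[OF this, of \<mu> N] show ?thesis
          unfolding Vint_def Gint_def c by (simp add: sum_distrib_left right_diff_distrib)
      qed
    qed
    then have "V \<mu> \<alpha> s = V (\<mu> + real N) \<alpha> s - (\<Sum>n<N. Vterm \<alpha> s (\<mu> + real n))"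
      unfolding V_def[of \<mu>] by (rule integral_unique)
    then show ?thesis by simp
  qed
  have "(\<lambda>N. V (\<mu> + real N) \<alpha> s) \<longlonglongrightarrow> 0"
  proof (rule Lim_null_comparison)
    show "(\<lambda>N. K / (pi * \<mu> + 2 * pi * real N)) \<longlonglongrightarrow> 0" by real_asymp
    show "eventually (\<lambda>N. norm (V (\<mu> + real N) \<alpha> s) \<le> K / (pi * \<mu> + 2 * pi * real N)) sequentially"
      unfolding V_def by (intro always_eventually allI dec(2))
  qed
  then have "(\<lambda>N. V (\<mu> + real N) \<alpha> s - V \<mu> \<alpha> s) \<longlonglongrightarrow> 0 - V \<mu> \<alpha> s" by (intro tendsto_intros)
  then show ?thesis unfolding sums_def part by simp
qed

text \<open>Up to the constant \<open>ee (\<theta> * \<mu>)\<close> a Lerch series with exchanged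
  roles: \<open>\<theta>\<close> becomes \<open>\<plusminus>\<alpha>\<close>, and
  \<open>\<mu>\<close> becomes \<open>lam\<close> or its dual.\<close>

definition dser :: "real \<Rightarrow> real \<Rightarrow> complex \<Rightarrow> complex" where
  "dser \<theta> \<mu> u = (\<Sum>n. ee (of_real (\<theta> * (\<mu> + real n))) * of_real (\<mu> + real n) powr (- u))"

lemma V_eq_dser:
  assumes \<alpha>: "0 < \<alpha>" "\<alpha> \<le> 1" and s: "Re s < -1" and \<mu>: "0 < \<mu>"
    and summ: "summable (\<lambda>n. ee (of_real (- \<alpha> * (\<mu> + real n))) * of_real (\<mu> + real n) powr (- (1 - s)))"
  shows "V \<mu> \<alpha> s = - (exp (- \<i> * of_real pi * s / 2) * Gamma (1 - s) * of_real (2 * pi) powr (s - 1) * dser (- \<alpha>) \<mu> (1 - s))"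
proof -
  have "(\<lambda>n. exp (- \<i> * of_real pi * s / 2) * Gamma (1 - s) * of_real (2 * pi) powr (s - 1) *
      (ee (of_real (- \<alpha> * (\<mu> + real n))) * of_real (\<mu> + real n) powr (- (1 - s)))) sums
      (exp (- \<i> * of_real pi * s / 2) * Gamma (1 - s) * of_real (2 * pi) powr (s - 1) * dser (- \<alpha>) \<mu> (1 - s))"
    unfolding dser_def by (intro sums_mult summable_sums summ)
  moreover have "(\<lambda>n. exp (- \<i> * of_real pi * s / 2) * Gamma (1 - s) * of_real (2 * pi) powr (s - 1) *
      (ee (of_real (- \<alpha> * (\<mu> + real n))) * of_real (\<mu> + real n) powr (- (1 - s)))) = (\<lambda>n. Vterm \<alpha> s (\<mu> + real n))"
    by (simp add: Vterm_def)
  ultimately show ?thesis using V_sums[OF \<alpha> s \<mu>] sums_unique2 by fastforce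
qed

section \<open>The Gamma function on vertical lines\<close>

text \<open>The reflection formula at \<open>z = - \<i> * t\<close>, where \<open>Gamma z\<close>
  and \<open>Gamma (- z)\<close> are complex conjugates. The estimates of
  \<open>norm (Gamma u)\<close> on the other vertical lines are reduced to this exact value.\<close>

lemma norm_Gamma_1_line:
  fixes t :: real
  assumes t: "t > 0"
  shows "(norm (Gamma (Complex 1 (- t))))\<^sup>2 = pi * t / sinh (pi * t)"
proof -
  define z where "z = - \<i> * of_real t"
  have z: "z \<noteq> 0" "z \<notin> \<int>\<^sub>\<le>\<^sub>0" "cnj z = - z" using t by (auto simp: z_def complex_eq_iff elim!: nonpos_Ints_cases)
  have nz: "norm z = t" using t by (simp add: z_def norm_mult)
  have e: "Complex 1 (- t) = z + 1" by (simp add: z_def complex_eq_iff)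
  have "norm (Gamma (z + 1)) = t * norm (Gamma z)"
    using Gamma_plus1[OF z(2)] nz by (simp add: norm_mult)
  moreover have "norm (Gamma (- z)) = norm (Gamma z)"
    by (metis cnj_Gamma complex_mod_cnj z(3))
  moreover have "norm (Gamma z * Gamma (- z)) = pi / (t * sinh (pi * t))"
  proof -
    have arg: "of_real pi * z = - (\<i> * of_real (pi * t))" by (simp add: z_def)
    have "sin (of_real pi * z) = - (\<i> * of_real (sinh (pi * t)))"
      unfolding arg by (simp add: sin_i_times sinh_def exp_minus flip: exp_of_real)
    then have "norm (sin (of_real pi * z)) = sinh (pi * t)"
      using t by (simp add: norm_mult)
    then show ?thesis unfolding Gamma_reflection_complex' by (simp add: norm_divide norm_mult nz)
  qed
  ultimately have "norm (Gamma z) * norm (Gamma z) = pi / (t * sinh (pi * t))" by (simp add: norm_mult)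
  with \<open>norm (Gamma (z + 1)) = t * norm (Gamma z)\<close> show ?thesis
    unfolding e using t by (simp add: power2_eq_square field_simps)
qed

lemma Complex_notin_nonpos_Ints: "x > 0 \<Longrightarrow> Complex x y \<notin> \<int>\<^sub>\<le>\<^sub>0"
  by (auto simp: complex_eq_iff elim!: nonpos_Ints_cases)

lemma norm_Gamma_Suc_line:
  assumes t: "t > 0"
  shows "norm (Gamma (Complex (real n + 1) (- t))) \<le> (real n + t) ^ n * norm (Gamma (Complex 1 (- t)))"
proof (induction n)
  case (Suc n)
  have e: "Complex (real (Suc n) + 1) (- t) = Complex (real n + 1) (- t) + 1" by (simp add: complex_eq_iff)
  have "norm (Gamma (Complex (real (Suc n) + 1) (- t))) = norm (Complex (real n + 1) (- t)) * norm (Gamma (Complex (real n + 1) (- t)))"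
  proof -
    have "Complex (real n + 1) (- t) \<notin> \<int>\<^sub>\<le>\<^sub>0" by (rule Complex_notin_nonpos_Ints) simp
    then show ?thesis unfolding e by (simp only: Gamma_plus1 norm_mult not_False_eq_True)
  qed
  also have "\<dots> \<le> (real (Suc n) + t) * ((real n + t) ^ n * norm (Gamma (Complex 1 (- t))))"
    using Suc cmod_le[of "Complex (real n + 1) (- t)"] t by (intro mult_mono) auto
  also have "\<dots> \<le> (real (Suc n) + t) * ((real (Suc n) + t) ^ n * norm (Gamma (Complex 1 (- t))))"
    using t by (intro mult_left_mono mult_right_mono power_mono) auto
  finally show ?case by simp
qed simp

text \<open>\<open>exp (pi * t / 2)\<close> is the size of the larger exponential in the functional
  equation; against the decay of the Gamma function it leaves a polynomial.\<close>

lemma norm_Gamma_exp_line: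
  assumes t: "t \<ge> 1"
  shows "norm (Gamma (Complex (real n + 1) (- t))) * exp (pi * t / 2) \<le> 4 * (real n + 1) ^ n * t ^ (n + 1)"
proof -
  have p: "exp (- (pi * t)) \<le> 1/2"
  proof -
    have "1 * 1 \<le> pi * t" using t pi_ge_two by (intro mult_mono) auto
    then have "exp 1 \<le> exp (pi * t)" by simp
    then have "exp (pi * t) \<ge> 2" using exp_ge_add_one_self[of 1] by linarith
    then show ?thesis by (simp add: exp_minus field_simps)
  qed
  have "exp (pi * t) \<ge> 1" using t by simp
  moreover have "sinh (pi * t) = (exp (pi * t) - exp (- (pi * t))) / 2" by (simp add: sinh_def)
  moreover have "E / 4 \<le> (E - e) / 2" if "1 \<le> E" "e \<le> 1 / 2" for E e :: real using that by (simp add: field_simps)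
  ultimately have "sinh (pi * t) \<ge> exp (pi * t) / 4" using p by metis
  then have "pi * t / sinh (pi * t) \<le> pi * t / (exp (pi * t) / 4)"
    using t by (intro divide_left_mono mult_pos_pos) auto
  then have "(norm (Gamma (Complex 1 (- t))))\<^sup>2 \<le> pi * t / (exp (pi * t) / 4)"
    using norm_Gamma_1_line[of t] t by simp
  then have "(norm (Gamma (Complex 1 (- t))))\<^sup>2 * exp (pi * t) \<le> 4 * pi * t"
    by (simp add: field_simps)
  also have "\<dots> \<le> 4 * 4 * t\<^sup>2"
  proof -
    have "pi * t \<le> 4 * (t * t)"
      using pi_less_4 t by (intro mult_mono) auto
    then show ?thesis by (simp add: power2_eq_square)
  qed
  finally have "(norm (Gamma (Complex 1 (- t))) * exp (pi * t / 2))\<^sup>2 \<le> (4 * t)\<^sup>2"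
    by (simp add: power_mult_distrib flip: exp_of_nat_mult)
  then have *: "norm (Gamma (Complex 1 (- t))) * exp (pi * t / 2) \<le> 4 * t"
    by (rule power2_le_imp_le) (use t in simp)
  have "norm (Gamma (Complex (real n + 1) (- t))) * exp (pi * t / 2) \<le> (real n + t) ^ n * norm (Gamma (Complex 1 (- t))) * exp (pi * t / 2)"
    using t by (intro mult_right_mono norm_Gamma_Suc_line) auto
  also have "\<dots> = (real n + t) ^ n * (norm (Gamma (Complex 1 (- t))) * exp (pi * t / 2))" by simp
  also have "\<dots> \<le> ((real n + 1) * t) ^ n * (4 * t)"
  proof (rule mult_mono[OF power_mono *])
    have "real n * 1 \<le> real n * t" using t by (intro mult_left_mono) auto
    then show "real n + t \<le> (real n + 1) * t" by (simp add: algebra_simps)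
  qed (use t in auto)
  also have "\<dots> = 4 * (real n + 1) ^ n * t ^ (n + 1)" by (simp add: power_mult_distrib mult_ac)
  finally show ?thesis .
qed

text \<open>The line \<open>Re u = 3\<close> is the reflection of the left side
  \<open>Re s = -2\<close>. Two steps of the recurrence lead back to \<open>Re u = 1\<close>. An
  error \<open>O(1 / t)\<close> is good enough, since integrating it gives
  \<open>O(ln T)\<close>.\<close>

lemma ln_norm_Gamma_3_line:
  "(\<lambda>t. ln (norm (Gamma (Complex 3 (- t)))) - (5/2 * ln t - pi * t / 2 + ln (2 * pi) / 2)) \<in> O[at_top](\<lambda>t. 1 / t)"
proof -
  have k: "2 * pi > 0" by simp
  have "(\<lambda>t::real. ln (1 - exp (- (k * t))) / 2) \<in> O[at_top](\<lambda>t. 1 / t)" if "k > 0" for k :: real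
    using that by real_asymp
  from this[OF k]
  have b3: "(\<lambda>t::real. ln (1 - exp (- (2 * pi * t))) / 2) \<in> O[at_top](\<lambda>t. 1 / t)" .
  have b1: "(\<lambda>t::real. ln (4 + t\<^sup>2) / 2 - ln t) \<in> O[at_top](\<lambda>t. 1 / t)"
    and b2: "(\<lambda>t::real. ln (1 + t\<^sup>2) / 2 - ln t) \<in> O[at_top](\<lambda>t. 1 / t)" by real_asymp+
  have "(\<lambda>t. (ln (4 + t\<^sup>2) / 2 - ln t) + (ln (1 + t\<^sup>2) / 2 - ln t) - ln (1 - exp (- (2 * pi * t))) / 2) \<in> O[at_top](\<lambda>t. 1 / t)"
    by (rule sum_in_bigo(2)[OF sum_in_bigo(1)[OF b1 b2] b3])
  also have "?this \<longleftrightarrow> ?thesis"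
  proof (rule landau_o.big.in_cong)
    show "eventually (\<lambda>t. (ln (4 + t\<^sup>2) / 2 - ln t) + (ln (1 + t\<^sup>2) / 2 - ln t) - ln (1 - exp (- (2 * pi * t))) / 2
        = ln (norm (Gamma (Complex 3 (- t)))) - (5/2 * ln t - pi * t / 2 + ln (2 * pi) / 2)) at_top"
      using eventually_gt_at_top[of 0]
    proof eventually_elim
      case (elim t)
      define G where "G = norm (Gamma (Complex 1 (- t)))"
      have sq: "G\<^sup>2 = pi * t / sinh (pi * t)" unfolding G_def by (rule norm_Gamma_1_line[OF elim])
      have "G\<^sup>2 > 0" unfolding sq using elim by simp
      then have "G > 0" unfolding zero_less_power2 by (simp add: G_def)
      have sh: "sinh (pi * t) = exp (pi * t) * (1 - exp (- (2 * pi * t))) / 2"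
        by (simp add: sinh_def algebra_simps flip: exp_add)
      define D where "D = 1 - exp (- (2 * pi * t))"
      have D: "D > 0" using elim by (simp add: D_def)
      have "G\<^sup>2 = 2 * pi * t / (exp (pi * t) * D)" unfolding sq sh D_def by simp
      then have "ln (G\<^sup>2) = ln (2 * pi) + ln t - (pi * t + ln D)"
        using elim D by (simp add: ln_div ln_mult)
      then have lnG: "ln G = (ln (2 * pi) + ln t - pi * t - ln D) / 2" using \<open>G > 0\<close> by (simp add: ln_realpow)
      have e: "Complex 3 (- t) = (Complex 1 (- t) + 1) + 1" by (simp add: complex_eq_iff)
      have e2: "Complex 1 (- t) + 1 = Complex 2 (- t)" by (simp add: complex_eq_iff)
      have "Gamma (Complex 3 (- t)) = Complex 2 (- t) * (Complex 1 (- t) * Gamma (Complex 1 (- t)))"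
        unfolding e by (subst Gamma_plus1, simp add: e2 Complex_notin_nonpos_Ints, subst Gamma_plus1, simp add: Complex_notin_nonpos_Ints, simp add: e2)
      then have "norm (Gamma (Complex 3 (- t))) = sqrt (4 + t\<^sup>2) * (sqrt (1 + t\<^sup>2) * G)"
        by (simp add: norm_mult G_def complex_norm)
      moreover have "4 + t\<^sup>2 > 0" "1 + t\<^sup>2 > 0" by (auto intro: add_pos_nonneg)
      ultimately have "ln (norm (Gamma (Complex 3 (- t)))) = ln (4 + t\<^sup>2) / 2 + (ln (1 + t\<^sup>2) / 2 + ln G)"
        using \<open>G > 0\<close> by (simp add: ln_mult ln_sqrt)
      then show ?case unfolding lnG D_def[symmetric] by (simp add: field_simps)
    qed
  qed
  finally show ?thesis .
qed

text \<open>The limit formula for \<open>Digamma\<close> leads to the sum of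
  \<open>u / (u\<^sup>2 + t\<^sup>2)\<close> over \<open>u = 3 + n\<close>, which is compared with
  its integral \<open>ln (u\<^sup>2 + t\<^sup>2) / 2\<close>.\<close>

lemma Re_Digamma_3_line:
  assumes t: "t \<ge> 1"
  shows "\<bar>Re (Digamma (Complex 3 (- t))) - ln t\<bar> \<le> 7 / t"
proof -
  define f where "f u = ln (u\<^sup>2 + t\<^sup>2) / 2" for u :: real
  define d where "d u = u / (u\<^sup>2 + t\<^sup>2)" for u :: real
  have pos: "u\<^sup>2 + t\<^sup>2 > 0" for u using t by (simp add: add_nonneg_pos)
  \<comment> \<open>The error of one step is at most \<open>1 / (u\<^sup>2 + t\<^sup>2)\<close>. An
    increment of \<open>arctan (u / t) / t\<close> over the preceding unit interval dominates this,
    so the errors telescope to a bounded quantity over \<open>t\<close>.\<close>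
  have step: "\<bar>f (u + 1) - f u - d u\<bar> \<le> (arctan (u / t) - arctan ((u - 1) / t)) / t" if u: "u \<ge> 1" for u
  proof -
    have "\<exists>\<xi>>u. \<xi> < u + 1 \<and> f (u + 1) - f u = (u + 1 - u) * d \<xi>"
    proof (rule MVT2)
      fix x assume "u \<le> x" "x \<le> u + 1"
      have "((\<lambda>u. ln (u\<^sup>2 + t\<^sup>2)) has_real_derivative 1 / (x\<^sup>2 + t\<^sup>2) * (2 * x)) (at x)"
        by (rule DERIV_chain2[where f = ln and g = "\<lambda>u. u\<^sup>2 + t\<^sup>2", OF DERIV_ln_divide[OF pos]]) (auto intro!: derivative_eq_intros)
      from DERIV_cdivide[OF this, of 2]
      moreover have "1 / A * (2 * x) / 2 = x / A" for A :: real by simp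
      ultimately have "((\<lambda>u. ln (u\<^sup>2 + t\<^sup>2) / 2) has_real_derivative x / (x\<^sup>2 + t\<^sup>2)) (at x)" by metis
      then show "DERIV f x :> d x" unfolding f_def d_def .
    qed simp
    then obtain \<xi> where \<xi>: "u < \<xi>" "\<xi> < u + 1" "f (u + 1) - f u = d \<xi>" by auto
    have ne: "\<xi>\<^sup>2 + t\<^sup>2 \<noteq> 0" "u\<^sup>2 + t\<^sup>2 \<noteq> 0" using pos[of \<xi>] pos[of u] by linarith+
    have "d \<xi> - d u = (\<xi> - u) * (t\<^sup>2 - \<xi> * u) / ((\<xi>\<^sup>2 + t\<^sup>2) * (u\<^sup>2 + t\<^sup>2))"
      unfolding d_def diff_frac_eq[OF ne] by (simp add: algebra_simps power2_eq_square)
    then have "\<bar>d \<xi> - d u\<bar> = (\<xi> - u) * \<bar>t\<^sup>2 - \<xi> * u\<bar> / ((\<xi>\<^sup>2 + t\<^sup>2) * (u\<^sup>2 + t\<^sup>2))"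
      using \<xi> pos[of \<xi>] pos[of u] by (simp add: abs_mult)
    also have "\<dots> \<le> 1 * (\<xi>\<^sup>2 + t\<^sup>2) / ((\<xi>\<^sup>2 + t\<^sup>2) * (u\<^sup>2 + t\<^sup>2))"
    proof (intro divide_right_mono mult_mono)
      have "0 \<le> \<xi> * u" "\<xi> * u \<le> \<xi> * \<xi>" using \<xi> u by (auto intro: mult_left_mono)
      then show "\<bar>t\<^sup>2 - \<xi> * u\<bar> \<le> \<xi>\<^sup>2 + t\<^sup>2" using zero_le_square[of t] zero_le_square[of \<xi>] unfolding abs_le_iff power2_eq_square by linarith
    qed (use \<xi> pos[of \<xi>] pos[of u] in auto)
    also have "\<dots> = 1 / (u\<^sup>2 + t\<^sup>2)" using ne by simp
    finally have A: "\<bar>f (u + 1) - f u - d u\<bar> \<le> 1 / (u\<^sup>2 + t\<^sup>2)" using \<xi> by simp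
    have "\<exists>\<eta>>u - 1. \<eta> < u \<and> arctan (u / t) - arctan ((u - 1) / t) = (u - (u - 1)) * (t / (\<eta>\<^sup>2 + t\<^sup>2))"
    proof (rule MVT2)
      fix x
      have "1 + (x / t)\<^sup>2 = (x\<^sup>2 + t\<^sup>2) / t\<^sup>2" using t by (simp add: field_simps)
      moreover have "((\<lambda>x. arctan (x / t)) has_real_derivative inverse (1 + (x / t)\<^sup>2) * (1 / t)) (at x)"
        using t by (auto intro!: derivative_eq_intros)
      ultimately show "((\<lambda>x. arctan (x / t)) has_real_derivative t / (x\<^sup>2 + t\<^sup>2)) (at x)"
        using t pos[of x] by (simp add: power2_eq_square)
    qed simp
    then obtain \<eta> where \<eta>: "u - 1 < \<eta>" "\<eta> < u" "arctan (u / t) - arctan ((u - 1) / t) = t / (\<eta>\<^sup>2 + t\<^sup>2)" by auto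
    have "\<eta>\<^sup>2 \<le> u\<^sup>2" using \<eta> u by (intro power_mono) auto
    then have "1 / (u\<^sup>2 + t\<^sup>2) \<le> 1 / (\<eta>\<^sup>2 + t\<^sup>2)" using pos[of \<eta>] pos[of u] by (intro divide_left_mono) auto
    with A show ?thesis unfolding \<eta>(3) using t by simp
  qed
  have tele: "\<bar>(f (3 + real m) - f 3) - (\<Sum>n<m. d (3 + real n))\<bar> \<le> (arctan ((2 + real m) / t) - arctan (2 / t)) / t" for m
  proof (induction m)
    case (Suc m)
    have "f (3 + real (Suc m)) = f (3 + real m + 1)" "(2 + real (Suc m)) / t = (3 + real m) / t" by (simp_all add: add_ac)
    moreover have "(3 + real m - 1) / t = (2 + real m) / t" by simp
    ultimately show ?case
      using Suc step[of "3 + real m"] by (simp add: diff_divide_distrib)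
  qed simp
  have tele2: "\<bar>(f (3 + real m) - f 3) - (\<Sum>n<m. d (3 + real n))\<bar> \<le> 2 / t" for m
  proof -
    have "arctan (2 / t) \<ge> 0" using t by (simp add: zero_le_arctan_iff)
    then have "arctan ((2 + real m) / t) - arctan (2 / t) \<le> 2"
      using arctan_ubound[of "(2 + real m) / t"] pi_less_4 by linarith
    then have "(arctan ((2 + real m) / t) - arctan (2 / t)) / t \<le> 2 / t"
      using t by (intro divide_right_mono) auto
    then show ?thesis using tele[of m] by linarith
  qed
  let ?z = "Complex 3 (- t)"
  have "(\<lambda>m. of_real (ln (real m)) - (\<Sum>n<m. inverse (?z + of_nat n))) \<longlonglongrightarrow> Digamma ?z"
    by (rule Digamma_LIMSEQ) (simp add: complex_eq_iff)
  from tendsto_Re[OF this]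
  have L: "(\<lambda>m. ln (real m) - (\<Sum>n<m. d (3 + real n))) \<longlonglongrightarrow> Re (Digamma ?z)"
    by (simp add: d_def inverse_complex.simps Complex_eq)
  have "(\<lambda>m. ln (real m) - f (3 + real m)) \<longlonglongrightarrow> 0"
    unfolding f_def by real_asymp
  then have "(\<lambda>m. \<bar>(ln (real m) - (\<Sum>n<m. d (3 + real n))) - (ln (real m) - f (3 + real m)) - f 3\<bar>) \<longlonglongrightarrow> \<bar>Re (Digamma ?z) - 0 - f 3\<bar>"
    by (intro tendsto_rabs tendsto_diff L tendsto_const)
  moreover have eq: "(ln (real m) - (\<Sum>n<m. d (3 + real n))) - (ln (real m) - f (3 + real m)) - f 3
      = (f (3 + real m) - f 3) - (\<Sum>n<m. d (3 + real n))" for m by simp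
  ultimately have "(\<lambda>m. \<bar>(f (3 + real m) - f 3) - (\<Sum>n<m. d (3 + real n))\<bar>) \<longlonglongrightarrow> \<bar>Re (Digamma ?z) - f 3\<bar>" by (simp only: eq diff_zero)
  then have B: "\<bar>Re (Digamma ?z) - f 3\<bar> \<le> 2 / t"
    by (rule LIMSEQ_le_const2) (use tele2 in auto)
  have "f 3 - ln t = ln (1 + 9 / t\<^sup>2) / 2"
  proof -
    have "9 + t\<^sup>2 = t\<^sup>2 * (1 + 9 / t\<^sup>2)" using t by (simp add: field_simps)
    moreover have "1 + 9 / t\<^sup>2 > 0" using t by (simp add: add_pos_nonneg)
    ultimately have "ln (9 + t\<^sup>2) = 2 * ln t + ln (1 + 9 / t\<^sup>2)"
      using t by (simp add: ln_mult ln_realpow)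
    moreover have "f 3 = ln (9 + t\<^sup>2) / 2" by (simp add: f_def)
    ultimately show ?thesis by linarith
  qed
  moreover have "0 \<le> ln (1 + 9 / t\<^sup>2)" "ln (1 + 9 / t\<^sup>2) \<le> 9 / t\<^sup>2"
    using t by (auto intro!: ln_add_one_self_le_self ln_ge_zero)
  moreover have "9 / t\<^sup>2 \<le> 9 / t" using t by (intro divide_left_mono) (auto simp: power2_eq_square)
  moreover have "9 / t = 9 * inverse t" "7 / t = 7 * inverse t" "2 / t = 2 * inverse t" "inverse t > 0"
    using t by (simp_all add: divide_inverse)
  ultimately show ?thesis using B by linarith
qed

text \<open>Both \<open>C * ln t - F t\<close> and \<open>C * ln t + F t\<close> are
  nondecreasing.\<close>

lemma log_growth_of_derivative_bound:
  fixes F F' :: "real \<Rightarrow> real"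
  assumes der: "\<And>t. t \<ge> t1 \<Longrightarrow> (F has_real_derivative F' t) (at t)"
    and bnd: "\<And>t. t \<ge> t1 \<Longrightarrow> \<bar>F' t\<bar> \<le> C / t" and t1: "t1 \<ge> 1" and T: "T \<ge> t1"
  shows "\<bar>F T - F t1\<bar> \<le> C * ln T"
proof -
  have D: "((\<lambda>t. C * ln t) has_real_derivative C / t) (at t)" if "t \<ge> t1" for t
    using that t1 by (auto intro!: derivative_eq_intros)
  have "0 \<le> C / t1" using bnd[of t1] abs_ge_zero[of "F' t1"] by linarith
  then have C: "C \<ge> 0" using t1 by (simp add: zero_le_divide_iff)
  have "C * ln t1 - F t1 \<le> C * ln T - F T"
  proof (rule DERIV_nonneg_imp_nondecreasing[OF T])
    fix t assume "t1 \<le> t" "t \<le> T"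
    then show "\<exists>y. ((\<lambda>t. C * ln t - F t) has_real_derivative y) (at t) \<and> 0 \<le> y"
      using DERIV_diff[OF D[of t] der[of t]] bnd[of t] by (intro exI[of _ "C / t - F' t"]) auto
  qed
  moreover have "C * ln t1 + F t1 \<le> C * ln T + F T"
  proof (rule DERIV_nonneg_imp_nondecreasing[OF T])
    fix t assume "t1 \<le> t" "t \<le> T"
    then show "\<exists>y. ((\<lambda>t. C * ln t + F t) has_real_derivative y) (at t) \<and> 0 \<le> y"
      using DERIV_add[OF D[of t] der[of t]] bnd[of t] by (intro exI[of _ "C / t + F' t"]) auto
  qed
  moreover have "C * ln t1 \<ge> 0" using C t1 by simp
  ultimately show ?thesis by linarith
qed

section \<open>Dirichlet series\<close>

text \<open>The series is divided by its first term \<open>\<mu> powr (- u)\<close>, so that its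
  logarithm is \<open>- u * ln \<mu>\<close> plus the bounded quantity
  \<open>Ln (1 + dtail)\<close>.\<close>

definition dtail :: "real \<Rightarrow> real \<Rightarrow> complex \<Rightarrow> complex" where
  "dtail \<theta> \<mu> u = (\<Sum>n. ee (of_real (\<theta> * (real n + 1))) * of_real ((\<mu> + real n + 1) / \<mu>) powr (- u))"

definition dnorm :: "real \<Rightarrow> real \<Rightarrow> complex \<Rightarrow> complex" where
  "dnorm \<theta> \<mu> u = 1 + dtail \<theta> \<mu> u"

lemma norm_dtail_term:
  assumes \<mu>: "0 < \<mu>" "\<mu> \<le> 1" and u: "Re u \<ge> 0"
  shows "norm (ee (of_real (\<theta> * (real n + 1))) * of_real ((\<mu> + real n + 1) / \<mu>) powr (- u)) = ((\<mu> + real n + 1) / \<mu>) powr (- Re u)"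
    and "((\<mu> + real n + 1) / \<mu>) powr (- Re u) \<le> (real n + 2) powr (- Re u)"
proof -
  have "(\<mu> + real n + 1) / \<mu> > 0" using \<mu> by (simp add: add_pos_nonneg)
  then show "norm (ee (of_real (\<theta> * (real n + 1))) * of_real ((\<mu> + real n + 1) / \<mu>) powr (- u)) = ((\<mu> + real n + 1) / \<mu>) powr (- Re u)"
    unfolding norm_mult norm_ee_of_real by (subst norm_powr_real_powr) auto
  have "real n * \<mu> \<le> real n * 1" using \<mu> by (intro mult_left_mono) auto
  then have "real n + 2 \<le> (\<mu> + real n + 1) / \<mu>" using \<mu> by (simp add: field_simps)
  then show "((\<mu> + real n + 1) / \<mu>) powr (- Re u) \<le> (real n + 2) powr (- Re u)"
    using u by (intro powr_mono2') auto
qed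

lemma summable_shift_powr: "\<sigma> > 1 \<Longrightarrow> summable (\<lambda>n. (real n + 2) powr (- \<sigma>))"
  using summable_iff_shift[of "\<lambda>n. real n powr (- \<sigma>)" 2] summable_real_powr_iff[of "- \<sigma>"] by (simp add: add_ac)

lemma summable_dtail:
  assumes \<mu>: "0 < \<mu>" "\<mu> \<le> 1" and u: "Re u > 1"
  shows "summable (\<lambda>n. norm (ee (of_real (\<theta> * (real n + 1))) * of_real ((\<mu> + real n + 1) / \<mu>) powr (- u)))"
    and "summable (\<lambda>n. ((\<mu> + real n + 1) / \<mu>) powr (- Re u))"
proof -
  have u0: "Re u \<ge> 0" using u by simp
  show "summable (\<lambda>n. ((\<mu> + real n + 1) / \<mu>) powr (- Re u))"
    by (rule summable_comparison_test'[OF summable_shift_powr[OF u], of 0])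
       (use norm_dtail_term(2)[OF \<mu> u0] in simp)
  then show "summable (\<lambda>n. norm (ee (of_real (\<theta> * (real n + 1))) * of_real ((\<mu> + real n + 1) / \<mu>) powr (- u)))"
    unfolding norm_dtail_term(1)[OF \<mu> u0] .
qed

lemma norm_dtail_le_sum:
  assumes \<mu>: "0 < \<mu>" "\<mu> \<le> 1" and u: "Re u > 1"
  shows "norm (dtail \<theta> \<mu> u) \<le> (\<Sum>n. ((\<mu> + real n + 1) / \<mu>) powr (- Re u))"
proof -
  have u0: "Re u \<ge> 0" using u by simp
  have "norm (dtail \<theta> \<mu> u) \<le> (\<Sum>n. norm (ee (of_real (\<theta> * (real n + 1))) * of_real ((\<mu> + real n + 1) / \<mu>) powr (- u)))"
    unfolding dtail_def by (rule summable_norm[OF summable_dtail(1)[OF \<mu> u]])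
  then show ?thesis unfolding norm_dtail_term(1)[OF \<mu> u0] .
qed

text \<open>Each term is at most \<open>2 powr (2 - Re u)\<close> times its value at exponent 2, and
  \<open>pi\<^sup>2 / 6 - 1 \<le> 3/4\<close>. A constant below 1 keeps \<open>dnorm\<close> in the
  right half-plane, where the principal logarithm is holomorphic; the power of 2 makes that
  logarithm small far to the right.\<close>

lemma norm_dtail_le:
  assumes \<mu>: "0 < \<mu>" "\<mu> \<le> 1" and u: "Re u \<ge> 2"
  shows "norm (dtail \<theta> \<mu> u) \<le> 3/4 * 2 powr (2 - Re u)"
proof -
  have u1: "Re u > 1" and u0: "Re u \<ge> 0" using u by auto
  have s: "(\<lambda>n. 1 / (real n + 2)\<^sup>2) sums (pi\<^sup>2 / 6 - 1)"
    using inverse_squares_sums sums_iff_shift[of "\<lambda>n. 1 / (real n + 1)\<^sup>2" 1 "pi\<^sup>2 / 6 - 1"] by (simp add: add_ac)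
  have tm: "((\<mu> + real n + 1) / \<mu>) powr (- Re u) \<le> 2 powr (2 - Re u) * (1 / (real n + 2)\<^sup>2)" for n
  proof -
    have "((\<mu> + real n + 1) / \<mu>) powr (- Re u) \<le> (real n + 2) powr (- Re u)" by (rule norm_dtail_term(2)[OF \<mu> u0])
    also have "(real n + 2) powr (- Re u) = (real n + 2) powr (2 - Re u) * (real n + 2) powr (- 2)"
      by (simp flip: powr_add)
    also have "(real n + 2) powr (- 2) = 1 / (real n + 2)\<^sup>2"
      using powr_minus_divide[of "real n + 2" 2] by simp
    also have "(real n + 2) powr (2 - Re u) * (1 / (real n + 2)\<^sup>2) \<le> 2 powr (2 - Re u) * (1 / (real n + 2)\<^sup>2)"
      using u by (intro mult_right_mono powr_mono2') auto
    finally show ?thesis .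
  qed
  have "norm (dtail \<theta> \<mu> u) \<le> (\<Sum>n. ((\<mu> + real n + 1) / \<mu>) powr (- Re u))" by (rule norm_dtail_le_sum[OF \<mu> u1])
  also have "\<dots> \<le> (\<Sum>n. 2 powr (2 - Re u) * (1 / (real n + 2)\<^sup>2))"
    using s by (intro suminf_le tm summable_dtail(2)[OF \<mu> u1] summable_mult) (auto simp: sums_iff)
  also have "\<dots> = 2 powr (2 - Re u) * (pi\<^sup>2 / 6 - 1)" using sums_unique[OF sums_mult[OF s, of "2 powr (2 - Re u)"]] by (simp only:)
  also have "\<dots> \<le> 2 powr (2 - Re u) * (3/4)"
  proof (rule mult_left_mono)
    have "pi\<^sup>2 \<le> (16/5)\<^sup>2" using pi_approx by (intro power_mono) auto
    then show "pi\<^sup>2 / 6 - 1 \<le> 3/4" by (simp add: power2_eq_square)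
  qed simp
  finally show ?thesis by simp
qed

text \<open>Comparison of the tail with the integral of \<open>(\<mu> / x) powr Re u\<close> over \<open>x \<ge> \<mu>\<close>.\<close>

lemma norm_dtail_less_1:
  assumes \<mu>: "0 < \<mu>" "\<mu> \<le> 1" and u: "Re u \<ge> 1 + \<mu>"
  shows "norm (dtail \<theta> \<mu> u) < 1"
proof -
  define \<sigma> where "\<sigma> = Re u"
  have \<sigma>: "\<sigma> > 1" "\<sigma> \<ge> 1 + \<mu>" using u \<mu> by (auto simp: \<sigma>_def)
  \<comment> \<open>The integral of \<open>(\<mu> / x) powr \<sigma>\<close> over
    \<open>x \<ge> \<mu> + n\<close>.\<close>
  define a where "a n = (\<mu> + real n) powr (1 - \<sigma>) * (\<mu> powr \<sigma> / (\<sigma> - 1))" for n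
  have tm: "((\<mu> + real n + 1) / \<mu>) powr (- \<sigma>) < a n - a (Suc n)" for n
  proof -
    let ?f = "\<lambda>x. - (x powr (1 - \<sigma>)) / (\<sigma> - 1)"
    have "\<exists>\<xi>>\<mu> + real n. \<xi> < \<mu> + real n + 1 \<and> ?f (\<mu> + real n + 1) - ?f (\<mu> + real n) = (\<mu> + real n + 1 - (\<mu> + real n)) * \<xi> powr (- \<sigma>)"
    proof (rule MVT2)
      fix x assume "\<mu> + real n \<le> x" "x \<le> \<mu> + real n + 1"
      then have x: "x > 0" using \<mu> by linarith
      have "((\<lambda>x. x powr (1 - \<sigma>)) has_real_derivative (1 - \<sigma>) * x powr (1 - \<sigma> - 1)) (at x)"
        by (rule has_real_derivative_powr[OF x])
      from DERIV_cdivide[OF DERIV_minus[OF this], of "\<sigma> - 1"]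
      have "(?f has_real_derivative - ((1 - \<sigma>) * x powr (1 - \<sigma> - 1)) / (\<sigma> - 1)) (at x)" .
      moreover have "- ((1 - \<sigma>) * x powr (1 - \<sigma> - 1)) / (\<sigma> - 1) = x powr (- \<sigma>)"
        using \<sigma> by (simp add: field_simps)
      ultimately show "(?f has_real_derivative x powr (- \<sigma>)) (at x)" by simp
    qed simp
    then obtain \<xi> where \<xi>: "\<mu> + real n < \<xi>" "\<xi> < \<mu> + real n + 1"
      "?f (\<mu> + real n + 1) - ?f (\<mu> + real n) = \<xi> powr (- \<sigma>)" by auto
    have "(\<mu> + real n + 1) powr (- \<sigma>) < \<xi> powr (- \<sigma>)"
      using \<xi> \<mu> \<sigma> by (intro powr_less_mono2_neg) auto
    then have "\<mu> powr \<sigma> * (\<mu> + real n + 1) powr (- \<sigma>) < \<mu> powr \<sigma> * (?f (\<mu> + real n + 1) - ?f (\<mu> + real n))"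
      unfolding \<xi>(3) using \<mu> by (intro mult_strict_left_mono) auto
    moreover have "\<mu> powr \<sigma> * (?f (\<mu> + real n + 1) - ?f (\<mu> + real n)) = a n - a (Suc n)"
      by (simp add: a_def algebra_simps)
    moreover have "((\<mu> + real n + 1) / \<mu>) powr (- \<sigma>) = \<mu> powr \<sigma> * (\<mu> + real n + 1) powr (- \<sigma>)"
      using \<mu> by (subst powr_divide) (auto simp: powr_minus field_simps)
    ultimately show ?thesis by simp
  qed
  have "a \<longlonglongrightarrow> 0"
  proof -
    have "(\<lambda>n. (\<mu> + real n) powr (1 - \<sigma>)) \<longlonglongrightarrow> 0" using \<sigma> by real_asymp
    from tendsto_mult_left_zero[OF this] show ?thesis unfolding a_def .
  qed
  from telescope_sums'[OF this] have S: "(\<lambda>n. a n - a (Suc n)) sums a 0" by simp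
  have summ: "summable (\<lambda>n. ((\<mu> + real n + 1) / \<mu>) powr (- \<sigma>))"
    using summable_dtail(2)[OF \<mu>, of u] \<sigma> by (simp add: \<sigma>_def)
  have sS: "summable (\<lambda>n. a n - a (Suc n))" by (rule sums_summable[OF S])
  \<comment> \<open>At the boundary value \<open>\<sigma> = 1 + \<mu>\<close> the integral
    \<open>a 0\<close> is exactly 1, so the strictness in every term has to be carried into the
    sum.\<close>
  have "0 < (\<Sum>n. (a n - a (Suc n)) - ((\<mu> + real n + 1) / \<mu>) powr (- \<sigma>))"
    using tm by (intro suminf_pos summable_diff[OF sS summ]) simp
  also have "\<dots> = a 0 - (\<Sum>n. ((\<mu> + real n + 1) / \<mu>) powr (- \<sigma>))"
    unfolding suminf_diff[OF sS summ, symmetric] sums_unique[OF S, symmetric] ..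
  finally have "(\<Sum>n. ((\<mu> + real n + 1) / \<mu>) powr (- \<sigma>)) < a 0" by simp
  moreover have "a 0 = \<mu> / (\<sigma> - 1)" using \<mu> by (simp add: a_def flip: powr_add)
  moreover have "\<mu> / (\<sigma> - 1) \<le> 1" using \<sigma> by simp
  moreover have "norm (dtail \<theta> \<mu> u) \<le> (\<Sum>n. ((\<mu> + real n + 1) / \<mu>) powr (- \<sigma>))"
    using norm_dtail_le_sum[OF \<mu>, of u \<theta>] \<sigma> by (simp add: \<sigma>_def)
  ultimately show ?thesis by linarith
qed

lemma dnorm_nonzero:
  assumes "0 < \<mu>" "\<mu> \<le> 1" "Re u \<ge> 1 + \<mu>"
  shows "dnorm \<theta> \<mu> u \<noteq> 0"
proof
  assume "dnorm \<theta> \<mu> u = 0"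
  then have "dtail \<theta> \<mu> u = - 1" by (simp add: dnorm_def add_eq_0_iff)
  then show False using norm_dtail_less_1[OF assms, of \<theta>] by simp
qed

lemma dnorm_holomorphic:
  assumes \<mu>: "0 < \<mu>" "\<mu> \<le> 1"
  shows "dnorm \<theta> \<mu> holomorphic_on {u. Re u > 1}"
proof -
  let ?t = "\<lambda>n u. ee (of_real (\<theta> * (real n + 1))) * of_real ((\<mu> + real n + 1) / \<mu>) powr (- u)"
  have "dtail \<theta> \<mu> holomorphic_on {u. Re u > 1}"
  proof (rule holomorphic_uniform_sequence[of _ "\<lambda>N u. \<Sum>n<N. ?t n u"])
    show "open {u. Re u > 1}" by (rule open_halfspace_Re_gt)
    show "(\<lambda>u. \<Sum>n<N. ?t n u) holomorphic_on {u. Re u > 1}" for N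
      by (intro holomorphic_intros)
    fix x :: complex assume x: "x \<in> {u. Re u > 1}"
    define d where "d = (Re x - 1) / 2"
    have d: "d > 0" using x by (simp add: d_def)
    have cb: "Re u \<ge> 1 + d" if "u \<in> cball x d" for u
      using that abs_Re_le_cmod[of "x - u"] by (simp add: dist_norm d_def field_simps)
    have "uniform_limit (cball x d) (\<lambda>N u. \<Sum>n<N. ?t n u) (\<lambda>u. \<Sum>n. ?t n u) sequentially"
    proof (rule Weierstrass_m_test)
      fix n u assume "u \<in> cball x d"
      then have u: "Re u \<ge> 1 + d" by (rule cb)
      then have u0: "Re u \<ge> 0" using d by simp
      have "norm (?t n u) \<le> (real n + 2) powr (- Re u)"
        using norm_dtail_term(1)[OF \<mu> u0, of \<theta> n] norm_dtail_term(2)[OF \<mu> u0, of n] by simp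
      also have "\<dots> \<le> (real n + 2) powr (- (1 + d))" using u by (intro powr_mono) auto
      finally show "norm (?t n u) \<le> (real n + 2) powr (- (1 + d))" .
    qed (rule summable_shift_powr, use d in simp)
    then show "\<exists>d>0. cball x d \<subseteq> {u. 1 < Re u} \<and> uniform_limit (cball x d) (\<lambda>N u. \<Sum>n<N. ?t n u) (dtail \<theta> \<mu>) sequentially"
      using d cb by (intro exI[of _ d]) (force simp: dtail_def[abs_def])
  qed
  then show ?thesis unfolding dnorm_def by (intro holomorphic_intros)
qed

lemma series_eq_dnorm:
  assumes \<mu>: "0 < \<mu>" "\<mu> \<le> 1" and u: "Re u > 1"
  shows "(\<lambda>n. ee (of_real (\<theta> * real n)) * of_real (real n + \<mu>) powr (- u)) sums (of_real \<mu> powr (- u) * dnorm \<theta> \<mu> u)"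
proof -
  let ?t = "\<lambda>n. ee (of_real (\<theta> * (real n + 1))) * of_real ((\<mu> + real n + 1) / \<mu>) powr (- u)"
  have "summable ?t" by (rule summable_norm_cancel[OF summable_dtail(1)[OF \<mu> u]])
  then have "?t sums dtail \<theta> \<mu> u" unfolding dtail_def by (rule summable_sums)
  then have "(\<lambda>n. of_real \<mu> powr (- u) * ?t n) sums (of_real \<mu> powr (- u) * dtail \<theta> \<mu> u)" by (rule sums_mult)
  moreover have "of_real \<mu> powr (- u) * ?t n = ee (of_real (\<theta> * real (Suc n))) * of_real (real (Suc n) + \<mu>) powr (- u)" for n
  proof -
    have e: "(of_real (real (Suc n) + \<mu>) :: complex) = of_real \<mu> * of_real ((\<mu> + real n + 1) / \<mu>)"
      using \<mu> by (simp flip: of_real_mult)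
    have "of_real (real (Suc n) + \<mu>) powr (- u) = of_real \<mu> powr (- u) * of_real ((\<mu> + real n + 1) / \<mu>) powr (- u)"
      unfolding e using \<mu> by (subst powr_times_real) auto
    then show ?thesis by (simp add: add_ac mult_ac)
  qed
  ultimately have "(\<lambda>n. ee (of_real (\<theta> * real (Suc n))) * of_real (real (Suc n) + \<mu>) powr (- u)) sums (of_real \<mu> powr (- u) * dtail \<theta> \<mu> u)" by simp
  from sums_Suc[OF this] show ?thesis by (simp add: dnorm_def distrib_left add.commute)
qed

lemma dser_eq_dnorm:
  assumes \<mu>: "0 < \<mu>" "\<mu> \<le> 1" and u: "Re u > 1"
  shows "summable (\<lambda>n. ee (of_real (\<theta> * (\<mu> + real n))) * of_real (\<mu> + real n) powr (- u))"
    and "dser \<theta> \<mu> u = ee (of_real (\<theta> * \<mu>)) * (of_real \<mu> powr (- u) * dnorm \<theta> \<mu> u)"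
proof -
  have "(\<lambda>n. ee (of_real (\<theta> * \<mu>)) * (ee (of_real (\<theta> * real n)) * of_real (real n + \<mu>) powr (- u)))
     sums (ee (of_real (\<theta> * \<mu>)) * (of_real \<mu> powr (- u) * dnorm \<theta> \<mu> u))"
    by (intro sums_mult series_eq_dnorm \<mu> u)
  moreover have "ee (of_real (\<theta> * \<mu>)) * (ee (of_real (\<theta> * real n)) * of_real (real n + \<mu>) powr (- u))
     = ee (of_real (\<theta> * (\<mu> + real n))) * of_real (\<mu> + real n) powr (- u)" for n
  proof -
    have "ee (of_real (\<theta> * (\<mu> + real n))) = ee (of_real (\<theta> * \<mu>)) * ee (of_real (\<theta> * real n))"
      by (simp add: distrib_left flip: ee_add)
    then show ?thesis by (simp add: add.commute mult.assoc)
  qed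
  ultimately have "(\<lambda>n. ee (of_real (\<theta> * (\<mu> + real n))) * of_real (\<mu> + real n) powr (- u))
     sums (ee (of_real (\<theta> * \<mu>)) * (of_real \<mu> powr (- u) * dnorm \<theta> \<mu> u))" by simp
  then show "summable (\<lambda>n. ee (of_real (\<theta> * (\<mu> + real n))) * of_real (\<mu> + real n) powr (- u))"
    "dser \<theta> \<mu> u = ee (of_real (\<theta> * \<mu>)) * (of_real \<mu> powr (- u) * dnorm \<theta> \<mu> u)"
    by (auto simp: sums_iff dser_def)
qed

text \<open>The upper half of the imaginary axis contributes the series with \<open>lam\<close>, the
  reflected lower half the one with \<open>lam_dual lam\<close>. With \<open>Im s = t\<close> the
  two exponentials have moduli \<open>exp (pi * t / 2)\<close> and
  \<open>exp (- (pi * t / 2))\<close>, so the first term dominates high up.\<close>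

theorem lerch_functional_equation:
  assumes lam: "0 < lam" "lam \<le> 1" and \<alpha>: "0 < \<alpha>" "\<alpha> \<le> 1" and s: "Re s < -1"
  shows "- J lam (\<alpha>/2) (\<alpha>/2) s = Gamma (1 - s) * of_real (2 * pi) powr (- (1 - s)) *
    (exp (\<i> * of_real pi * (1 - s) / 2) * (ee (of_real (- \<alpha> * lam)) * (of_real lam powr (- (1 - s)) * dnorm (- \<alpha>) lam (1 - s)))
     + exp (- (\<i> * of_real pi * (1 - s) / 2)) * (ee (of_real (\<alpha> * lam_dual lam)) * (of_real (lam_dual lam) powr (- (1 - s)) * dnorm \<alpha> (lam_dual lam) (1 - s))))"
proof -
  let ?u = "1 - s" and ?ls = "lam_dual lam"
  have ls: "0 < ?ls" "?ls \<le> 1" using lam_dual_pos[OF lam] by auto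
  have u: "Re ?u > 1" "Re (1 - cnj s) > 1" using s by auto
  let ?c = "Gamma ?u * of_real (2 * pi) powr (s - 1)"
  have V1: "V lam \<alpha> s = - (exp (- \<i> * of_real pi * s / 2) * Gamma (1 - s) * of_real (2 * pi) powr (s - 1) * dser (- \<alpha>) lam (1 - s))"
    by (intro V_eq_dser \<alpha> s lam dser_eq_dnorm(1) u)
  have "V ?ls \<alpha> (cnj s) = - (exp (- \<i> * of_real pi * cnj s / 2) * Gamma (1 - cnj s) * of_real (2 * pi) powr (cnj s - 1) * dser (- \<alpha>) ?ls (1 - cnj s))"
    using s by (intro V_eq_dser \<alpha> ls dser_eq_dnorm(1) u) simp
  then have "cnj (V ?ls \<alpha> (cnj s)) = - (exp (\<i> * of_real pi * s / 2) * Gamma (1 - s) * of_real (2 * pi) powr (s - 1) * cnj (dser (- \<alpha>) ?ls (1 - cnj s)))"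
    by (simp add: exp_cnj cnj_Gamma cnj_powr del: of_real_mult)
  also have "cnj (dser (- \<alpha>) ?ls (1 - cnj s)) = dser \<alpha> ?ls (1 - s)"
  proof -
    have "(\<lambda>n. ee (of_real (- \<alpha> * (?ls + real n))) * of_real (?ls + real n) powr (- (1 - cnj s))) sums dser (- \<alpha>) ?ls (1 - cnj s)"
      unfolding dser_def by (intro summable_sums dser_eq_dnorm(1) ls u)
    then have "(\<lambda>n. cnj (ee (of_real (- \<alpha> * (?ls + real n))) * of_real (?ls + real n) powr (- (1 - cnj s)))) sums cnj (dser (- \<alpha>) ?ls (1 - cnj s))"
      by (rule sums_cnj[THEN iffD2])
    moreover have "cnj (ee (of_real (- \<alpha> * (?ls + real n))) * of_real (?ls + real n) powr (- (1 - cnj s)))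
        = ee (of_real (\<alpha> * (?ls + real n))) * of_real (?ls + real n) powr (- (1 - s))" for n
    proof -
      have "cnj (of_real (?ls + real n) powr (- (1 - cnj s))) = of_real (?ls + real n) powr (- (1 - s))"
        using ls by (subst cnj_powr) auto
      moreover have "cnj (ee (of_real (- \<alpha> * (?ls + real n)))) = ee (of_real (\<alpha> * (?ls + real n)))"
        by (simp add: cnj_ee)
      ultimately show ?thesis by simp
    qed
    ultimately show ?thesis unfolding dser_def[of \<alpha>] by (simp add: sums_iff)
  qed
  finally have V2: "cnj (V ?ls \<alpha> (cnj s)) = - (exp (\<i> * of_real pi * s / 2) * Gamma (1 - s) * of_real (2 * pi) powr (s - 1) * dser \<alpha> ?ls (1 - s))" .
  have ii: "\<i> = exp (\<i> * of_real pi / 2)"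
  proof -
    have "exp (\<i> * of_real pi / 2) = cis (pi / 2)" by (simp add: cis_conv_exp)
    then show ?thesis by simp
  qed
  \<comment> \<open>The factor \<open>\<i>\<close> from \<open>dw = \<i> * dy\<close> turns the
    exponent in \<open>s\<close> into one in \<open>1 - s\<close>.\<close>
  have e1: "\<i> * exp (- \<i> * of_real pi * s / 2) = exp (\<i> * of_real pi * ?u / 2)"
  proof -
    have "exp (\<i> * of_real pi / 2) * exp (- \<i> * of_real pi * s / 2) = exp (\<i> * of_real pi * ?u / 2)"
      by (simp add: right_diff_distrib diff_divide_distrib flip: exp_add)
    then show ?thesis by (simp flip: ii)
  qed
  have e2: "\<i> * exp (\<i> * of_real pi * s / 2) = - exp (- (\<i> * of_real pi * ?u / 2))"
  proof -
    have "exp (\<i> * of_real pi * s / 2) = exp (\<i> * of_real pi / 2) * exp (- (\<i> * of_real pi * ?u / 2))"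
      by (simp add: right_diff_distrib diff_divide_distrib flip: exp_add)
    then show ?thesis by (simp flip: ii)
  qed
  have "- J lam (\<alpha>/2) (\<alpha>/2) s = (\<i> * exp (- \<i> * of_real pi * s / 2)) * ?c * dser (- \<alpha>) lam ?u
     - (\<i> * exp (\<i> * of_real pi * s / 2)) * ?c * dser \<alpha> ?ls ?u"
    unfolding J_eq_V[OF lam \<alpha> s] V1 V2 by (simp add: algebra_simps)
  also have "\<dots> = ?c * (exp (\<i> * of_real pi * ?u / 2) * dser (- \<alpha>) lam ?u + exp (- (\<i> * of_real pi * ?u / 2)) * dser \<alpha> ?ls ?u)"
    unfolding e1 e2 by (simp add: algebra_simps)
  finally show ?thesis
    unfolding dser_eq_dnorm(2)[OF lam u(1)] dser_eq_dnorm(2)[OF ls u(1)] by simp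
qed

section \<open>The continued Lerch zeta function\<close>

locale lerch_params =
  fixes lam \<alpha> :: real
  assumes lam: "0 < lam" "lam \<le> 1" and \<alpha>: "0 < \<alpha>" "\<alpha> \<le> 1"
begin

abbreviation L :: "complex \<Rightarrow> complex" where
  "L \<equiv> lerch_zeta lam \<alpha>"

definition L0 :: "complex \<Rightarrow> complex" where
  "L0 s = - J lam (\<alpha>/2) (\<alpha>/2) s"

lemma half_alpha: "0 < \<alpha>/2" "\<alpha>/2 < 1"
  using \<alpha> by auto

lemma lam_dual_range: "0 < lam_dual lam" "lam_dual lam \<le> 1"
  using lam_dual_pos[OF lam] by auto

lemma U_parts_holomorphic:
  "(\<lambda>s. \<i> * (U lam (\<alpha>/2) (\<alpha>/2) s - cnj (U (lam_dual lam) (\<alpha>/2) (\<alpha>/2) (cnj s)))) holomorphic_on UNIV"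
proof -
  have "U (lam_dual lam) (\<alpha>/2) (\<alpha>/2) holomorphic_on cnj ` UNIV"
    using U_holomorphic[OF half_alpha half_alpha(1) lam_dual_range(1)] by (rule holomorphic_on_subset) simp
  from holomorphic_on_compose_cnj_cnj[OF this open_UNIV]
  have "(\<lambda>s. cnj (U (lam_dual lam) (\<alpha>/2) (\<alpha>/2) (cnj s))) holomorphic_on UNIV" by (simp add: o_def)
  moreover have "U lam (\<alpha>/2) (\<alpha>/2) holomorphic_on UNIV" by (rule U_holomorphic[OF half_alpha half_alpha(1) lam(1)])
  ultimately show ?thesis by (intro holomorphic_intros)
qed

lemma L0_holomorphic: "L0 holomorphic_on (- {1})"
  unfolding L0_def J_def using half_alpha
  by (intro holomorphic_intros holomorphic_on_subset[OF U_parts_holomorphic]) auto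

lemma L0_meromorphic: "L0 meromorphic_on UNIV"
proof -
  have a: "(\<lambda>s. \<i> * (U lam (\<alpha>/2) (\<alpha>/2) s - cnj (U (lam_dual lam) (\<alpha>/2) (\<alpha>/2) (cnj s)))) meromorphic_on UNIV"
    using U_parts_holomorphic by (intro analytic_on_imp_meromorphic_on) (simp add: analytic_on_open)
  have b: "(\<lambda>s. lam_ind lam * of_real (\<alpha>/2) powr (1 - s)) meromorphic_on UNIV"
    using half_alpha by (intro analytic_on_imp_meromorphic_on) (auto simp: analytic_on_open intro!: holomorphic_intros)
  show ?thesis unfolding L0_def[abs_def] J_def
    by (intro meromorphic_intros a b)
qed

lemma L0_series:
  assumes "Re s > 1"
  shows "(\<lambda>m::nat. exp (2 * of_real pi * \<i> * of_real lam * of_nat m) / of_real (real m + \<alpha>) powr s) sums L0 s"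
proof -
  have "(\<lambda>m. ee (of_real (lam * real m)) * of_real (real m + \<alpha>) powr (- s)) sums L0 s"
    unfolding L0_def by (rule lerch_series_eq_J[OF lam \<alpha> assms])
  then show ?thesis by (simp add: ee_def powr_minus divide_inverse mult_ac)
qed

text \<open>At \<open>s = 1\<close> the division by zero in \<open>J\<close> may leave
  \<open>L0\<close> with a meaningless value. \<open>remove_sings\<close> replaces it by the one
  that \<open>nicely_meromorphic_on\<close> prescribes.\<close>

lemma lerch_continuation: "is_lerch_continuation lam \<alpha> (remove_sings L0)"
proof -
  have "L0 analytic_on {z}" if "z \<noteq> 1" for z
    unfolding analytic_at using L0_holomorphic that by (intro exI[of _ "- {1}"]) auto
  then have eq: "remove_sings L0 z = L0 z" if "z \<noteq> 1" for z
    using that by (intro remove_sings_at_analytic)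
  have "remove_sings L0 holomorphic_on (- {1})"
    using L0_holomorphic by (rule holomorphic_transform) (use eq in auto)
  moreover have "remove_sings L0 nicely_meromorphic_on UNIV"
    by (rule remove_sings_nicely_meromorphic[OF L0_meromorphic])
  moreover have "remove_sings L0 s = L0 s" if "Re s > 1" for s using that by (intro eq) auto
  ultimately show ?thesis unfolding is_lerch_continuation_def using L0_series by auto
qed

lemma L_eq_remove_sings: "L = remove_sings L0"
  unfolding lerch_zeta_def
  using lerch_continuation is_lerch_continuation_unique by (intro the_equality) blast+

lemma L_holomorphic: "L holomorphic_on (- {1})"
  using lerch_continuation unfolding L_eq_remove_sings is_lerch_continuation_def by blast

lemma L_eq_L0: "s \<noteq> 1 \<Longrightarrow> L s = L0 s"
proof -
  assume "s \<noteq> 1"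
  then have "L0 analytic_on {s}"
    unfolding analytic_at using L0_holomorphic by (intro exI[of _ "- {1}"]) auto
  then show ?thesis unfolding L_eq_remove_sings by (rule remove_sings_at_analytic)
qed

lemma L_right:
  assumes "Re s > 1"
  shows "L s = of_real \<alpha> powr (- s) * dnorm lam \<alpha> s"
proof -
  have "s \<noteq> 1" using assms by auto
  then show ?thesis
    using sums_unique2[OF lerch_series_eq_J[OF lam \<alpha> assms] series_eq_dnorm[OF \<alpha> assms, of lam]]
    by (simp add: L_eq_L0 L0_def)
qed

text \<open>This explains the right end \<open>1 + \<alpha>\<close> of the strip of nontrivial
  zeros.\<close>

lemma L_nonzero_right:
  assumes "Re s \<ge> 1 + \<alpha>"
  shows "L s \<noteq> 0"
  using L_right[of s] dnorm_nonzero[OF \<alpha> assms, of lam] assms \<alpha> by (simp add: powr_def)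

text \<open>The quotient of the two terms of the functional equation at \<open>u = 1 - s\<close>.\<close>

definition dual_ratio :: "complex \<Rightarrow> complex" where
  "dual_ratio u = exp (- (\<i> * of_real pi * u)) * (ee (of_real (\<alpha> * lam_dual lam)) / ee (of_real (- \<alpha> * lam)))
     * ((of_real (lam_dual lam) powr (- u) * dnorm \<alpha> (lam_dual lam) u) / (of_real lam powr (- u) * dnorm (- \<alpha>) lam u))"

lemma dnorm_bounds:
  assumes "0 < \<mu>" "\<mu> \<le> 1" "Re u \<ge> 2"
  shows "norm (dnorm \<theta> \<mu> u) \<le> 2" "norm (dnorm \<theta> \<mu> u) \<ge> 1/4"
proof -
  have "2 powr (2 - Re u) \<le> 2 powr 0" using assms by (intro powr_mono) auto
  then have "norm (dtail \<theta> \<mu> u) \<le> 3/4" using norm_dtail_le[OF assms, of \<theta>] by simp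
  then show "norm (dnorm \<theta> \<mu> u) \<le> 2" "norm (dnorm \<theta> \<mu> u) \<ge> 1/4"
    unfolding dnorm_def using norm_triangle_ineq[of 1 "dtail \<theta> \<mu> u"] norm_triangle_ineq2[of 1 "- dtail \<theta> \<mu> u"] by auto
qed

text \<open>The term that dominates for large \<open>Im s\<close> is pulled out. All factors but the
  last then have evident logarithms, and the last is \<open>1\<close> plus something small.\<close>

lemma L_left:
  assumes s: "Re s < -1"
  shows "L s = Gamma (1 - s) * of_real (2 * pi) powr (- (1 - s)) * exp (\<i> * of_real pi * (1 - s) / 2)
     * ee (of_real (- \<alpha> * lam)) * of_real lam powr (- (1 - s)) * dnorm (- \<alpha>) lam (1 - s) * (1 + dual_ratio (1 - s))"
proof -
  have ne: "s \<noteq> 1" using s by auto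
  define u where "u = 1 - s"
  have u: "Re u \<ge> 2" using s by (simp add: u_def)
  define A where "A = ee (of_real (- \<alpha> * lam)) * (of_real lam powr (- u) * dnorm (- \<alpha>) lam u)"
  define B where "B = ee (of_real (\<alpha> * lam_dual lam)) * (of_real (lam_dual lam) powr (- u) * dnorm \<alpha> (lam_dual lam) u)"
  have "dnorm (- \<alpha>) lam u \<noteq> 0" using dnorm_bounds(2)[OF lam u, of "- \<alpha>"] by auto
  then have A: "A \<noteq> 0" using lam by (simp add: A_def powr_def)
  have sm: "dual_ratio u = exp (- (\<i> * of_real pi * u)) * (B / A)"
    by (simp add: dual_ratio_def A_def B_def)
  have ex: "exp (- (\<i> * of_real pi * u)) * exp (\<i> * of_real pi * u / 2) = exp (- (\<i> * of_real pi * u / 2))"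
    by (simp add: mult_ac flip: exp_add)
  have "exp (\<i> * of_real pi * u / 2) * A * (1 + dual_ratio u) = exp (\<i> * of_real pi * u / 2) * A + (exp (- (\<i> * of_real pi * u)) * exp (\<i> * of_real pi * u / 2)) * B"
    unfolding sm using A by (simp add: field_simps)
  then have e: "exp (\<i> * of_real pi * u / 2) * A * (1 + dual_ratio u) = exp (\<i> * of_real pi * u / 2) * A + exp (- (\<i> * of_real pi * u / 2)) * B"
    unfolding ex .
  have "L s = Gamma u * of_real (2 * pi) powr (- u) * (exp (\<i> * of_real pi * u / 2) * A + exp (- (\<i> * of_real pi * u / 2)) * B)"
    unfolding L_eq_L0[OF ne] L0_def A_def B_def u_def by (rule lerch_functional_equation[OF lam \<alpha> s])
  then have "L s = Gamma u * of_real (2 * pi) powr (- u) * (exp (\<i> * of_real pi * u / 2) * A * (1 + dual_ratio u))"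
    by (simp only: e)
  then show ?thesis unfolding u_def[symmetric] A_def by (simp only: mult.assoc)
qed

text \<open>For \<open>s\<close> in the upper half-plane \<open>Im u\<close> is negative, so the
  ratio is exponentially small there. The constant 8 is the upper bound 2 for \<open>dnorm\<close>
  over its lower bound \<open>1/4\<close>.\<close>

lemma dual_ratio_bound:
  obtains C where "C > 0" "\<And>u. 2 \<le> Re u \<Longrightarrow> Re u \<le> 4 \<Longrightarrow> norm (dual_ratio u) \<le> C * exp (pi * Im u)"
proof -
  let ?l = "lam_dual lam"
  define C where "C = 8 * ?l powr (- 4)"
  have "norm (dual_ratio u) \<le> C * exp (pi * Im u)" if u: "2 \<le> Re u" "Re u \<le> 4" for u
  proof -
    have n1: "norm (of_real ?l powr (- u)) \<le> ?l powr (- 4)"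
      using lam_dual_range u by (subst norm_powr_real_powr) (auto intro: powr_mono')
    have "lam powr 0 \<le> lam powr (- Re u)" using lam u by (intro powr_mono') auto
    then have n2: "norm (of_real lam powr (- u)) \<ge> 1"
      using lam by (subst norm_powr_real_powr) auto
    have num: "norm (of_real ?l powr (- u) * dnorm \<alpha> ?l u) \<le> ?l powr (- 4) * 2"
      unfolding norm_mult using n1 dnorm_bounds(1)[OF lam_dual_range u(1)] by (intro mult_mono) auto
    have "1 * (1/4) \<le> norm (of_real lam powr (- u)) * norm (dnorm (- \<alpha>) lam u)"
      using n2 dnorm_bounds(2)[OF lam u(1), of "- \<alpha>"] by (intro mult_mono) auto
    then have den: "1/4 \<le> norm (of_real lam powr (- u) * dnorm (- \<alpha>) lam u)" by (simp add: norm_mult)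
    have "norm (dual_ratio u) = exp (pi * Im u) * (norm (of_real ?l powr (- u) * dnorm \<alpha> ?l u) / norm (of_real lam powr (- u) * dnorm (- \<alpha>) lam u))"
      by (simp add: dual_ratio_def norm_mult norm_divide norm_ee del: of_real_mult of_real_minus)
    also have "\<dots> \<le> exp (pi * Im u) * ((?l powr (- 4) * 2) / (1/4))"
      using num den by (intro mult_left_mono frac_le) auto
    finally show ?thesis by (simp add: C_def mult_ac)
  qed
  moreover have "C > 0" using lam_dual_range by (simp add: C_def)
  ultimately show ?thesis using that by blast
qed

text \<open>The strip holds every disc of radius 19 about a point with real part 3. The right edge
  lies in the region of absolute convergence; on the left edge the functional equation brings in
  \<open>Gamma (17 - \<i> * t)\<close>, whence the exponent 17.\<close>

lemma L_growth:
  obtains C where "C > 0" "\<And>z. -16 \<le> Re z \<Longrightarrow> Re z \<le> 22 \<Longrightarrow> 1 \<le> Im z \<Longrightarrow> norm (L z) \<le> C * norm z ^ 17"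
proof -
  let ?b = "\<alpha>/2" and ?l = "lam_dual lam"
  obtain K1 where K1: "K1 \<ge> 0" "\<And>s. \<bar>Re s\<bar> \<le> 22 \<Longrightarrow> norm (U lam ?b ?b s) \<le> K1 * exp (pi/2 * \<bar>Im s\<bar>)"
    by (rule norm_U_strip[OF half_alpha half_alpha(1) lam(1), of 22]) (simp, rule that)
  obtain K2 where K2: "K2 \<ge> 0" "\<And>s. \<bar>Re s\<bar> \<le> 22 \<Longrightarrow> norm (U ?l ?b ?b s) \<le> K2 * exp (pi/2 * \<bar>Im s\<bar>)"
    by (rule norm_U_strip[OF half_alpha half_alpha(1) lam_dual_range(1), of 22]) (simp, rule that)
  define C1 where "C1 = K1 + K2 + ?b powr (- 21)"
  define C2 where "C2 = max (2 * \<alpha> powr (- 22)) (4 * 17 ^ 16 * (2 * lam powr (- 17) + 2 * ?l powr (- 17)))"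
  have hol: "L holomorphic_on {z. Im z > 0}"
    by (rule holomorphic_on_subset[OF L_holomorphic]) auto
  \<comment> \<open>The integral representation alone grows like \<open>exp (pi/2 * Im z)\<close>,
    because \<open>Arg w\<close> reaches up to \<open>pi/2\<close> on the line; this is the growth
    hypothesis of Phragmen--Lindelof.\<close>
  have crude: "norm (L z) \<le> C1 * exp (pi/2 * Im z)" if z: "-16 \<le> Re z" "Re z \<le> 22" "1 \<le> Im z" for z
  proof -
    have ne: "z \<noteq> 1" using z by auto
    have u1: "norm (U lam ?b ?b z) \<le> K1 * exp (pi/2 * Im z)" using K1(2)[of z] z by simp
    have u2: "norm (U ?l ?b ?b (cnj z)) \<le> K2 * exp (pi/2 * Im z)" using K2(2)[of "cnj z"] z by simp
    have p: "norm (lam_ind lam * of_real ?b powr (1 - z) / (1 - z)) \<le> ?b powr (- 21)"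
    proof -
      have "norm (of_real ?b powr (1 - z)) = ?b powr (1 - Re z)"
        using half_alpha by (subst norm_powr_real_powr) auto
      also have "\<dots> \<le> ?b powr (- 21)" using half_alpha z by (intro powr_mono') auto
      finally have a: "norm (of_real ?b powr (1 - z)) \<le> ?b powr (- 21)" .
      have b: "norm (1 - z) \<ge> 1" using abs_Im_le_cmod[of "1 - z"] z by simp
      have "norm (lam_ind lam) * norm (of_real ?b powr (1 - z)) / norm (1 - z) \<le> 1 * ?b powr (- 21) / 1"
        using a b by (intro frac_le mult_mono) (auto simp: lam_ind_def)
      then show ?thesis by (simp add: norm_mult norm_divide)
    qed
    have "norm (L z) \<le> norm (\<i> * (U lam ?b ?b z - cnj (U ?l ?b ?b (cnj z)))) + norm (lam_ind lam * of_real ?b powr (1 - z) / (1 - z))"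
      unfolding L_eq_L0[OF ne] L0_def J_def norm_minus_cancel by (rule norm_triangle_ineq)
    also have "\<dots> \<le> (norm (U lam ?b ?b z) + norm (U ?l ?b ?b (cnj z))) + ?b powr (- 21)"
      using norm_triangle_ineq4[of "U lam ?b ?b z" "cnj (U ?l ?b ?b (cnj z))"] p by (simp add: norm_mult)
    also have "\<dots> \<le> (K1 * exp (pi/2 * Im z) + K2 * exp (pi/2 * Im z)) + ?b powr (- 21) * exp (pi/2 * Im z)"
      using u1 u2 z by (intro add_mono) (auto intro!: mult_le_cancel_left1[THEN iffD2])
    also have "\<dots> = C1 * exp (pi/2 * Im z)" by (simp add: C1_def algebra_simps)
    finally show ?thesis .
  qed
  have edges: "norm (L z) \<le> C2 * Im z ^ 17" if z: "Re z = -16 \<or> Re z = 22" "1 \<le> Im z" for z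
  proof (cases "Re z = 22")
    case True
    have "norm (L z) \<le> \<alpha> powr (- 22) * 2"
      unfolding L_right[of z, simplified True, simplified] norm_mult
      using dnorm_bounds(1)[OF \<alpha>, of z] True \<alpha> by (intro mult_mono) (auto simp: norm_powr_real_powr)
    also have "\<dots> \<le> C2 * 1" by (simp add: C2_def)
    also have "\<dots> \<le> C2 * Im z ^ 17"
    proof (rule mult_left_mono)
      show "C2 \<ge> 0" using \<alpha> by (simp add: C2_def le_max_iff_disj)
    qed (use z in \<open>simp add: one_le_power\<close>)
    finally show ?thesis .
  next
    case False
    then have re: "Re z = -16" using z by simp
    define u where "u = 1 - z"
    define t where "t = Im z"
    have t: "t \<ge> 1" using z by (simp add: t_def)
    have uc: "u = Complex (real 16 + 1) (- t)" by (simp add: u_def t_def complex_eq_iff re)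
    have ru: "Re u = 17" "Im u = - t" by (simp_all add: uc)
    have ne: "z \<noteq> 1" using z by auto
    have s: "Re z < -1" using re by simp
    have n2pi: "norm (of_real (2 * pi) powr (- u)) \<le> 1"
    proof -
      have "(2 * pi) powr (- 17) \<le> (2 * pi) powr 0" using pi_ge_two by (intro powr_mono) auto
      then show ?thesis using ru by (subst norm_powr_real_powr) auto
    qed
    have A: "norm (of_real \<mu> powr (- u) * dnorm \<theta> \<mu> u) \<le> \<mu> powr (- 17) * 2" if "0 < \<mu>" "\<mu> \<le> 1" for \<mu> \<theta>
      unfolding norm_mult using dnorm_bounds(1)[OF that, of u] ru that by (intro mult_mono) (auto simp: norm_powr_real_powr)
    define W1 where "W1 = of_real lam powr (- u) * dnorm (- \<alpha>) lam u"
    define W2 where "W2 = of_real ?l powr (- u) * dnorm \<alpha> ?l u"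
    have "norm (exp (\<i> * of_real pi * u / 2) * (ee (of_real (- \<alpha> * lam)) * W1) + exp (- (\<i> * of_real pi * u / 2)) * (ee (of_real (\<alpha> * ?l)) * W2))
       \<le> exp (pi * t / 2) * norm W1 + exp (- (pi * t / 2)) * norm W2"
      by (intro order_trans[OF norm_triangle_ineq] add_mono) (simp_all add: norm_mult norm_ee ru)
    also have "\<dots> \<le> exp (pi * t / 2) * (lam powr (- 17) * 2) + exp (pi * t / 2) * (?l powr (- 17) * 2)"
      using A[OF lam, of "- \<alpha>"] A[OF lam_dual_range, of \<alpha>] t by (intro add_mono mult_mono) (auto simp: W1_def W2_def)
    also have "\<dots> = exp (pi * t / 2) * (2 * lam powr (- 17) + 2 * ?l powr (- 17))" by (simp add: algebra_simps)
    finally have B: "norm (exp (\<i> * of_real pi * u / 2) * (ee (of_real (- \<alpha> * lam)) * W1) + exp (- (\<i> * of_real pi * u / 2)) * (ee (of_real (\<alpha> * ?l)) * W2))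
       \<le> exp (pi * t / 2) * (2 * lam powr (- 17) + 2 * ?l powr (- 17))" .
    have "L z = Gamma u * of_real (2 * pi) powr (- u) * (exp (\<i> * of_real pi * u / 2) * (ee (of_real (- \<alpha> * lam)) * W1) + exp (- (\<i> * of_real pi * u / 2)) * (ee (of_real (\<alpha> * ?l)) * W2))"
      unfolding L_eq_L0[OF ne] L0_def W1_def W2_def u_def by (rule lerch_functional_equation[OF lam \<alpha> s])
    then have "norm (L z) \<le> norm (Gamma u) * 1 * (exp (pi * t / 2) * (2 * lam powr (- 17) + 2 * ?l powr (- 17)))"
      by (simp only: norm_mult[of _ "exp _ * _ + _"] norm_mult[of "Gamma u"]) (intro mult_mono n2pi B order_refl mult_nonneg_nonneg norm_ge_zero zero_le_one)
    also have "\<dots> = (norm (Gamma u) * exp (pi * t / 2)) * (2 * lam powr (- 17) + 2 * ?l powr (- 17))" by simp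
    also have "\<dots> \<le> (4 * (real 16 + 1) ^ 16 * t ^ (16 + 1)) * (2 * lam powr (- 17) + 2 * ?l powr (- 17))"
      unfolding uc by (intro mult_right_mono norm_Gamma_exp_line t) simp
    also have "\<dots> = (4 * 17 ^ 16 * (2 * lam powr (- 17) + 2 * ?l powr (- 17))) * t ^ 17" by simp
    also have "\<dots> \<le> C2 * t ^ 17" using t by (intro mult_right_mono) (auto simp: C2_def)
    finally show ?thesis by (simp add: t_def)
  qed
  show ?thesis
    by (rule phragmen_lindelof_half_strip[OF hol _ crude edges, of "-16" 22]) (use that in auto)
qed

end

section \<open>Arguments on the vertical sides\<close>

text \<open>Since \<open>f' / f = l'\<close>, integration by parts gives the primitive
  \<open>(s - a) * l s - M s\<close>. A side is thus reduced to the values of \<open>l\<close> and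
  \<open>M\<close> at its ends.\<close>

lemma log_side_integral:
  fixes f l M :: "complex \<Rightarrow> complex"
  assumes S: "open S" and l: "l holomorphic_on S" and f: "\<And>s. s \<in> S \<Longrightarrow> f s = exp (l s)"
    and M: "\<And>s. s \<in> S \<Longrightarrow> (M has_field_derivative l s) (at s)" and seg: "closed_segment p q \<subseteq> S"
  shows "((\<lambda>s. (s - a) * (deriv f s / f s)) has_contour_integral (((q - a) * l q - M q) - ((p - a) * l p - M p))) (linepath p q)"
proof -
  have der: "((\<lambda>s. (s - a) * l s - M s) has_field_derivative (s - a) * (deriv f s / f s)) (at s within S)" if s: "s \<in> S" for s
  proof -
    have dl: "(l has_field_derivative deriv l s) (at s)" using l S s by (rule holomorphic_derivI)
    have "((\<lambda>s. exp (l s)) has_field_derivative exp (l s) * deriv l s) (at s)"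
      by (rule DERIV_chain2[OF DERIV_exp dl])
    then have "(f has_field_derivative exp (l s) * deriv l s) (at s)"
      by (rule has_field_derivative_transform_within_open[OF _ S s]) (simp add: f)
    then have e: "deriv f s / f s = deriv l s" using f[OF s] by (simp add: DERIV_imp_deriv)
    have d1: "((\<lambda>s. s - a) has_field_derivative 1) (at s)" by (auto intro!: derivative_eq_intros)
    have "((\<lambda>s. (s - a) * l s - M s) has_field_derivative ((s - a) * deriv l s + 1 * l s) - l s) (at s)"
      by (rule DERIV_diff[OF DERIV_mult'[OF d1 dl] M[OF s]])
    then show ?thesis unfolding e by (simp add: has_field_derivative_at_within)
  qed
  show ?thesis using contour_integral_primitive[of S, OF der, of "linepath p q"] seg by simp
qed

lemma Im_vertical_derivative:
  assumes "(f has_field_derivative d) (at (Complex x (- t)))"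
  shows "((\<lambda>t. Im (f (Complex x (- t)))) has_real_derivative - Re d) (at t)"
proof -
  have "((\<lambda>t. of_real x - \<i> * of_real t) has_vector_derivative - \<i>) (at t)"
    by (auto intro!: derivative_eq_intros has_vector_derivative_real_field)
  moreover have "(\<lambda>t. of_real x - \<i> * of_real t) = (\<lambda>t. Complex x (- t))" by (auto simp: complex_eq_iff)
  ultimately have "((\<lambda>t. Complex x (- t)) has_vector_derivative - \<i>) (at t)" by simp
  from field_vector_diff_chain_at[OF this assms]
  have "((\<lambda>t. f (Complex x (- t))) has_vector_derivative - \<i> * d) (at t)" by (simp add: o_def)
  from bounded_linear.has_vector_derivative[OF bounded_linear_Im this]
  show ?thesis by (simp add: has_real_derivative_iff_has_vector_derivative)
qed

lemma absorb_constant: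
  fixes x a b T :: real
  assumes "x \<le> a * ln T + b" "T \<ge> 2" "b \<ge> 0"
  shows "x \<le> (a + b / ln 2) * ln T"
proof -
  have "b / ln 2 * ln 2 \<le> b / ln 2 * ln T" using assms by (intro mult_left_mono) auto
  then show ?thesis using assms by (simp add: distrib_right)
qed

text \<open>In the derivative along the line, the weight \<open>5/2\<close> times
  \<open>Re Digamma\<close>, about \<open>5/2 * ln t\<close>, meets the \<open>5/2 * ln t\<close> in
  \<open>ln (norm (Gamma (3 - \<i> * t)))\<close> with opposite sign. Only the derivative of the
  stated main term and \<open>O(1 / t)\<close> remain.\<close>

lemma ln_Gamma_side:
  obtains N C t0 where "\<And>u. Re u > 0 \<Longrightarrow> (N has_field_derivative ln_Gamma u) (at u)" "C \<ge> 0" "t0 \<ge> (2::real)"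
    "\<And>T. T \<ge> t0 \<Longrightarrow> \<bar>- (5/2) * Im (ln_Gamma (Complex 3 (- T))) + Im (N (Complex 3 (- T))) - (pi * T\<^sup>2 / 4 - ln (2 * pi) / 2 * T)\<bar> \<le> C * ln T"
proof -
  let ?H = "{u::complex. Re u > 0}"
  have np: "u \<notin> \<real>\<^sub>\<le>\<^sub>0" if "Re u > 0" for u :: complex using that by (auto simp: complex_nonpos_Reals_iff)
  have dG: "(ln_Gamma has_field_derivative Digamma u) (at u)" if "Re u > 0" for u :: complex
    by (rule has_field_derivative_ln_Gamma_complex) (use np[OF that] in auto)
  have "ln_Gamma holomorphic_on ?H"
    unfolding holomorphic_on_def field_differentiable_def using dG has_field_derivative_at_within by blast
  then obtain N where N': "\<And>u. u \<in> ?H \<Longrightarrow> (N has_field_derivative ln_Gamma u) (at u within ?H)"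
    using holomorphic_convex_primitive'[OF convex_halfspace_Re_gt open_halfspace_Re_gt] by blast
  have N: "(N has_field_derivative ln_Gamma u) (at u)" if "Re u > 0" for u
    using N'[of u] that at_within_open[of u ?H] open_halfspace_Re_gt[of 0] by simp
  obtain K t1 where K: "\<And>t. t \<ge> t1 \<Longrightarrow> \<bar>ln (norm (Gamma (Complex 3 (- t)))) - (5/2 * ln t - pi * t / 2 + ln (2 * pi) / 2)\<bar> \<le> K * \<bar>1 / t\<bar>"
    using ln_norm_Gamma_3_line unfolding bigo_def eventually_at_top_linorder by auto
  define t0 where "t0 = max 2 t1"
  have t0: "t0 \<ge> 2" "t0 \<ge> t1" by (auto simp: t0_def)
  define F where "F t = - (5/2) * Im (ln_Gamma (Complex 3 (- t))) + Im (N (Complex 3 (- t))) - (pi * t\<^sup>2 / 4 - ln (2 * pi) / 2 * t)" for t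
  define F' where "F' t = - (5/2) * (- Re (Digamma (Complex 3 (- t)))) + (- Re (ln_Gamma (Complex 3 (- t)))) - (pi * t / 2 - ln (2 * pi) / 2)" for t
  have der: "(F has_real_derivative F' t) (at t)" for t
  proof -
    have 1: "((\<lambda>t. Im (ln_Gamma (Complex 3 (- t)))) has_real_derivative - Re (Digamma (Complex 3 (- t)))) (at t)"
      by (intro Im_vertical_derivative dG) simp
    have 2: "((\<lambda>t. Im (N (Complex 3 (- t)))) has_real_derivative - Re (ln_Gamma (Complex 3 (- t)))) (at t)"
      by (intro Im_vertical_derivative N) simp
    have 3: "((\<lambda>t. pi * t\<^sup>2 / 4 - ln (2 * pi) / 2 * t) has_real_derivative (pi * t / 2 - ln (2 * pi) / 2)) (at t)"
      by (auto intro!: derivative_eq_intros)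
    show ?thesis unfolding F_def F'_def by (intro DERIV_diff DERIV_add DERIV_cmult 1 2 3)
  qed
  have bnd: "\<bar>F' t\<bar> \<le> (\<bar>K\<bar> + 18) / t" if t: "t \<ge> t0" for t
  proof -
    have t1: "t \<ge> 1" "t \<ge> t1" using t t0 by auto
    have "Gamma (Complex 3 (- t)) = exp (ln_Gamma (Complex 3 (- t)))"
      using Complex_notin_nonpos_Ints[of 3 "- t"] by (simp add: Gamma_complex_altdef)
    then have "ln (norm (Gamma (Complex 3 (- t)))) = Re (ln_Gamma (Complex 3 (- t)))" by simp
    with K[OF t1(2)] have A: "\<bar>Re (ln_Gamma (Complex 3 (- t))) - (5/2 * ln t - pi * t / 2 + ln (2 * pi) / 2)\<bar> \<le> K * (1 / t)"
      using t1 by simp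
    have "K * (1 / t) \<le> \<bar>K\<bar> * (1 / t)" using t1 by (intro mult_right_mono) auto
    with A have A': "\<bar>Re (ln_Gamma (Complex 3 (- t))) - (5/2 * ln t - pi * t / 2 + ln (2 * pi) / 2)\<bar> \<le> \<bar>K\<bar> * (1 / t)"
      by (rule order_trans)
    \<comment> \<open>\<open>18\<close> rounds up \<open>5/2 * 7\<close>, with \<open>7\<close> from
      \<open>Re_Digamma_3_line\<close>.\<close>
    have ineq: "\<bar>5/2 * a - b\<bar> \<le> 18 * x + y" if "\<bar>a\<bar> \<le> 7 * x" "\<bar>b\<bar> \<le> y" "x \<ge> 0" for a b x y :: real
      using that by linarith
    have "\<bar>Re (Digamma (Complex 3 (- t))) - ln t\<bar> \<le> 7 * (1 / t)" "1 / t \<ge> 0"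
      using Re_Digamma_3_line[OF t1(1)] t1 by simp_all
    note ineq[OF this(1) A' this(2)]
    moreover have "F' t = 5/2 * (Re (Digamma (Complex 3 (- t))) - ln t) - (Re (ln_Gamma (Complex 3 (- t))) - (5/2 * ln t - pi * t / 2 + ln (2 * pi) / 2))"
      by (simp add: F'_def algebra_simps)
    ultimately have "\<bar>F' t\<bar> \<le> 18 * (1 / t) + \<bar>K\<bar> * (1 / t)" by (simp only:)
    then show ?thesis by (simp add: add_divide_distrib)
  qed
  have "\<bar>F T\<bar> \<le> ((\<bar>K\<bar> + 18) + \<bar>F t0\<bar> / ln 2) * ln T" if T: "T \<ge> t0" for T
  proof (rule absorb_constant)
    have "\<bar>F T - F t0\<bar> \<le> (\<bar>K\<bar> + 18) * ln T"
      by (rule log_growth_of_derivative_bound[OF der bnd _ T]) (use t0 in auto)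
    then show "\<bar>F T\<bar> \<le> (\<bar>K\<bar> + 18) * ln T + \<bar>F t0\<bar>" by linarith
  qed (use T t0 in auto)
  then show ?thesis using that[of N "(\<bar>K\<bar> + 18) + \<bar>F t0\<bar> / ln 2" t0] N t0 unfolding F_def by auto
qed

definition dlog :: "real \<Rightarrow> real \<Rightarrow> complex \<Rightarrow> complex" where
  "dlog \<theta> \<mu> u = Ln (dnorm \<theta> \<mu> u)"

lemma Re_dnorm_pos:
  assumes \<mu>: "0 < \<mu>" "\<mu> \<le> 1" and u: "Re u \<ge> 2"
  shows "Re (dnorm \<theta> \<mu> u) > 0"
proof -
  have "2 powr (2 - Re u) \<le> 2 powr 0" using u by (intro powr_mono) auto
  then have "norm (dtail \<theta> \<mu> u) \<le> 3/4" using norm_dtail_le[OF \<mu> u, of \<theta>] by simp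
  then show ?thesis using abs_Re_le_cmod[of "dtail \<theta> \<mu> u"] by (simp add: dnorm_def)
qed

lemma exp_dlog:
  assumes "0 < \<mu>" "\<mu> \<le> 1" "Re u \<ge> 2"
  shows "exp (dlog \<theta> \<mu> u) = dnorm \<theta> \<mu> u"
proof -
  have "dnorm \<theta> \<mu> u \<noteq> 0" using Re_dnorm_pos[OF assms, of \<theta>] by auto
  then show ?thesis by (simp add: dlog_def)
qed

lemma dlog_holomorphic:
  assumes \<mu>: "0 < \<mu>" "\<mu> \<le> 1"
  shows "dlog \<theta> \<mu> holomorphic_on {u. Re u > 2}"
  unfolding dlog_def
proof (rule holomorphic_on_Ln')
  show "dnorm \<theta> \<mu> holomorphic_on {u. Re u > 2}"
    by (rule holomorphic_on_subset[OF dnorm_holomorphic[OF \<mu>]]) auto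
  show "dnorm \<theta> \<mu> u \<notin> \<real>\<^sub>\<le>\<^sub>0" if "u \<in> {u. Re u > 2}" for u
    using Re_dnorm_pos[OF \<mu>, of u \<theta>] that by (auto simp: complex_nonpos_Reals_iff)
qed

lemma norm_dlog_le:
  assumes \<mu>: "0 < \<mu>" "\<mu> \<le> 1" and u: "Re u \<ge> 3"
  shows "norm (dlog \<theta> \<mu> u) \<le> 6 * 2 powr (- Re u)"
proof -
  have e: "2 powr (2 - Re u) = 4 * 2 powr (- Re u)" by (simp add: powr_diff powr_minus divide_inverse)
  have "norm (dtail \<theta> \<mu> u) \<le> 3/4 * 2 powr (2 - Re u)" using norm_dtail_le[OF \<mu>, of u \<theta>] u by simp
  then have t: "norm (dtail \<theta> \<mu> u) \<le> 3 * 2 powr (- Re u)" unfolding e by simp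
  have "2 powr (- Re u) \<le> 2 powr (-3)" using u by (intro powr_mono) auto
  then have "2 powr (- Re u) \<le> (1/8 :: real)" by (simp add: powr_minus)
  then have "norm (dtail \<theta> \<mu> u) < 1/2" using t by linarith
  from norm_Ln_le[OF this] show ?thesis using t by (simp add: dlog_def dnorm_def)
qed

text \<open>The primitive is compared along the line \<open>Re u = 3 + ln T / ln 2\<close>, where \<open>dlog\<close> is \<open>O(1 / T)\<close>.\<close>

lemma dlog_primitive:
  assumes \<mu>: "0 < \<mu>" "\<mu> \<le> 1"
  obtains G C where "\<And>u. Re u > 2 \<Longrightarrow> (G has_field_derivative dlog \<theta> \<mu> u) (at u)" "C \<ge> 0"
    "\<And>T x y. T \<ge> 2 \<Longrightarrow> \<bar>x\<bar> \<le> T \<Longrightarrow> \<bar>y\<bar> \<le> T \<Longrightarrow> norm (G (Complex 3 x) - G (Complex 3 y)) \<le> C * ln T"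
proof -
  let ?H = "{u::complex. Re u > 2}"
  obtain G where G': "\<And>u. u \<in> ?H \<Longrightarrow> (G has_field_derivative dlog \<theta> \<mu> u) (at u within ?H)"
    using holomorphic_convex_primitive'[OF convex_halfspace_Re_gt open_halfspace_Re_gt dlog_holomorphic[OF \<mu>]] by blast
  have G: "(G has_field_derivative dlog \<theta> \<mu> u) (at u)" if "Re u > 2" for u
    using G'[of u] that at_within_open[of u ?H] open_halfspace_Re_gt[of 2] by simp
  have bound: "norm (G v - G w) \<le> 6 * 2 powr (- X) * norm (v - w)" if X: "X \<ge> 3" "Re v \<ge> X" "Re w \<ge> X" for v w X
  proof (rule field_differentiable_bound[of "{u. Re u \<ge> X}" G "dlog \<theta> \<mu>"])
    show "convex {u. Re u \<ge> X}" by (rule convex_halfspace_Re_ge)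
    fix z assume "z \<in> {u. Re u \<ge> X}"
    then have z: "Re z \<ge> X" by simp
    show "(G has_field_derivative dlog \<theta> \<mu> z) (at z within {u. Re u \<ge> X})"
      by (rule has_field_derivative_at_within[OF G]) (use z X in simp)
    have "norm (dlog \<theta> \<mu> z) \<le> 6 * 2 powr (- Re z)" using z X by (intro norm_dlog_le \<mu>) simp
    also have "\<dots> \<le> 6 * 2 powr (- X)" using z by (intro mult_left_mono powr_mono) auto
    finally show "norm (dlog \<theta> \<mu> z) \<le> 6 * 2 powr (- X)" .
  qed (use X in auto)
  have "norm (G (Complex 3 x) - G (Complex 3 y)) \<le> 3 / ln 2 * ln T" if T: "T \<ge> 2" "\<bar>x\<bar> \<le> T" "\<bar>y\<bar> \<le> T" for T x y
  proof -
    define Y where "Y = ln T / ln 2"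
    have Y: "Y \<ge> 1" using T by (simp add: Y_def)
    \<comment> \<open>Each horizontal leg of the detour costs a multiple of its length
      \<open>Y = ln T / ln 2\<close>. The vertical leg has length at most \<open>2 * T\<close> and
      costs \<open>O(1)\<close>, since \<open>2 powr (- (3 + Y)) = 1 / (8 * T)\<close>.\<close>
    have hor: "norm (G (Complex (3 + Y) z) - G (Complex 3 z)) \<le> 3/4 * Y" for z
    proof -
      have "Complex (3 + Y) z - Complex 3 z = of_real Y" by (simp add: complex_eq_iff)
      moreover have "norm (G (Complex (3 + Y) z) - G (Complex 3 z)) \<le> 6 * 2 powr (- 3) * norm (Complex (3 + Y) z - Complex 3 z)"
        using Y by (intro bound) auto
      moreover have "6 * 2 powr (- 3) = (3/4 :: real)" by (simp add: powr_minus)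
      ultimately show ?thesis using Y by (simp only:) simp
    qed
    have "norm (G (Complex (3 + Y) x) - G (Complex (3 + Y) y)) \<le> 6 * 2 powr (- (3 + Y)) * norm (Complex (3 + Y) x - Complex (3 + Y) y)"
      using Y by (intro bound) auto
    also have "Complex (3 + Y) x - Complex (3 + Y) y = \<i> * of_real (x - y)" by (simp add: complex_eq_iff)
    also have "2 powr (- (3 + Y)) = 1 / (8 * T)"
    proof -
      have "2 powr Y = T" using T by (simp add: Y_def powr_def)
      then have "2 powr (3 + Y) = 8 * T" by (simp add: powr_add)
      then show ?thesis using powr_minus_divide[of 2 "3 + Y"] by simp
    qed
    also have "6 * (1 / (8 * T)) * norm (\<i> * of_real (x - y)) \<le> 6 * (1 / (8 * T)) * (2 * T)"
      using T unfolding norm_mult norm_of_real by (intro mult_left_mono) auto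
    also have "\<dots> = 3/2" using T by simp
    finally have ver: "norm (G (Complex (3 + Y) x) - G (Complex (3 + Y) y)) \<le> 3/2" .
    have "norm (G (Complex 3 x) - G (Complex 3 y)) \<le> norm (G (Complex (3 + Y) x) - G (Complex 3 x))
       + norm (G (Complex (3 + Y) x) - G (Complex (3 + Y) y)) + norm (G (Complex (3 + Y) y) - G (Complex 3 y))"
    proof -
      have "norm (a - b) \<le> norm (c - a) + norm (c - d) + norm (d - b)" for a b c d :: complex
        using norm_triangle_ineq[of "(a - c) + (c - d)" "d - b"] norm_triangle_ineq[of "a - c" "c - d"] norm_minus_commute[of a c] by simp
      then show ?thesis .
    qed
    also have "\<dots> \<le> 3/4 * Y + 3/2 + 3/4 * Y" by (intro add_mono hor ver)
    also have "\<dots> \<le> 3 * Y" using Y by simp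
    finally show ?thesis by (simp add: Y_def)
  qed
  then show ?thesis using that[of G "3 / ln 2"] G by simp
qed

context lerch_params begin

section \<open>Contributions of the two vertical sides\<close>

lemma right_side:
  obtains l M C where "l holomorphic_on {s. Re s > 2}" "\<And>s. Re s > 2 \<Longrightarrow> L s = exp (l s)"
    "\<And>s. Re s > 2 \<Longrightarrow> (M has_field_derivative l s) (at s)"
    "\<And>T. T \<ge> 2 \<Longrightarrow> \<bar>5/2 * Im (l (Complex 3 T)) - Im (M (Complex 3 T)) - T / 2 * ln \<alpha>\<bar> \<le> C * ln T"
proof -
  obtain G C where G: "\<And>u. Re u > 2 \<Longrightarrow> (G has_field_derivative dlog lam \<alpha> u) (at u)" and C: "C \<ge> 0"
    and GC: "\<And>T x y. T \<ge> 2 \<Longrightarrow> \<bar>x\<bar> \<le> T \<Longrightarrow> \<bar>y\<bar> \<le> T \<Longrightarrow> norm (G (Complex 3 x) - G (Complex 3 y)) \<le> C * ln T"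
    by (rule dlog_primitive[OF \<alpha>, of lam]) (rule that)
  define l where "l s = - s * of_real (ln \<alpha>) + dlog lam \<alpha> s" for s
  define M where "M s = - (s * s / 2) * of_real (ln \<alpha>) + G s" for s
  have hol: "l holomorphic_on {s. Re s > 2}"
    unfolding l_def by (intro holomorphic_intros dlog_holomorphic \<alpha>)
  have ex: "L s = exp (l s)" if "Re s > 2" for s
    using that \<alpha> exp_dlog[OF \<alpha>, of s lam] unfolding l_def exp_add by (simp add: L_right powr_def Ln_of_real)
  have der: "(M has_field_derivative l s) (at s)" if "Re s > 2" for s
    unfolding M_def l_def using that by (auto intro!: derivative_eq_intros G)
  define K where "K = norm (G (Complex 3 0))"
  have "\<bar>5/2 * Im (l (Complex 3 T)) - Im (M (Complex 3 T)) - T / 2 * ln \<alpha>\<bar> \<le> (C + (10 + K) / ln 2) * ln T" if T: "T \<ge> 2" for T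
  proof (rule absorb_constant)
    \<comment> \<open>The linear part of \<open>l\<close> gives
      \<open>- 5/2 * T * ln \<alpha>\<close>, and its primitive gives
      \<open>3 * T * ln \<alpha>\<close> because \<open>Im (s * s / 2) = 3 * T\<close>. The sum is
      the main term \<open>T / 2 * ln \<alpha>\<close>.\<close>
    have e: "5/2 * Im (l (Complex 3 T)) - Im (M (Complex 3 T)) - T / 2 * ln \<alpha> = 5/2 * Im (dlog lam \<alpha> (Complex 3 T)) - Im (G (Complex 3 T))"
      by (simp add: l_def M_def algebra_simps)
    have "dnorm lam \<alpha> (Complex 3 T) \<noteq> 0" using Re_dnorm_pos[OF \<alpha>, of "Complex 3 T" lam] by auto
    then have "\<bar>Im (dlog lam \<alpha> (Complex 3 T))\<bar> \<le> 4"
      using mpi_less_Im_Ln[of "dnorm lam \<alpha> (Complex 3 T)"] Im_Ln_le_pi[of "dnorm lam \<alpha> (Complex 3 T)"] pi_less_4 by (simp add: dlog_def abs_le_iff)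
    moreover have "norm (G (Complex 3 T)) \<le> C * ln T + K"
      using GC[of T T 0] T norm_triangle_ineq2[of "G (Complex 3 T)" "G (Complex 3 0)"] by (simp add: K_def)
    moreover have "\<bar>Im (G (Complex 3 T))\<bar> \<le> norm (G (Complex 3 T))" by (rule abs_Im_le_cmod)
    ultimately show "\<bar>5/2 * Im (l (Complex 3 T)) - Im (M (Complex 3 T)) - T / 2 * ln \<alpha>\<bar> \<le> C * ln T + (10 + K)"
      unfolding e by linarith
  qed (use T K_def in auto)
  then show ?thesis using that[OF hol ex der] by blast
qed

lemma dual_ratio_holomorphic: "dual_ratio holomorphic_on {u. Re u > 2}"
  unfolding dual_ratio_def
proof (intro holomorphic_intros)
  show "dnorm \<alpha> (lam_dual lam) holomorphic_on {u. Re u > 2}" "dnorm (- \<alpha>) lam holomorphic_on {u. Re u > 2}"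
    by (rule holomorphic_on_subset[OF dnorm_holomorphic]; use lam_dual_range lam in auto)+
  show "of_real lam powr (- u) * dnorm (- \<alpha>) lam u \<noteq> 0" if "u \<in> {u. Re u > 2}" for u
    using Re_dnorm_pos[OF lam, of u "- \<alpha>"] that lam by (auto simp: powr_def)
qed

lemma left_side:
  obtains l M C t0 where "t0 \<ge> 2" "l holomorphic_on {s. -3 < Re s \<and> Re s < -1 \<and> Im s > t0 - 1}"
    "\<And>s. -3 < Re s \<Longrightarrow> Re s < -1 \<Longrightarrow> Im s > t0 - 1 \<Longrightarrow> L s = exp (l s)"
    "\<And>s. -3 < Re s \<Longrightarrow> Re s < -1 \<Longrightarrow> Im s > t0 - 1 \<Longrightarrow> (M has_field_derivative l s) (at s)"
    "\<And>T. T \<ge> t0 \<Longrightarrow> \<bar>- (5/2) * Im (l (Complex (-2) T)) - Im (M (Complex (-2) T)) - T / 2 * ln lam\<bar> \<le> C * ln T"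
proof -
  obtain N1 C1 t1 where N1: "\<And>u. Re u > 0 \<Longrightarrow> (N1 has_field_derivative ln_Gamma u) (at u)" and C1: "C1 \<ge> 0" and t1: "t1 \<ge> 2"
    and B1: "\<And>T. T \<ge> t1 \<Longrightarrow> \<bar>- (5/2) * Im (ln_Gamma (Complex 3 (- T))) + Im (N1 (Complex 3 (- T))) - (pi * T\<^sup>2 / 4 - ln (2 * pi) / 2 * T)\<bar> \<le> C1 * ln T"
    by (rule ln_Gamma_side) (rule that)
  obtain G C2 where G: "\<And>u. Re u > 2 \<Longrightarrow> (G has_field_derivative dlog (- \<alpha>) lam u) (at u)" and C2: "C2 \<ge> 0"
    and GC: "\<And>T x y. T \<ge> 2 \<Longrightarrow> \<bar>x\<bar> \<le> T \<Longrightarrow> \<bar>y\<bar> \<le> T \<Longrightarrow> norm (G (Complex 3 x) - G (Complex 3 y)) \<le> C2 * ln T"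
    by (rule dlog_primitive[OF lam, of "- \<alpha>"]) (rule that)
  obtain C3 where C3: "C3 > 0" and sb: "\<And>u. 2 \<le> Re u \<Longrightarrow> Re u \<le> 4 \<Longrightarrow> norm (dual_ratio u) \<le> C3 * exp (pi * Im u)"
    by (rule dual_ratio_bound) (rule that)
  \<comment> \<open>Above this height
    \<open>C3 * exp (pi * Im u) \<le> C3 * exp (- (4 * C3)) \<le> 1/4\<close>, so
    \<open>1 + dual_ratio u\<close> stays in the right half-plane.\<close>
  define t0 where "t0 = t1 + 4 * C3"
  have t0: "t0 \<ge> 2" "t0 \<ge> t1" "t0 - 1 \<ge> 1 + 4 * C3" using t1 C3 by (auto simp: t0_def)
  define S where "S = {u. 2 < Re u} \<inter> {u. Re u < 4} \<inter> {u. Im u < - (t0 - 1)}"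
  have S: "open S" "convex S"
    unfolding S_def by (intro open_Int open_halfspace_Re_gt open_halfspace_Re_lt open_halfspace_Im_lt
        convex_Int convex_halfspace_Re_gt convex_halfspace_Re_lt convex_halfspace_Im_lt)+
  have small_q: "norm (dual_ratio u) \<le> 1/4" if u: "u \<in> S" for u
  proof -
    have "pi * Im u \<le> 1 * Im u" using u t0 C3 pi_ge_two by (intro mult_right_mono_neg) (auto simp: S_def)
    moreover have "Im u < - (t0 - 1)" using u by (simp add: S_def)
    ultimately have "pi * Im u \<le> - (4 * C3)" using t0 by linarith
    then have "exp (pi * Im u) \<le> exp (- (4 * C3))" by simp
    also have "\<dots> \<le> 1 / (4 * C3)"
    proof -
      have "4 * C3 \<le> exp (4 * C3)" using exp_ge_add_one_self[of "4 * C3"] by linarith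
      then show ?thesis using C3 by (simp add: exp_minus inverse_eq_divide frac_le)
    qed
    finally have "C3 * exp (pi * Im u) \<le> C3 * (1 / (4 * C3))" using C3 by (intro mult_left_mono) auto
    then show ?thesis using sb[of u] u C3 by (simp add: S_def)
  qed
  define W where "W u = Ln (1 + dual_ratio u)" for u
  have npW: "1 + dual_ratio u \<notin> \<real>\<^sub>\<le>\<^sub>0" if "u \<in> S" for u
    using small_q[OF that] abs_Re_le_cmod[of "dual_ratio u"] by (auto simp: complex_nonpos_Reals_iff)
  have holW: "W holomorphic_on S"
    unfolding W_def using npW
    by (intro holomorphic_on_Ln' holomorphic_intros holomorphic_on_subset[OF dual_ratio_holomorphic]) (auto simp: S_def)
  obtain W1 where W1': "\<And>u. u \<in> S \<Longrightarrow> (W1 has_field_derivative W u) (at u within S)"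
    by (rule holomorphic_convex_primitive'[OF S(2,1) holW]) (rule that)
  have W1: "(W1 has_field_derivative W u) (at u)" if "u \<in> S" for u
    using W1'[OF that] unfolding at_within_open[OF that S(1)] .
  have expW: "exp (W u) = 1 + dual_ratio u" if "u \<in> S" for u
  proof -
    have "1 + dual_ratio u \<noteq> 0" using npW[OF that] by (metis nonpos_Reals_zero_I)
    then show ?thesis by (simp add: W_def)
  qed
  define k where "k = complex_of_real (ln (2 * pi) + ln lam)"
  \<comment> \<open>Term by term a logarithm of the product in \<open>L_left\<close>, in the
    variable \<open>u = 1 - s\<close>; the constant \<open>k\<close> merges the powers of
    \<open>2 * pi\<close> and of \<open>lam\<close>.\<close>
  define l0 where "l0 u = ln_Gamma u - u * k + \<i> * of_real pi * u / 2 - 2 * of_real pi * \<i> * of_real (\<alpha> * lam) + dlog (- \<alpha>) lam u + W u" for u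
  define N where "N u = N1 u - u * u / 2 * k + \<i> * of_real pi * (u * u) / 4 - 2 * of_real pi * \<i> * of_real (\<alpha> * lam) * u + G u + W1 u" for u
  have dN: "(N has_field_derivative l0 u) (at u)" if "u \<in> S" for u
  proof -
    have "Re u > 0" "Re u > 2" using that by (auto simp: S_def)
    then show ?thesis unfolding N_def l0_def
      by (auto intro!: derivative_eq_intros N1 G W1 that simp: algebra_simps)
  qed
  have hol0: "l0 holomorphic_on S"
  proof -
    have g: "ln_Gamma holomorphic_on S"
      unfolding holomorphic_on_def field_differentiable_def
    proof
      fix u assume "u \<in> S"
      then have "u \<notin> \<real>\<^sub>\<le>\<^sub>0" by (auto simp: S_def complex_nonpos_Reals_iff)
      then show "\<exists>f'. (ln_Gamma has_field_derivative f') (at u within S)"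
        using has_field_derivative_ln_Gamma_complex[of u] has_field_derivative_at_within by blast
    qed
    have d: "dlog (- \<alpha>) lam holomorphic_on S"
      by (rule holomorphic_on_subset[OF dlog_holomorphic[OF lam]]) (auto simp: S_def)
    show ?thesis unfolding l0_def by (intro holomorphic_intros g d holW) auto
  qed
  define l where "l s = l0 (1 - s)" for s
  define M where "M s = - N (1 - s)" for s
  have inS: "1 - s \<in> S" if "-3 < Re s" "Re s < -1" "Im s > t0 - 1" for s
    using that by (auto simp: S_def)
  have hol: "l holomorphic_on {s. -3 < Re s \<and> Re s < -1 \<and> Im s > t0 - 1}"
    unfolding l_def by (intro holomorphic_on_compose_gen[OF _ hol0, unfolded o_def] holomorphic_intros) (use inS in auto)
  have ex: "L s = exp (l s)" if s: "-3 < Re s" "Re s < -1" "Im s > t0 - 1" for s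
  proof -
    define u where "u = 1 - s"
    have u: "u \<in> S" using inS[OF s] by (simp add: u_def)
    then have ru: "Re u \<ge> 2" by (simp add: S_def)
    have "u \<notin> \<int>\<^sub>\<le>\<^sub>0" using ru by (auto elim!: nonpos_Ints_cases)
    then have g: "exp (ln_Gamma u) = Gamma u" by (simp add: Gamma_complex_altdef)
    have p: "exp (- (u * k)) = of_real (2 * pi) powr (- u) * of_real lam powr (- u)"
      using lam by (simp add: k_def powr_def Ln_of_real exp_add[symmetric] algebra_simps del: of_real_mult of_real_add)
         (simp add: algebra_simps)
    have "exp (l s) = exp (ln_Gamma u) * exp (- (u * k)) * exp (\<i> * of_real pi * u / 2) * exp (- (2 * of_real pi * \<i> * of_real (\<alpha> * lam))) * exp (dlog (- \<alpha>) lam u) * exp (W u)"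
      unfolding l_def l0_def u_def[symmetric] by (simp only: exp_add diff_conv_add_uminus)
    also have "exp (- (2 * of_real pi * \<i> * of_real (\<alpha> * lam))) = ee (of_real (- \<alpha> * lam))"
      by (simp add: ee_def)
    finally have "exp (l s) = Gamma u * (of_real (2 * pi) powr (- u) * of_real lam powr (- u)) * exp (\<i> * of_real pi * u / 2) * ee (of_real (- \<alpha> * lam)) * dnorm (- \<alpha>) lam u * (1 + dual_ratio u)"
      unfolding g p expW[OF u] exp_dlog[OF lam ru] .
    then show ?thesis unfolding L_left[OF s(2)] u_def[symmetric] by (simp only: mult_ac)
  qed
  have der: "(M has_field_derivative l s) (at s)" if s: "-3 < Re s" "Re s < -1" "Im s > t0 - 1" for s
  proof -
    have "((\<lambda>s. N (1 - s)) has_field_derivative l0 (1 - s) * (- 1)) (at s)"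
      by (rule DERIV_chain2[where f = N and g = "\<lambda>s. 1 - s", OF dN[OF inS[OF s]]]) (auto intro!: derivative_eq_intros)
    from DERIV_minus[OF this] show ?thesis by (simp add: M_def[abs_def] l_def)
  qed
  have W_bound: "norm (W (Complex 3 (- t))) \<le> 2 * C3 * exp (- (pi * t))" if "t \<ge> t0" for t
  proof -
    have u: "Complex 3 (- t) \<in> S" using that by (auto simp: S_def)
    have "norm (dual_ratio (Complex 3 (- t))) < 1/2" using small_q[OF u] by simp
    from norm_Ln_le[OF this] sb[of "Complex 3 (- t)"] show ?thesis by (simp add: W_def)
  qed
  have W_bound': "norm (W (Complex 3 (- t))) \<le> 2 * C3 / t" if t: "t \<ge> t0" for t
  proof -
    have tp: "t > 0" using t t0 by simp
    have "t \<le> pi * t" using tp pi_ge_two by simp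
    then have "t \<le> exp (pi * t)" using exp_ge_add_one_self[of "pi * t"] by linarith
    then have "exp (- (pi * t)) \<le> 1 / t" using tp by (simp add: exp_minus field_simps)
    then have "2 * C3 * exp (- (pi * t)) \<le> 2 * C3 * (1 / t)" using C3 by (intro mult_left_mono) auto
    then show ?thesis using W_bound[OF t] by simp
  qed
  \<comment> \<open>On the line \<open>W\<close> is exponentially small; the weaker
    \<open>O(1 / t)\<close> already fits \<open>log_growth_of_derivative_bound\<close>.\<close>
  have W1_bound: "\<bar>Im (W1 (Complex 3 (- T))) - Im (W1 (Complex 3 (- t0)))\<bar> \<le> 2 * C3 * ln T" if T: "T \<ge> t0" for T
  proof (rule log_growth_of_derivative_bound[where F = "\<lambda>t. Im (W1 (Complex 3 (- t)))" and F' = "\<lambda>t. - Re (W (Complex 3 (- t)))"])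
    show "((\<lambda>t. Im (W1 (Complex 3 (- t)))) has_real_derivative - Re (W (Complex 3 (- t)))) (at t)" if "t0 \<le> t" for t
      by (intro Im_vertical_derivative W1) (use that in \<open>auto simp: S_def\<close>)
    show "\<bar>- Re (W (Complex 3 (- t)))\<bar> \<le> 2 * C3 / t" if "t0 \<le> t" for t
      using W_bound'[OF that] abs_Re_le_cmod[of "W (Complex 3 (- t))"] by simp
  qed (use T t0 in auto)
  define K where "K = norm (G (Complex 3 0)) + \<bar>Im (W1 (Complex 3 (- t0)))\<bar> + 10 + 5 * C3 + \<bar>pi * \<alpha> * lam + 3/2 * pi\<bar>"
  have "\<bar>- (5/2) * Im (l (Complex (-2) T)) - Im (M (Complex (-2) T)) - T / 2 * ln lam\<bar> \<le> ((C1 + C2 + 2 * C3) + K / ln 2) * ln T" if T: "T \<ge> t0" for T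
  proof (rule absorb_constant)
    let ?u = "Complex 3 (- T)"
    have c: "1 - Complex (-2) T = ?u" by (simp add: complex_eq_iff)
    \<comment> \<open>At \<open>u = 3 - \<i> * T\<close> the terms with \<open>k\<close> add up to
      \<open>T / 2 * k\<close>, and those with \<open>\<i> * pi * u / 2\<close> to
      \<open>- pi * T\<^sup>2 / 4 - 3/2 * pi\<close>. So \<open>T\<^sup>2\<close> and
      \<open>ln (2 * pi)\<close> occur with signs opposite to the main term of
      \<open>ln_Gamma_side\<close>, and \<open>T / 2 * ln lam\<close> is left.\<close>
    have e: "- (5/2) * Im (l (Complex (-2) T)) - Im (M (Complex (-2) T)) - T / 2 * ln lam =
       (- (5/2) * Im (ln_Gamma ?u) + Im (N1 ?u) - (pi * T\<^sup>2 / 4 - ln (2 * pi) / 2 * T))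
       - (pi * \<alpha> * lam + 3/2 * pi) - 5/2 * Im (dlog (- \<alpha>) lam ?u) + Im (G ?u) - 5/2 * Im (W ?u) + Im (W1 ?u)"
      unfolding l_def M_def c l0_def N_def k_def by (simp add: algebra_simps power2_eq_square add_divide_distrib diff_divide_distrib)
    have "dnorm (- \<alpha>) lam ?u \<noteq> 0" using Re_dnorm_pos[OF lam, of ?u "- \<alpha>"] by auto
    then have b1: "\<bar>Im (dlog (- \<alpha>) lam ?u)\<bar> \<le> 4"
      using mpi_less_Im_Ln[of "dnorm (- \<alpha>) lam ?u"] Im_Ln_le_pi[of "dnorm (- \<alpha>) lam ?u"] pi_less_4 by (simp add: dlog_def abs_le_iff)
    have T2: "T \<ge> 2" using T t0 by simp
    have b2: "\<bar>Im (G ?u)\<bar> \<le> C2 * ln T + norm (G (Complex 3 0))"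
      using GC[of T "- T" 0] T2 norm_triangle_ineq2[of "G ?u" "G (Complex 3 0)"] abs_Im_le_cmod[of "G ?u"] by simp
    have "2 * C3 / T \<le> 2 * C3 / 1" using T2 C3 by (intro divide_left_mono) auto
    then have b3: "\<bar>Im (W ?u)\<bar> \<le> 2 * C3" using W_bound'[OF T] abs_Im_le_cmod[of "W ?u"] by simp
    have b4: "\<bar>- (5/2) * Im (ln_Gamma ?u) + Im (N1 ?u) - (pi * T\<^sup>2 / 4 - ln (2 * pi) / 2 * T)\<bar> \<le> C1 * ln T"
      using T t0 by (intro B1) simp
    have ineq: "\<bar>A - B - 5/2 * c + d - 5/2 * f + g\<bar> \<le> a' + \<bar>B\<bar> + 10 + d' + 5 * C3 + g'"
      if "\<bar>A\<bar> \<le> a'" "\<bar>c\<bar> \<le> 4" "\<bar>d\<bar> \<le> d'" "\<bar>f\<bar> \<le> 2 * C3" "\<bar>g\<bar> \<le> g'" for A B c d f g a' d' g' :: real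
      using that by (simp add: abs_le_iff) linarith
    have b5: "\<bar>Im (W1 ?u)\<bar> \<le> 2 * C3 * ln T + \<bar>Im (W1 (Complex 3 (- t0)))\<bar>" using W1_bound[OF T] by linarith
    show "\<bar>- (5/2) * Im (l (Complex (-2) T)) - Im (M (Complex (-2) T)) - T / 2 * ln lam\<bar> \<le> (C1 + C2 + 2 * C3) * ln T + K"
      unfolding e by (rule order_trans[OF ineq[OF b4 b1 b2 b3 b5]]) (simp add: K_def algebra_simps)
  qed (use T t0 C3 in \<open>auto simp: K_def\<close>)
  then show ?thesis using that[OF t0(1) hol ex der] by blast
qed

end

section \<open>The argument principle\<close>

text \<open>Applied to heights of zeros, it places a horizontal edge strictly below the next zero,
  both at the bottom and at the top of the contour.\<close>

lemma exists_gap: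
  fixes A :: "real set"
  assumes "finite A"
  obtains t where "T < t" "t < T + 1" "\<And>a. a \<in> A \<Longrightarrow> T < a \<Longrightarrow> t < a"
proof -
  define B where "B = insert (T + 1) {a \<in> A. T < a}"
  have B: "finite B" "B \<noteq> {}" using assms by (auto simp: B_def)
  have "Min B > T" using B by (subst Min_gr_iff) (auto simp: B_def)
  moreover have "Min B \<le> T + 1" using B by (intro Min_le) (auto simp: B_def)
  moreover have "Min B \<le> a" if "a \<in> A" "T < a" for a using B that by (intro Min_le) (auto simp: B_def)
  ultimately show ?thesis using that[of "(T + Min B) / 2"] by force
qed

context lerch_params begin

text \<open>The open rectangle inside the contour is wider than the strip of nontrivial zeros; above
  a fixed height the two contain the same zeros.\<close>

definition Z :: "real \<Rightarrow> real \<Rightarrow> complex set" where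
  "Z t T = {\<rho>. L \<rho> = 0 \<and> -2 < Re \<rho> \<and> Re \<rho> < 3 \<and> t < Im \<rho> \<and> Im \<rho> < T}"

lemma L_holomorphic_upper: "L holomorphic_on {z. Im z > 0}"
  by (rule holomorphic_on_subset[OF L_holomorphic]) auto

text \<open>The entire function \<open>(s - 1) * L s\<close> also controls zeros accumulating at \<open>1\<close>.\<close>

lemma finite_zeros:
  "finite {z. z \<noteq> 1 \<and> L z = 0 \<and> a \<le> Re z \<and> Re z \<le> b \<and> t \<le> Im z \<and> Im z \<le> T}"
proof -
  define E where "E s = (1 - s) * (\<i> * (U lam (\<alpha>/2) (\<alpha>/2) s - cnj (U (lam_dual lam) (\<alpha>/2) (\<alpha>/2) (cnj s))))
    + lam_ind lam * of_real (\<alpha>/2) powr (1 - s)" for s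
  have hol: "E holomorphic_on UNIV"
    unfolding E_def
  proof (rule holomorphic_on_add[OF holomorphic_on_mult[OF _ U_parts_holomorphic]])
    show "(\<lambda>s. lam_ind lam * of_real (\<alpha>/2) powr (1 - s)) holomorphic_on UNIV"
      using half_alpha by (intro holomorphic_intros)
  qed (intro holomorphic_intros)
  have E: "E s = - (1 - s) * L s" if "s \<noteq> 1" for s
    using that by (simp add: E_def L_eq_L0 L0_def J_def field_simps)
  have E3: "E 3 \<noteq> 0" using L_nonzero_right[of 3] \<alpha> by (simp add: E)
  let ?S = "{z. z \<noteq> 1 \<and> L z = 0 \<and> a \<le> Re z \<and> Re z \<le> b \<and> t \<le> Im z \<and> Im z \<le> T}"
  have sub: "?S \<subseteq> {z \<in> cbox (Complex a t) (Complex b T). E z = 0}"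
    by (auto simp: E in_cbox_complex_iff)
  show ?thesis
  proof (cases "E constant_on UNIV")
    case True
    then have "E z \<noteq> 0" for z using E3 by (auto simp: constant_on_def)
    then have "?S = {}" using sub by blast
    then show ?thesis by (simp only: finite.emptyI)
  next
    case False
    have "finite {z \<in> cbox (Complex a t) (Complex b T). E z = 0}"
      by (rule holomorphic_compact_finite_zeros[OF hol _ _ _ _ False]) auto
    then show ?thesis using sub finite_subset by blast
  qed
qed

lemma rectangle_zero_sum:
  assumes t: "0 < t" "t < T"
    and nb: "\<And>z. L z = 0 \<Longrightarrow> -2 \<le> Re z \<Longrightarrow> Re z \<le> 3 \<Longrightarrow> t \<le> Im z \<Longrightarrow> Im z \<le> T \<Longrightarrow> z \<in> Z t T"
  shows "contour_integral (rectpath (Complex (-2) t) (Complex 3 T)) (\<lambda>s. (s - 1/2) * (deriv L s / L s)) =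
    2 * pi * \<i> * (\<Sum>\<rho>\<in>Z t T. (\<rho> - 1/2) * of_int (zorder L \<rho>))"
proof -
  let ?g = "rectpath (Complex (-2) t) (Complex 3 T)"
  let ?C = "cbox (Complex (-2) t) (Complex 3 T)"
  \<comment> \<open>An open rectangle slightly larger than the contour; \<open>Im z > t / 2\<close>
    keeps it away from the possible pole at \<open>1\<close>.\<close>
  define S where "S = {z. Re z > -3} \<inter> {z. Re z < 4} \<inter> {z. Im z > t / 2} \<inter> {z. Im z < T + 1}"
  define pz where "pz = {w \<in> S. L w = 0 \<or> w \<in> {}}"
  have S: "open S" "convex S"
    unfolding S_def by (intro open_Int open_halfspace_Re_gt open_halfspace_Re_lt open_halfspace_Im_gt open_halfspace_Im_lt
        convex_Int convex_halfspace_Re_gt convex_halfspace_Re_lt convex_halfspace_Im_gt convex_halfspace_Im_lt)+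
  have CS: "?C \<subseteq> S" using t by (auto simp: S_def in_cbox_complex_iff)
  have img: "path_image ?g = ?C - box (Complex (-2) t) (Complex 3 T)"
    using t by (intro path_image_rectpath_cbox_minus_box) auto
  have fin: "finite pz"
    by (rule finite_subset[OF _ finite_zeros[of "-3" 4 "t/2" "T + 1"]]) (use t in \<open>auto simp: pz_def S_def\<close>)
  have Zpz: "Z t T \<subseteq> pz" using t by (auto simp: Z_def pz_def S_def)
  have C_pz: "p \<in> Z t T" if "p \<in> pz" "p \<in> ?C" for p
    using nb[of p] that by (auto simp: pz_def in_cbox_complex_iff)
  have Zbox: "p \<in> box (Complex (-2) t) (Complex 3 T)" if "p \<in> Z t T" for p
    using that by (auto simp: Z_def in_box_complex_iff)
  have w0: "winding_number ?g z = 0" if "z \<notin> ?C" for z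
    using t that by (intro winding_number_rectpath_outside) auto
  have "contour_integral ?g (\<lambda>x. deriv L x * (x - 1/2) / L x) = 2 * pi * \<i> *
          (\<Sum>p\<in>pz. winding_number ?g p * (p - 1/2) * zorder L p)"
    unfolding pz_def
  proof (rule argument_principle)
    show "connected S" using S(2) by (rule convex_connected)
    show "L holomorphic_on S - {}"
      by (rule holomorphic_on_subset[OF L_holomorphic_upper]) (use t in \<open>auto simp: S_def\<close>)
    show "(\<lambda>s. s - 1/2) holomorphic_on S" by (intro holomorphic_intros)
    show "path_image ?g \<subseteq> S - {w \<in> S. L w = 0 \<or> w \<in> {}}"
      using CS C_pz Zbox unfolding img pz_def by blast
    show "\<forall>z. z \<notin> S \<longrightarrow> winding_number ?g z = 0" using w0 CS by blast
    show "finite {w \<in> S. L w = 0 \<or> w \<in> {}}" using fin by (simp add: pz_def)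
  qed (use S in auto)
  \<comment> \<open>Zeros in the margin between the contour and \<open>S\<close> have winding number
    0 and drop out.\<close>
  also have "(\<Sum>p\<in>pz. winding_number ?g p * (p - 1/2) * zorder L p) = (\<Sum>p\<in>Z t T. (p - 1/2) * of_int (zorder L p))"
  proof (rule sum.mono_neutral_cong_right[OF fin Zpz])
    show "\<forall>p\<in>pz - Z t T. winding_number ?g p * (p - 1/2) * zorder L p = 0"
      using C_pz w0 by auto
    show "winding_number ?g p * (p - 1/2) * zorder L p = (p - 1/2) * of_int (zorder L p)" if "p \<in> Z t T" for p
      using winding_number_rectpath[OF Zbox[OF that]] by simp
  qed
  finally show ?thesis by (simp add: mult.commute)
qed

text \<open>The estimate is proved for heights that carry no zero. The second claim is exported to
  identify \<open>Z\<close> with the nontrivial zeros: on the left the functional equation writes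
  \<open>L\<close> as an exponential above \<open>t1\<close>.\<close>

lemma zero_sum_estimate:
  obtains t1 C where "t1 > 0"
    "\<And>z. L z = 0 \<Longrightarrow> -2 \<le> Re z \<Longrightarrow> Re z < -1 \<Longrightarrow> Im z \<le> t1"
    "\<And>T. T \<ge> t1 + 22 \<Longrightarrow> (\<forall>z. L z = 0 \<longrightarrow> -2 \<le> Re z \<longrightarrow> Re z \<le> 3 \<longrightarrow> Im z \<noteq> T) \<Longrightarrow>
       \<bar>(\<Sum>\<rho>\<in>Z t1 T. of_int (zorder L \<rho>) * (Re \<rho> - 1/2)) - T / (4 * pi) * ln (\<alpha> / lam)\<bar> \<le> C * ln T"
proof -
  obtain lR NR CR where R: "lR holomorphic_on {s. Re s > 2}" "\<And>s. Re s > 2 \<Longrightarrow> L s = exp (lR s)"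
    "\<And>s. Re s > 2 \<Longrightarrow> (NR has_field_derivative lR s) (at s)"
    and RT: "\<And>T. T \<ge> 2 \<Longrightarrow> \<bar>5/2 * Im (lR (Complex 3 T)) - Im (NR (Complex 3 T)) - T / 2 * ln \<alpha>\<bar> \<le> CR * ln T"
    by (rule right_side) (rule that)
  obtain lL NL CL t0 where t0: "t0 \<ge> 2" and Lf: "lL holomorphic_on {s. -3 < Re s \<and> Re s < -1 \<and> Im s > t0 - 1}"
    "\<And>s. -3 < Re s \<Longrightarrow> Re s < -1 \<Longrightarrow> Im s > t0 - 1 \<Longrightarrow> L s = exp (lL s)"
    "\<And>s. -3 < Re s \<Longrightarrow> Re s < -1 \<Longrightarrow> Im s > t0 - 1 \<Longrightarrow> (NL has_field_derivative lL s) (at s)"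
    and LT: "\<And>T. T \<ge> t0 \<Longrightarrow> \<bar>- (5/2) * Im (lL (Complex (-2) T)) - Im (NL (Complex (-2) T)) - T / 2 * ln lam\<bar> \<le> CL * ln T"
    by (rule left_side) (rule that)
  obtain CG where CG: "CG > 0" "\<And>z. -16 \<le> Re z \<Longrightarrow> Re z \<le> 22 \<Longrightarrow> 1 \<le> Im z \<Longrightarrow> norm (L z) \<le> CG * norm z ^ 17"
    by (rule L_growth) (rule that)
  obtain t1 where t1: "t0 < t1" "t1 < t0 + 1"
    "\<And>a. a \<in> Im ` {z. z \<noteq> 1 \<and> L z = 0 \<and> -2 \<le> Re z \<and> Re z \<le> 3 \<and> t0 \<le> Im z \<and> Im z \<le> t0 + 1} \<Longrightarrow> t0 < a \<Longrightarrow> t1 < a"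
    by (rule exists_gap[OF finite_imageI[OF finite_zeros]]) (rule that)
  have no_t1: "Im z \<noteq> t1" if "L z = 0" "-2 \<le> Re z" "Re z \<le> 3" for z
  proof
    assume "Im z = t1"
    then have "t1 \<in> Im ` {z. z \<noteq> 1 \<and> L z = 0 \<and> -2 \<le> Re z \<and> Re z \<le> 3 \<and> t0 \<le> Im z \<and> Im z \<le> t0 + 1}"
      using that t1 t0 by (intro image_eqI[of _ _ z]) auto
    from t1(3)[OF this t1(1)] show False by simp
  qed
  have no_left: "Im z \<le> t1" if "L z = 0" "-2 \<le> Re z" "Re z < -1" for z
    using Lf(2)[of z] that t1 by force
  define f where "f s = (s - 1/2) * (deriv L s / L s)" for s
  \<comment> \<open>Everything that depends on the fixed lower edge alone: the bottom side and the
    lower boundary terms of the two vertical sides.\<close>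
  define c0 where "c0 = Im (contour_integral (linepath (Complex (-2) t1) (Complex 3 t1)) f)
     - Im ((Complex 3 t1 - 1/2) * lR (Complex 3 t1) - NR (Complex 3 t1))
     + Im ((Complex (-2) t1 - 1/2) * lL (Complex (-2) t1) - NL (Complex (-2) t1))"
  define c1 where "c1 = \<bar>c0\<bar> + 600 * (\<bar>ln (4 * CG * 2 ^ 17)\<bar> + 1)"
  \<comment> \<open>\<open>10200 = 600 * 17\<close>: the constant of the horizontal estimate times
    the growth exponent of \<open>L\<close>.\<close>
  define C where "C = CR + CL + 10200 + c1 / ln 2"
  have main: "\<bar>(\<Sum>\<rho>\<in>Z t1 T. of_int (zorder L \<rho>) * (Re \<rho> - 1/2)) - T / (4 * pi) * ln (\<alpha> / lam)\<bar> \<le> C * ln T"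
    if T: "T \<ge> t1 + 22" and noT': "\<forall>z. L z = 0 \<longrightarrow> -2 \<le> Re z \<longrightarrow> Re z \<le> 3 \<longrightarrow> Im z \<noteq> T" for T
  proof -
    have noT: "Im z \<noteq> T" if "L z = 0" "-2 \<le> Re z" "Re z \<le> 3" for z using noT' that by blast
    let ?c = "Complex 3 T" and ?d = "Complex (-2) T"
    let ?g = "rectpath (Complex (-2) t1) (Complex 3 T)"
    have T2: "T \<ge> 22" "T \<ge> t0" "T \<ge> 2" "t1 < T" "t1 > 0" using T t1 t0 by auto
    have nb: "z \<in> Z t1 T" if z: "L z = 0" "-2 \<le> Re z" "Re z \<le> 3" "t1 \<le> Im z" "Im z \<le> T" for z
    proof -
      have "Re z \<noteq> -2"
      proof
        assume "Re z = -2"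
        then have "L z = exp (lL z)" using z t1 by (intro Lf(2)) auto
        then show False using z by simp
      qed
      moreover have "Re z \<noteq> 3" using L_nonzero_right[of z] z \<alpha> by auto
      ultimately show ?thesis using z noT[of z] no_t1[of z] by (simp add: Z_def)
    qed
    have img: "path_image ?g = cbox (Complex (-2) t1) ?c - box (Complex (-2) t1) ?c"
      using T2 by (intro path_image_rectpath_cbox_minus_box) auto
    have nz: "L z \<noteq> 0 \<and> Im z > 0" if "z \<in> path_image ?g" for z
    proof
      show "Im z > 0" using that t1 t0 unfolding img by (auto simp: in_cbox_complex_iff)
      show "L z \<noteq> 0"
      proof
        assume "L z = 0"
        then have "z \<in> Z t1 T" using that unfolding img by (intro nb) (auto simp: in_cbox_complex_iff)
        then show False using that unfolding img by (auto simp: Z_def in_box_complex_iff)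
      qed
    qed
    have op: "open {z. Im z > 0}" by (rule open_halfspace_Im_gt)
    have cL: "continuous_on {z. Im z > 0} L" "continuous_on {z. Im z > 0} (deriv L)"
      using L_holomorphic_upper op by (auto intro!: holomorphic_on_imp_continuous_on holomorphic_deriv)
    have contf: "continuous_on A f" "continuous_on A (\<lambda>s. deriv L s / L s)" if "\<And>z. z \<in> A \<Longrightarrow> L z \<noteq> 0 \<and> Im z > 0" for A
      unfolding f_def using that
      by (auto intro!: continuous_intros continuous_on_subset[OF cL(1)] continuous_on_subset[OF cL(2)])
    define I where "I = contour_integral ?g f"
    define S where "S = (\<Sum>\<rho>\<in>Z t1 T. of_int (zorder L \<rho>) * (Re \<rho> - 1/2))"
    have "I = 2 * pi * \<i> * (\<Sum>\<rho>\<in>Z t1 T. (\<rho> - 1/2) * of_int (zorder L \<rho>))"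
      unfolding I_def f_def by (rule rectangle_zero_sum) (use T2 nb in auto)
    then have "Im I = 2 * pi * Re (\<Sum>\<rho>\<in>Z t1 T. (\<rho> - 1/2) * of_int (zorder L \<rho>))" by simp
    also have "Re (\<Sum>\<rho>\<in>Z t1 T. (\<rho> - 1/2) * of_int (zorder L \<rho>)) = S"
      unfolding S_def Re_sum by (intro sum.cong) (auto simp: mult.commute)
    finally have ImI: "Im I = 2 * pi * S" .
    have I4: "I = contour_integral (linepath (Complex (-2) t1) (Complex 3 t1)) f
       + contour_integral (linepath (Complex 3 t1) ?c) f - contour_integral (linepath ?d ?c) f
       - contour_integral (linepath (Complex (-2) t1) ?d) f"
      unfolding I_def by (rule contour_integral_rectpath) (rule contf(1)[OF nz])
    have right: "contour_integral (linepath (Complex 3 t1) ?c) f =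
       ((?c - 1/2) * lR ?c - NR ?c) - ((Complex 3 t1 - 1/2) * lR (Complex 3 t1) - NR (Complex 3 t1))"
      unfolding f_def
    proof (rule contour_integral_unique[OF log_side_integral[of "{s. Re s > 2}"]])
      show "open {s. Re s > (2::real)}" by (rule open_halfspace_Re_gt)
      show "closed_segment (Complex 3 t1) ?c \<subseteq> {s. Re s > 2}" by (auto simp: closed_segment_same_Re)
    qed (use R in auto)
    have left: "contour_integral (linepath (Complex (-2) t1) ?d) f =
       ((?d - 1/2) * lL ?d - NL ?d) - ((Complex (-2) t1 - 1/2) * lL (Complex (-2) t1) - NL (Complex (-2) t1))"
      unfolding f_def
    proof (rule contour_integral_unique[OF log_side_integral[of "{s. -3 < Re s \<and> Re s < -1 \<and> Im s > t0 - 1}"]])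
      have "{s. -3 < Re s \<and> Re s < -1 \<and> Im s > t0 - 1} = {s. Re s > -3} \<inter> {s. Re s < -1} \<inter> {s. Im s > t0 - 1}" by auto
      then show "open {s. -3 < Re s \<and> Re s < -1 \<and> Im s > t0 - 1}"
        by (simp add: open_Int open_halfspace_Re_gt open_halfspace_Re_lt open_halfspace_Im_gt)
      show "closed_segment (Complex (-2) t1) ?d \<subseteq> {s. -3 < Re s \<and> Re s < -1 \<and> Im s > t0 - 1}"
        using T2 t1 by (auto simp: closed_segment_same_Re closed_segment_eq_real_ivl)
    qed (use Lf in auto)
    have cd: "?c - 5 = ?d" "?c - 5/2 = Complex (1/2) T" by (simp_all add: complex_eq_iff)
    have seg: "-2 \<le> Re z \<and> Re z \<le> 3 \<and> Im z = T" if "z \<in> closed_segment ?d ?c" for z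
      using that by (auto simp: closed_segment_same_Im closed_segment_eq_real_ivl)
    have nzt: "L z \<noteq> 0 \<and> Im z > 0" if "z \<in> closed_segment ?d ?c" for z
      using noT[of z] seg[OF that] T2 by auto
    \<comment> \<open>\<open>T \<ge> t1 + 22\<close> serves twice: it keeps the disc above height 1,
      and it gives \<open>norm z \<le> 19 + 3 + T \<le> 2 * T\<close>.\<close>
    have ball: "-16 \<le> Re z \<and> Re z \<le> 22 \<and> 1 \<le> Im z \<and> norm z \<le> 2 * T" if z: "z \<in> ball ?c 19" for z
    proof -
      have n: "norm (z - ?c) < 19" using z by (simp add: dist_norm norm_minus_commute)
      have "\<bar>Re z - 3\<bar> < 19" "\<bar>Im z - T\<bar> < 19"
        using abs_Re_le_cmod[of "z - ?c"] abs_Im_le_cmod[of "z - ?c"] n by auto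
      moreover have "norm z \<le> norm (z - ?c) + norm ?c" using norm_triangle_ineq[of "z - ?c" ?c] by simp
      moreover have "norm ?c \<le> 3 + T" using cmod_le[of ?c] T2 by simp
      moreover have "norm z \<le> 2 * T"
      proof -
        have "norm z \<le> T + 22" using calculation(3,4) n by linarith
        then show ?thesis using T2 by linarith
      qed
      ultimately show ?thesis using T2 by auto
    qed
    define M where "M = CG * (2 * T) ^ 17"
    have Mb: "norm (L z) \<le> M" if "z \<in> ball ?c 19" for z
    proof -
      have "norm (L z) \<le> CG * norm z ^ 17" using ball[OF that] by (intro CG(2)) auto
      also have "\<dots> \<le> CG * (2 * T) ^ 17" using ball[OF that] CG(1) by (intro mult_left_mono power_mono) auto
      finally show ?thesis by (simp add: M_def)
    qed
    have holb: "L holomorphic_on ball ?c 19"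
      by (rule holomorphic_on_subset[OF L_holomorphic_upper]) (use ball in force)
    note hz = horizontal_log_derivative[OF holb Mb, unfolded cd]
    define I1 where "I1 = contour_integral (linepath ?d ?c) (\<lambda>z. deriv L z / L z)"
    define I2 where "I2 = contour_integral (linepath ?d ?c) (\<lambda>z. (z - Complex (1/2) T) * (deriv L z / L z))"
    have hz1: "Re I1 = ln (norm (L ?c)) - ln (norm (L ?d))" unfolding I1_def by (rule hz(1)) (use nzt in auto)
    have hz2: "\<bar>Im I2\<bar> \<le> 600 * (ln (M / norm (L ?c)) + 1)" unfolding I2_def by (rule hz(2)) (use nzt in auto)
    \<comment> \<open>The midpoint of the top side is \<open>1/2 + \<i> * T\<close>, so the weight
      splits into a real part centred there and the constant \<open>\<i> * T\<close>.\<close>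
    have top: "contour_integral (linepath ?d ?c) f = I2 + \<i> * of_real T * I1"
    proof -
      have i1: "(\<lambda>z. deriv L z / L z) contour_integrable_on linepath ?d ?c"
        by (intro contour_integrable_continuous_linepath contf(2) nzt)
      have i2: "(\<lambda>z. (z - Complex (1/2) T) * (deriv L z / L z)) contour_integrable_on linepath ?d ?c"
        by (intro contour_integrable_continuous_linepath continuous_intros contf(2) nzt)
      have "f = (\<lambda>z. (z - Complex (1/2) T) * (deriv L z / L z) + \<i> * of_real T * (deriv L z / L z))"
      proof
        fix z
        have "z - 1/2 = (z - Complex (1/2) T) + \<i> * of_real T" by (simp add: complex_eq_iff)
        then show "f z = (z - Complex (1/2) T) * (deriv L z / L z) + \<i> * of_real T * (deriv L z / L z)"
          unfolding f_def by (simp only: distrib_right)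
      qed
      then show ?thesis
        unfolding I1_def I2_def using i1 i2
        by (simp only: contour_integral_add contour_integrable_lmul contour_integral_lmul)
    qed
    have reR: "Re (lR ?c) = ln (norm (L ?c))" using R(2)[of ?c] by simp
    have reL: "Re (lL ?d) = ln (norm (L ?d))" using Lf(2)[of ?d] T2 by simp
    define AR where "AR = 5/2 * Im (lR ?c) - Im (NR ?c)"
    define AL where "AL = - (5/2) * Im (lL ?d) - Im (NL ?d)"
    have imR: "Im ((?c - 1/2) * lR ?c - NR ?c) = AR + T * ln (norm (L ?c))"
      by (simp add: AR_def reR[symmetric])
    have imL: "Im ((?d - 1/2) * lL ?d - NL ?d) = AL + T * ln (norm (L ?d))"
      by (simp add: AL_def reL[symmetric])
    have imT: "Im (I2 + \<i> * of_real T * I1) = Im I2 + T * (ln (norm (L ?c)) - ln (norm (L ?d)))"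
      by (simp add: hz1[symmetric])
    \<comment> \<open>The multiples \<open>T * ln (norm (L s))\<close> at the two upper corners,
      from the vertical sides and from \<open>\<i> * T * I1\<close>, cancel.\<close>
    have "Im I = c0 + AR - AL - Im I2"
      unfolding I4 right left top minus_complex.sel plus_complex.sel(2)[of "contour_integral _ _"]
      unfolding c0_def imR[unfolded minus_complex.sel] imL[unfolded minus_complex.sel] imT
      by (simp add: imR[unfolded minus_complex.sel] imL[unfolded minus_complex.sel] imT algebra_simps)
    then have S2: "2 * pi * S = c0 + AR - AL - Im I2" using ImI by simp
    have Lc: "norm (L ?c) \<ge> 1/4"
    proof -
      have "\<alpha> powr 0 \<le> \<alpha> powr (-3)" using \<alpha> by (intro powr_mono') auto
      then have "1 \<le> norm (of_real \<alpha> powr (- ?c))" using \<alpha> by (subst norm_powr_real_powr) auto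
      then have "1 * (1/4) \<le> norm (of_real \<alpha> powr (- ?c)) * norm (dnorm lam \<alpha> ?c)"
        using dnorm_bounds(2)[OF \<alpha>, of ?c lam] by (intro mult_mono) auto
      then show ?thesis by (simp add: L_right norm_mult)
    qed
    have lnM: "ln (M / norm (L ?c)) \<le> \<bar>ln (4 * CG * 2 ^ 17)\<bar> + 17 * ln T"
    proof -
      have Mpos: "M > 0" using CG(1) T2 by (simp add: M_def)
      have "M / norm (L ?c) \<le> M / (1/4)" using Lc Mpos by (intro divide_left_mono) auto
      also have "\<dots> = (4 * CG * 2 ^ 17) * T ^ 17" by (simp add: M_def power_mult_distrib)
      finally have "ln (M / norm (L ?c)) \<le> ln ((4 * CG * 2 ^ 17) * T ^ 17)"
        using Mpos Lc by (intro ln_mono divide_pos_pos) linarith+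
      also have "\<dots> = ln (4 * CG * 2 ^ 17) + ln (T ^ 17)" using CG(1) T2 by (intro ln_mult_pos) auto
      also have "ln (T ^ 17) = 17 * ln T" using T2 by (simp add: ln_realpow)
      finally show ?thesis by linarith
    qed
    have lnr: "ln (\<alpha> / lam) = ln \<alpha> - ln lam" using \<alpha> lam by (simp add: ln_div)
    have aR: "\<bar>AR - T / 2 * ln \<alpha>\<bar> \<le> CR * ln T" unfolding AR_def by (rule RT) (rule T2)
    have aL: "\<bar>AL - T / 2 * ln lam\<bar> \<le> CL * ln T" unfolding AL_def by (rule LT) (rule T2)
    have "\<bar>2 * pi * S - T / 2 * ln (\<alpha> / lam)\<bar> \<le> (CR + CL + 10200) * ln T + c1"
    proof -
      have "2 * pi * S - T / 2 * ln (\<alpha> / lam) = c0 + (AR - T / 2 * ln \<alpha>) - (AL - T / 2 * ln lam) - Im I2"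
        unfolding S2 lnr by (simp add: field_simps)
      also have "\<bar>\<dots>\<bar> \<le> \<bar>c0\<bar> + CR * ln T + CL * ln T + 600 * ((\<bar>ln (4 * CG * 2 ^ 17)\<bar> + 17 * ln T) + 1)"
      proof -
        have "\<bar>c0 + a - b - i\<bar> \<le> \<bar>c0\<bar> + \<bar>a\<bar> + \<bar>b\<bar> + \<bar>i\<bar>" for a b i by linarith
        note this[of "AR - T / 2 * ln \<alpha>" "AL - T / 2 * ln lam" "Im I2"]
        also have "\<bar>c0\<bar> + \<bar>AR - T / 2 * ln \<alpha>\<bar> + \<bar>AL - T / 2 * ln lam\<bar> + \<bar>Im I2\<bar>
           \<le> \<bar>c0\<bar> + CR * ln T + CL * ln T + 600 * (ln (M / norm (L ?c)) + 1)"
          by (intro add_mono aR aL hz2 order_refl)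
        also have "\<dots> \<le> \<bar>c0\<bar> + CR * ln T + CL * ln T + 600 * ((\<bar>ln (4 * CG * 2 ^ 17)\<bar> + 17 * ln T) + 1)"
          by (intro add_left_mono mult_left_mono add_right_mono lnM) simp
        finally show ?thesis .
      qed
      also have "\<dots> = (CR + CL + 10200) * ln T + c1" by (simp add: c1_def algebra_simps)
      finally show ?thesis .
    qed
    then have "\<bar>2 * pi * S - T / 2 * ln (\<alpha> / lam)\<bar> \<le> C * ln T"
      unfolding C_def by (rule absorb_constant) (use T2 c1_def in auto)
    moreover have "2 * pi * S - T / 2 * ln (\<alpha> / lam) = 2 * pi * (S - T / (4 * pi) * ln (\<alpha> / lam))"
      by (simp add: field_simps)
    ultimately have "2 * pi * \<bar>S - T / (4 * pi) * ln (\<alpha> / lam)\<bar> \<le> C * ln T" by (simp add: abs_mult)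
    moreover have "1 * \<bar>S - T / (4 * pi) * ln (\<alpha> / lam)\<bar> \<le> 2 * pi * \<bar>S - T / (4 * pi) * ln (\<alpha> / lam)\<bar>"
      using pi_ge_two by (intro mult_right_mono) auto
    ultimately have "\<bar>S - T / (4 * pi) * ln (\<alpha> / lam)\<bar> \<le> C * ln T" by simp
    then show ?thesis by (simp only: S_def)
  qed
  have "t1 > 0" using t1 t0 by simp
  then show ?thesis by (rule that[OF _ no_left main])
qed

text \<open>The zeros up to height \<open>t1\<close> form a finite set with a constant contribution.
  For the others an arbitrary \<open>T\<close>, possibly the height of a zero, is replaced by a
  slightly larger \<open>T'\<close> without changing the set of zeros.\<close>

lemma zero_sum_bigo:
  "(\<lambda>T::real. (\<Sum>\<rho> \<in> {\<rho> \<in> lerch_nontrivial_zeros lam \<alpha>. 0 < Im \<rho> \<and> Im \<rho> \<le> T}.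
      of_int (zorder L \<rho>) * (Re \<rho> - 1 / 2)) - T / (4 * pi) * ln (\<alpha> / lam)) \<in> O[at_top](\<lambda>T. ln T)"
proof -
  let ?w = "\<lambda>\<rho>. of_int (zorder L \<rho>) * (Re \<rho> - 1 / 2) :: real"
  obtain t1 C where t1: "t1 > 0"
    and no_left: "\<And>z. L z = 0 \<Longrightarrow> -2 \<le> Re z \<Longrightarrow> Re z < -1 \<Longrightarrow> Im z \<le> t1"
    and est: "\<And>T. T \<ge> t1 + 22 \<Longrightarrow> (\<forall>z. L z = 0 \<longrightarrow> -2 \<le> Re z \<longrightarrow> Re z \<le> 3 \<longrightarrow> Im z \<noteq> T) \<Longrightarrow>
       \<bar>(\<Sum>\<rho>\<in>Z t1 T. ?w \<rho>) - T / (4 * pi) * ln (\<alpha> / lam)\<bar> \<le> C * ln T"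
    by (rule zero_sum_estimate) (rule that)
  define A where "A = {\<rho> \<in> lerch_nontrivial_zeros lam \<alpha>. 0 < Im \<rho> \<and> Im \<rho> \<le> t1}"
  have finA: "finite A"
    by (rule finite_subset[OF _ finite_zeros[of "-1" 2 0 t1]]) (use \<alpha> in \<open>auto simp: A_def lerch_nontrivial_zeros_def\<close>)
  have not_pole: "\<not> is_pole L z" if "Im z > 0" for z
    by (rule not_is_pole_holomorphic[OF open_halfspace_Im_gt _ L_holomorphic_upper]) (use that in auto)
  define k where "k = \<bar>sum ?w A\<bar> + \<bar>1 / (4 * pi) * ln (\<alpha> / lam)\<bar>"
  have bound: "\<bar>(\<Sum>\<rho> \<in> {\<rho> \<in> lerch_nontrivial_zeros lam \<alpha>. 0 < Im \<rho> \<and> Im \<rho> \<le> T}. ?w \<rho>) - T / (4 * pi) * ln (\<alpha> / lam)\<bar>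
     \<le> (2 * \<bar>C\<bar> + k / ln 2) * ln T" if T: "T \<ge> t1 + 22" for T
  proof -
    \<comment> \<open>No zero has height in \<open>(T, T']\<close>, so the closed condition
      \<open>Im \<rho> \<le> T\<close> becomes the open one \<open>Im \<rho> < T'\<close> of
      \<open>Z\<close>. Since \<open>T' - T < 1\<close>, the main term changes by
      \<open>O(1)\<close>.\<close>
    obtain T' where T': "T < T'" "T' < T + 1"
      "\<And>a. a \<in> Im ` {z. z \<noteq> 1 \<and> L z = 0 \<and> -2 \<le> Re z \<and> Re z \<le> 3 \<and> T \<le> Im z \<and> Im z \<le> T + 1} \<Longrightarrow> T < a \<Longrightarrow> T' < a"
      by (rule exists_gap[OF finite_imageI[OF finite_zeros]]) (rule that)
    have gap: "\<not> (T < Im z \<and> Im z \<le> T')" if z: "L z = 0" "-2 \<le> Re z" "Re z \<le> 3" for z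
    proof
      assume a: "T < Im z \<and> Im z \<le> T'"
      then have "z \<noteq> 1" using T t1 by auto
      with a have "Im z \<in> Im ` {z. z \<noteq> 1 \<and> L z = 0 \<and> -2 \<le> Re z \<and> Re z \<le> 3 \<and> T \<le> Im z \<and> Im z \<le> T + 1}"
        using z T' by (intro imageI) auto
      from T'(3)[OF this] a show False by simp
    qed
    have eq: "{\<rho> \<in> lerch_nontrivial_zeros lam \<alpha>. 0 < Im \<rho> \<and> Im \<rho> \<le> T} = A \<union> Z t1 T'"
    proof (intro equalityI subsetI)
      fix \<rho> assume r: "\<rho> \<in> {\<rho> \<in> lerch_nontrivial_zeros lam \<alpha>. 0 < Im \<rho> \<and> Im \<rho> \<le> T}"
      then show "\<rho> \<in> A \<union> Z t1 T'"
        using T' \<alpha> by (cases "Im \<rho> \<le> t1") (auto simp: A_def Z_def lerch_nontrivial_zeros_def)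
    next
      fix \<rho> assume "\<rho> \<in> A \<union> Z t1 T'"
      then show "\<rho> \<in> {\<rho> \<in> lerch_nontrivial_zeros lam \<alpha>. 0 < Im \<rho> \<and> Im \<rho> \<le> T}"
      proof
        assume "\<rho> \<in> A"
        then show ?thesis using T by (auto simp: A_def)
      next
        assume z: "\<rho> \<in> Z t1 T'"
        then have z': "L \<rho> = 0" "-2 \<le> Re \<rho>" "Re \<rho> \<le> 3" "t1 < Im \<rho>" "Im \<rho> < T'" by (auto simp: Z_def)
        have "Im \<rho> \<le> T" using gap[OF z'(1-3)] z' by linarith
        moreover have "Re \<rho> < 1 + \<alpha>" using L_nonzero_right[of \<rho>] z' by force
        moreover have "-1 \<le> Re \<rho>" using no_left[of \<rho>] z' by force
        moreover have "Im \<rho> > 0" using z' t1 by simp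
        ultimately show ?thesis using z' not_pole[of \<rho>] by (simp add: lerch_nontrivial_zeros_def)
      qed
    qed
    have finZ: "finite (Z t1 T')"
      by (rule finite_subset[OF _ finite_zeros[of "-2" 3 t1 T']]) (use t1 in \<open>auto simp: Z_def\<close>)
    have "(\<Sum>\<rho> \<in> {\<rho> \<in> lerch_nontrivial_zeros lam \<alpha>. 0 < Im \<rho> \<and> Im \<rho> \<le> T}. ?w \<rho>) = sum ?w A + sum ?w (Z t1 T')"
      unfolding eq by (rule sum.union_disjoint[OF finA finZ]) (auto simp: A_def Z_def)
    moreover have "\<bar>sum ?w (Z t1 T') - T' / (4 * pi) * ln (\<alpha> / lam)\<bar> \<le> C * ln T'"
    proof (rule est)
      show "T' \<ge> t1 + 22" using T T' by simp
      show "\<forall>z. L z = 0 \<longrightarrow> -2 \<le> Re z \<longrightarrow> Re z \<le> 3 \<longrightarrow> Im z \<noteq> T'" using gap T' by force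
    qed
    moreover have "C * ln T' \<le> 2 * \<bar>C\<bar> * ln T"
    proof -
      \<comment> \<open>A crude comparison that yields \<open>ln T' \<le> 2 * ln T\<close>.\<close>
      have "T' \<le> T ^ 2"
      proof -
        have "T' \<le> 2 * T" using T T' t1 by simp
        also have "\<dots> \<le> T * T" using T t1 by (intro mult_right_mono) auto
        finally show ?thesis by (simp add: power2_eq_square)
      qed
      then have "ln T' \<le> ln (T ^ 2)" using T T' t1 by (intro ln_mono) auto
      then have l: "ln T' \<le> 2 * ln T" using T t1 by (simp add: ln_realpow)
      have "ln T' \<ge> 0" using T T' t1 by simp
      then have "C * ln T' \<le> \<bar>C\<bar> * ln T'" by (intro mult_right_mono) auto
      also have "\<dots> \<le> \<bar>C\<bar> * (2 * ln T)" using l by (intro mult_left_mono) auto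
      finally show ?thesis by simp
    qed
    moreover have "\<bar>T' / (4 * pi) * ln (\<alpha> / lam) - T / (4 * pi) * ln (\<alpha> / lam)\<bar> \<le> \<bar>1 / (4 * pi) * ln (\<alpha> / lam)\<bar>"
    proof -
      have "T' / (4 * pi) * ln (\<alpha> / lam) - T / (4 * pi) * ln (\<alpha> / lam) = (T' - T) * (1 / (4 * pi) * ln (\<alpha> / lam))"
        by (simp add: field_simps)
      then have "\<bar>T' / (4 * pi) * ln (\<alpha> / lam) - T / (4 * pi) * ln (\<alpha> / lam)\<bar> = (T' - T) * \<bar>1 / (4 * pi) * ln (\<alpha> / lam)\<bar>"
        using T' by (simp add: abs_mult)
      also have "\<dots> \<le> 1 * \<bar>1 / (4 * pi) * ln (\<alpha> / lam)\<bar>" using T' by (intro mult_right_mono) auto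
      finally show ?thesis by simp
    qed
    ultimately have "\<bar>(\<Sum>\<rho> \<in> {\<rho> \<in> lerch_nontrivial_zeros lam \<alpha>. 0 < Im \<rho> \<and> Im \<rho> \<le> T}. ?w \<rho>) - T / (4 * pi) * ln (\<alpha> / lam)\<bar>
       \<le> 2 * \<bar>C\<bar> * ln T + k" unfolding k_def by linarith
    then show ?thesis by (rule absorb_constant) (use T t1 k_def in auto)
  qed
  show ?thesis
  proof (rule bigoI)
    show "eventually (\<lambda>T. norm ((\<Sum>\<rho> \<in> {\<rho> \<in> lerch_nontrivial_zeros lam \<alpha>. 0 < Im \<rho> \<and> Im \<rho> \<le> T}. ?w \<rho>) - T / (4 * pi) * ln (\<alpha> / lam))
       \<le> (2 * \<bar>C\<bar> + k / ln 2) * norm (ln T)) at_top"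
      using eventually_ge_at_top[of "t1 + 22"]
    proof eventually_elim
      case (elim T)
      then have "ln T \<ge> 0" using t1 by simp
      then show ?case using bound[OF elim] by simp
    qed
  qed
qed

end

theorem theorem1:
  fixes lam \<alpha> :: real
  assumes "0 < lam" "lam \<le> 1" "0 < \<alpha>" "\<alpha> \<le> 1"
  shows "(\<lambda>T::real.
            (\<Sum>\<rho> \<in> {\<rho> \<in> lerch_nontrivial_zeros lam \<alpha>. 0 < Im \<rho> \<and> Im \<rho> \<le> T}.
               of_int (zorder (lerch_zeta lam \<alpha>) \<rho>) * (Re \<rho> - 1 / 2))
            - T / (4 * pi) * ln (\<alpha> / lam))
         \<in> O[at_top](\<lambda>T. ln T)"
proof -
  interpret lerch_params lam \<alpha> by unfold_locales (use assms in auto)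
  show ?thesis by (rule zero_sum_bigo)
qed

end
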